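(* Let $k\ge2$ be an arbitrary constant integer. Consider $k$-careful voting on the Erdős–Rényi graph $G(n,p)$ with vertex set $V$, and suppose that $p=p(n)=\Omega(1/\sqrt n)$. Then, w.h.p. over $G(n,p)$, for every $A\subseteq V$, $T_{\mathrm{cons}}(A)=O(\log n)$ w.h.p.
   Context: $G(n,p)$ is the random graph on $n$ vertices in which each of the $\binom n2$ pairs is an edge independently with probability $p$. $k$-careful voting: each vertex holds opinion $0$ or $1$; in each synchronous round every vertex $v$ independently samples $k$ neighbours uniformly at random with replacement, and if all $k$ sampled opinions are the same, $v$ adopts that opinion; otherwise $v$ keeps its own. All vertices update simultaneously. $A_t$ is the set of vertices of opinion $0$ after $t$ rounds, and $T_{\mathrm{cons}}(A)=\min\{t\ge0:A_t\in\{\emptyset,V\}\}$ for the process started at $A_0=A$. Conventions: "w.h.p." means with probability at least $1-n^{-c}$ for a constant $c>0$, and $n$ is sufficiently large. The outer "w.h.p." refers to the randomness of the graph, the inner one to the randomness of the voting process on the realized graph. Constants hidden in $O$ and in w.h.p. do not depend on $n$, on the realized graph or on $A$. *)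

theory Defs
  imports "HOL-Probability.Probability" "HOL-Library.Landau_Symbols"
begin

text \<open>A simple graph on a vertex set is given by its set of edges, an edge being a
  two-element set of vertices.\<close>

definition vertex_pairs :: "'a set \<Rightarrow> 'a set set" where
  "vertex_pairs V = {e. e \<subseteq> V \<and> card e = 2}"

text \<open>The vertex set of \<open>G(n,p)\<close> is \<open>{..<n}\<close>.\<close>

definition random_graph :: "nat \<Rightarrow> real \<Rightarrow> nat set set pmf" where
  "random_graph n p =
     map_pmf (\<lambda>present. {e \<in> vertex_pairs {..<n}. present e})
       (Pi_pmf (vertex_pairs {..<n}) False (\<lambda>_. bernoulli_pmf p))"

definition neighbours :: "'a set set \<Rightarrow> 'a \<Rightarrow> 'a set" where
  "neighbours E v = {w. {v, w} \<in> E}"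

text \<open>The \<open>k\<close> samples taken by each vertex in one round. A vertex without neighbours
  has nothing to sample from; by convention it samples itself, and so keeps its opinion.
  Outside \<open>V\<close> the sample lists carry the irrelevant default \<open>[]\<close>.\<close>

definition round_samples :: "nat \<Rightarrow> 'a set \<Rightarrow> 'a set set \<Rightarrow> ('a \<Rightarrow> 'a list) pmf" where
  "round_samples k V E =
     Pi_pmf V [] (\<lambda>v. replicate_pmf k
       (pmf_of_set (if neighbours E v = {} then {v} else neighbours E v)))"

text \<open>An opinion is encoded as a truth value, \<open>True\<close> standing for opinion \<open>0\<close>. The rule is
  only used for nonempty lists of sampled opinions.\<close>

definition careful_rule :: "bool \<Rightarrow> bool list \<Rightarrow> bool" where
  "careful_rule own sampled = (if \<forall>b \<in> set sampled. b = hd sampled then hd sampled else own)"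

definition careful_update :: "'a set \<Rightarrow> ('a \<Rightarrow> 'a list) \<Rightarrow> 'a set \<Rightarrow> 'a set" where
  "careful_update V s A = {v \<in> V. careful_rule (v \<in> A) (map (\<lambda>w. w \<in> A) (s v))}"

text \<open>The process lives on the space of infinite sequences of independent rounds of samples;
  \<open>\<omega> !! t\<close> holds the samples that determine \<open>A\<^sub>t\<^sub>+\<^sub>1\<close> from \<open>A\<^sub>t\<close>.\<close>

definition voting_space ::
    "nat \<Rightarrow> 'a set \<Rightarrow> 'a set set \<Rightarrow> ('a \<Rightarrow> 'a list) stream measure" where
  "voting_space k V E = stream_space (measure_pmf (round_samples k V E))"

primrec opinion_set :: "'a set \<Rightarrow> 'a set \<Rightarrow> ('a \<Rightarrow> 'a list) stream \<Rightarrow> nat \<Rightarrow> 'a set" where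
  "opinion_set V A \<omega> 0 = A"
| "opinion_set V A \<omega> (Suc t) = careful_update V (\<omega> !! t) (opinion_set V A \<omega> t)"

text \<open>The value is \<open>\<infinity>\<close> if consensus is never reached.\<close>

definition consensus_time :: "'a set \<Rightarrow> 'a set \<Rightarrow> ('a \<Rightarrow> 'a list) stream \<Rightarrow> enat" where
  "consensus_time V A \<omega> = Inf {enat t | t. opinion_set V A \<omega> t \<in> {{}, V}}"

end

theory Submission
  imports Defs "HOL-Real_Asymp.Real_Asymp"
begin

text \<open>Weight the vertices by the stationary distribution of the simple random walk, let \<open>\<alpha>\<close> be the
  weight of the minority opinion and \<open>\<beta> = 1 / 2 - \<alpha>\<close> the bias. The truncated ratio
  \<open>\<Phi> = min 1 (R \<alpha> / (sqrt n \<beta>))\<close> contracts by a constant factor in expectation in every round,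
  from every state. If \<open>\<beta> \<ge> R / (4 sqrt n)\<close>, then the mean weight of the minority is at most
  \<open>\<alpha> (1 - c \<beta>)\<close>, hence the mean bias is at least \<open>\<beta> (1 + c \<alpha>)\<close>, and Chebyshev's inequality
  controls the fluctuations. If \<open>\<Phi> = 1\<close>, then the fluctuations of order \<open>1 / sqrt n\<close> push the bias
  beyond \<open>R / sqrt n\<close> with constant probability. As \<open>\<Phi>\<close> is at least \<open>n powr (- 2)\<close> before consensus, Markov's
  inequality finishes the proof after \<open>O(log n)\<close> rounds.

  The drift estimate needs the mixing bound \<open>\<Sum>\<^sub>v \<pi>(v) (x\<^sub>v - \<alpha>)\<^sup>2 = O(1 / sqrt n)\<close> for all vertex sets
  simultaneously, \<open>x\<^sub>v\<close> being the fraction of neighbours of \<open>v\<close> in the set. For this no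
  spectral theory of random matrices is required: a large deviation bound with exponent linear
  in \<open>n\<close> and a union bound over the \<open>2 ^ n\<close> sets suffice.\<close>

section \<open>Independent bits\<close>

text \<open>The ratio of \<alpha> to \<beta> is used because neither quantity has a uniform rate. In
  the mean, \<alpha> shrinks by the factor 1 - c \<beta> and \<beta> grows by 1 + c \<alpha>; the
  first rate degenerates near balance, the second near consensus. Their quotient stays away from 1
  everywhere, because \<alpha> + \<beta> = 1 / 2, so that one argument serves all stages. The
  obstacle lies near balance. The Taylor error of the mean is of the order of the mixing error,
  about 1 / (n p), and it must be beaten by a drift of order \<beta>. The hypothesis on p makes 1 /
  (n p) at most of the order 1 / sqrt n, which is also the size of the random fluctuations. Below
  the scale R / sqrt n the noise alone is used; above it the drift dominates the error, provided
  that R is large compared with the mixing constant \<kappa>. This dictates the order of choice: the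
  lower bound on p gives \<kappa>, then R is chosen, then the exponential parameter \<mu>, which has
  to be large enough for a jump beyond R / sqrt n. The resulting escape probability is tiny but
  independent of n.\<close>

abbreviation independent_bits :: "'a set \<Rightarrow> ('a \<Rightarrow> real) \<Rightarrow> ('a \<Rightarrow> bool) pmf" where
  "independent_bits V q \<equiv> Pi_pmf V False (\<lambda>v. bernoulli_pmf (q v))"

lemma finite_set_independent_bits:
  assumes "finite V"
  shows "finite (set_pmf (independent_bits V q))"
  by (rule finite_subset[OF set_Pi_pmf_subset'[OF assms]]) (use assms in auto)

lemma integrable_independent_bits:
  fixes F :: "('a \<Rightarrow> bool) \<Rightarrow> real"
  assumes "finite V"
  shows "integrable (measure_pmf (independent_bits V q)) F"
  by (intro integrable_measure_pmf_finite finite_set_independent_bits assms)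

text \<open>Conditioning on the bit at \<open>x\<close>; the moment formulas of this section follow
  from it by induction over the index set.\<close>

lemma expectation_independent_bits_insert:
  fixes F :: "('a \<Rightarrow> bool) \<Rightarrow> real"
  assumes "finite V" "x \<notin> V" "0 \<le> q x" "q x \<le> 1"
  shows "measure_pmf.expectation (independent_bits (insert x V) q) F =
    q x * measure_pmf.expectation (independent_bits V q) (\<lambda>B. F (B(x := True))) +
    (1 - q x) * measure_pmf.expectation (independent_bits V q) (\<lambda>B. F (B(x := False)))"
proof -
  have "measure_pmf.expectation (independent_bits (insert x V) q) F =
    measure_pmf.expectation (bernoulli_pmf (q x) \<bind> (\<lambda>b. map_pmf (\<lambda>B. B(x := b)) (independent_bits V q))) F"
    using assms by (simp add: Pi_pmf_insert' map_pmf_def)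
  also have "\<dots> = (\<Sum>b\<in>UNIV. pmf (bernoulli_pmf (q x)) b *\<^sub>R
      measure_pmf.expectation (map_pmf (\<lambda>B. B(x := b)) (independent_bits V q)) F)"
    using assms(1) by (intro pmf_expectation_bind) (simp_all add: finite_set_independent_bits)
  finally show ?thesis using assms by (simp add: UNIV_bool)
qed

lemma expectation_independent_bits_prod:
  fixes g :: "'a \<Rightarrow> bool \<Rightarrow> real"
  assumes "finite V" "\<And>v. v \<in> V \<Longrightarrow> 0 \<le> q v \<and> q v \<le> 1"
  shows "measure_pmf.expectation (independent_bits V q) (\<lambda>B. \<Prod>v\<in>V. g v (B v)) =
    (\<Prod>v\<in>V. q v * g v True + (1 - q v) * g v False)"
  using assms
proof (induction V rule: finite_induct)
  case (insert x V)
  have *: "(\<Prod>v\<in>V. g v ((B(x := b)) v)) = (\<Prod>v\<in>V. g v (B v))" for B b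
    using insert.hyps by (intro prod.cong) auto
  show ?case
    using insert.hyps insert.prems insert.IH
    by (subst expectation_independent_bits_insert, simp, simp, simp, simp)
      (simp add: * algebra_simps del: fun_upd_apply, simp add: algebra_simps)
qed auto

lemma expectation_independent_bits_sum:
  fixes w :: "'a \<Rightarrow> real"
  assumes "finite V" "\<And>v. v \<in> V \<Longrightarrow> 0 \<le> q v \<and> q v \<le> 1"
  shows "measure_pmf.expectation (independent_bits V q) (\<lambda>B. \<Sum>v\<in>V. w v * (of_bool (B v) - q v)) = 0"
  using assms
proof (induction V rule: finite_induct)
  case (insert x V)
  define S where "S = (\<lambda>B. \<Sum>v\<in>V. w v * (of_bool (B v) - q v))"
  have *: "(\<Sum>v\<in>insert x V. w v * (of_bool ((B(x := b)) v) - q v)) = w x * (of_bool b - q x) + S B" for B b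
    using insert.hyps by (auto simp: S_def intro!: sum.cong)
  have 0: "measure_pmf.expectation (independent_bits V q) S = 0"
    unfolding S_def using insert by auto
  have "measure_pmf.expectation (independent_bits V q) (\<lambda>B. c + S B) = c" for c
    using insert.hyps by (simp add: integrable_independent_bits 0)
  then show ?case
    using insert.hyps insert.prems
    by (subst expectation_independent_bits_insert, simp, simp, simp, simp)
       (simp only: *, simp add: algebra_simps)
qed auto

lemma expectation_independent_bits_sum_square:
  fixes w :: "'a \<Rightarrow> real"
  assumes "finite V" "\<And>v. v \<in> V \<Longrightarrow> 0 \<le> q v \<and> q v \<le> 1"
  shows "measure_pmf.expectation (independent_bits V q) (\<lambda>B. (\<Sum>v\<in>V. w v * (of_bool (B v) - q v))\<^sup>2) =
    (\<Sum>v\<in>V. (w v)\<^sup>2 * (q v * (1 - q v)))"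
  using assms
proof (induction V rule: finite_induct)
  case (insert x V)
  define S where "S = (\<lambda>B. \<Sum>v\<in>V. w v * (of_bool (B v) - q v))"
  have *: "(\<Sum>v\<in>insert x V. w v * (of_bool ((B(x := b)) v) - q v)) = w x * (of_bool b - q x) + S B" for B b
    using insert.hyps by (auto simp: S_def intro!: sum.cong)
  have 0: "measure_pmf.expectation (independent_bits V q) S = 0"
    unfolding S_def using insert by (intro expectation_independent_bits_sum) auto
  have 2: "measure_pmf.expectation (independent_bits V q) (\<lambda>B. (S B)\<^sup>2) = (\<Sum>v\<in>V. (w v)\<^sup>2 * (q v * (1 - q v)))"
    unfolding S_def using insert by auto
  have "measure_pmf.expectation (independent_bits V q) (\<lambda>B. (c + S B)\<^sup>2) = c\<^sup>2 + (\<Sum>v\<in>V. (w v)\<^sup>2 * (q v * (1 - q v)))" for c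
    using insert.hyps by (simp add: power2_sum integrable_independent_bits 0 2)
  then show ?case
    using insert.hyps insert.prems
    by (subst expectation_independent_bits_insert, simp, simp, simp, simp)
       (simp only: *, simp add: power2_eq_square algebra_simps)
qed auto

text \<open>Independence of functions of disjoint sets of coordinates. In the induction exactly one
  of \<open>F\<close> and \<open>G\<close> can feel the bit at the new index, so the two conditional
  averages still factor.\<close>

lemma expectation_independent_bits_mult:
  fixes F G :: "('a \<Rightarrow> bool) \<Rightarrow> real"
  assumes "finite V" "\<And>v. v \<in> V \<Longrightarrow> 0 \<le> q v \<and> q v \<le> 1"
    and "\<And>B B'. (\<And>v. v \<in> S \<Longrightarrow> B v = B' v) \<Longrightarrow> F B = F B'"
    and "\<And>B B'. (\<And>v. v \<notin> S \<Longrightarrow> B v = B' v) \<Longrightarrow> G B = G B'"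
  shows "measure_pmf.expectation (independent_bits V q) (\<lambda>B. F B * G B) =
    measure_pmf.expectation (independent_bits V q) F * measure_pmf.expectation (independent_bits V q) G"
  using assms
proof (induction V arbitrary: F G rule: finite_induct)
  case (insert x V)
  let ?E = "measure_pmf.expectation (independent_bits V q)"
  have q: "0 \<le> q x" "q x \<le> 1" and qV: "\<And>v. v \<in> V \<Longrightarrow> 0 \<le> q v \<and> q v \<le> 1"
    using insert.prems(1) by auto
  have "?E (\<lambda>B. F (B(x := b)) * G (B(x := b))) = ?E (\<lambda>B. F (B(x := b))) * ?E (\<lambda>B. G (B(x := b)))" for b
    using qV by (intro insert.IH) (auto intro!: insert.prems(2,3))
  moreover have "F (B(x := b)) = F B" if "x \<notin> S" for B b
    using that by (intro insert.prems) auto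
  moreover have "G (B(x := b)) = G B" if "x \<in> S" for B b
    using that by (intro insert.prems) auto
  ultimately show ?case
    using insert.hyps q
    by (cases "x \<in> S") (simp_all add: expectation_independent_bits_insert algebra_simps)
next
  case empty
  show ?case by simp
qed

text \<open>Splits off one block at a time. The blocks will be sets of edges: partial stars at
  different vertices, or the two edges of a path through a given middle vertex.\<close>

lemma expectation_independent_bits_prod_blocks:
  fixes F :: "'i \<Rightarrow> ('a \<Rightarrow> bool) \<Rightarrow> real"
  assumes "finite V" "\<And>v. v \<in> V \<Longrightarrow> 0 \<le> q v \<and> q v \<le> 1"
    and "finite I" "disjoint_family_on S I"
    and "\<And>i B B'. i \<in> I \<Longrightarrow> (\<And>v. v \<in> S i \<Longrightarrow> B v = B' v) \<Longrightarrow> F i B = F i B'"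
  shows "measure_pmf.expectation (independent_bits V q) (\<lambda>B. \<Prod>i\<in>I. F i B) =
    (\<Prod>i\<in>I. measure_pmf.expectation (independent_bits V q) (F i))"
  using assms(3-)
proof (induction I rule: finite_induct)
  case (insert i I)
  have "measure_pmf.expectation (independent_bits V q) (\<lambda>B. F i B * (\<Prod>j\<in>I. F j B)) =
    measure_pmf.expectation (independent_bits V q) (F i) * measure_pmf.expectation (independent_bits V q) (\<lambda>B. \<Prod>j\<in>I. F j B)"
  proof (rule expectation_independent_bits_mult[where S = "S i"])
    fix B B' :: "'a \<Rightarrow> bool" assume *: "\<And>v. v \<notin> S i \<Longrightarrow> B v = B' v"
    have "F j B = F j B'" if "j \<in> I" for j
    proof (rule insert.prems(2))
      fix v assume "v \<in> S j"
      then have "v \<notin> S i" using insert.prems(1) insert.hyps that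
        by (auto simp: disjoint_family_on_def)
      then show "B v = B' v" by (rule *)
    qed (use that in simp)
    then show "(\<Prod>j\<in>I. F j B) = (\<Prod>j\<in>I. F j B')" by (intro prod.cong) auto
  next
    show "F i B = F i B'" if "\<And>v. v \<in> S i \<Longrightarrow> B v = B' v" for B B'
      using insert.prems(2)[of i B B'] that by simp
  qed (use assms in simp_all)
  moreover have "disjoint_family_on S I"
    using insert.prems(1) by (auto simp: disjoint_family_on_def)
  moreover have "measure_pmf.expectation (independent_bits V q) (\<lambda>B. \<Prod>j\<in>I. F j B) =
    (\<Prod>j\<in>I. measure_pmf.expectation (independent_bits V q) (F j))"
    using calculation(2) insert.prems(2) by (intro insert.IH) blast+
  ultimately show ?case using insert.hyps by simp
next
  case empty
  show ?case by simp
qed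

lemma pmf_markov:
  fixes f :: "'a \<Rightarrow> real"
  assumes "finite (set_pmf p)" "a > 0" "\<And>x. x \<in> set_pmf p \<Longrightarrow> f x \<ge> 0"
  shows "measure_pmf.prob p {x. f x \<ge> a} \<le> measure_pmf.expectation p f / a"
proof -
  have "a * measure_pmf.prob p {x. f x \<ge> a} = measure_pmf.expectation p (\<lambda>x. a * indicator {x. f x \<ge> a} x)"
    by simp
  also have "\<dots> \<le> measure_pmf.expectation p f"
    using assms by (intro integral_mono_AE integrable_measure_pmf_finite)
      (auto simp: AE_measure_pmf_iff indicator_def)
  finally show ?thesis using assms by (simp add: field_simps)
qed

lemma chebyshev_independent_bits:
  fixes w :: "'a \<Rightarrow> real"
  assumes "finite V" "\<And>v. v \<in> V \<Longrightarrow> 0 \<le> q v \<and> q v \<le> 1" "t > 0"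
  shows "measure_pmf.prob (independent_bits V q) {B. (\<Sum>v\<in>V. w v * (of_bool (B v) - q v)) \<ge> t} \<le>
    (\<Sum>v\<in>V. (w v)\<^sup>2 * (q v * (1 - q v))) / t\<^sup>2"
proof -
  let ?S = "\<lambda>B. \<Sum>v\<in>V. w v * (of_bool (B v) - q v)"
  have "measure_pmf.prob (independent_bits V q) {B. ?S B \<ge> t} \<le>
    measure_pmf.prob (independent_bits V q) {B. (?S B)\<^sup>2 \<ge> t\<^sup>2}"
    using assms by (intro measure_pmf.finite_measure_mono) (auto intro!: power_mono)
  also have "\<dots> \<le> measure_pmf.expectation (independent_bits V q) (\<lambda>B. (?S B)\<^sup>2) / t\<^sup>2"
    using assms by (intro pmf_markov finite_set_independent_bits) auto
  finally show ?thesis by (simp add: expectation_independent_bits_sum_square assms)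
qed

section \<open>Exponential moments\<close>

lemma exp_le_quadratic:
  fixes u :: real
  assumes "\<bar>u\<bar> \<le> 1"
  shows "exp u \<le> 1 + u + u\<^sup>2"
proof -
  obtain t where t: "\<bar>t\<bar> \<le> \<bar>u\<bar>" "exp u = (\<Sum>m<3. u ^ m / fact m) + exp t / fact 3 * u ^ 3"
    using Maclaurin_exp_le[of u 3] by blast
  have "exp t \<le> exp 1" using t assms by simp
  then have "exp t \<le> 3" using exp_le by linarith
  have "exp t / 6 * u ^ 3 \<le> \<bar>exp t / 6 * u ^ 3\<bar>" by simp
  also have "\<dots> = (exp t / 6 * \<bar>u\<bar>) * u\<^sup>2" by (simp add: abs_mult power_abs power3_eq_cube power2_eq_square)
  also have "\<dots> \<le> (3 / 6 * 1) * u\<^sup>2"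
    using assms \<open>exp t \<le> 3\<close> by (intro mult_right_mono mult_mono) auto
  finally show ?thesis using t(2) by (simp add: lessThan_nat_numeral fact_numeral)
qed

lemma exp_ge_quadratic:
  fixes u :: real
  assumes "\<bar>u\<bar> \<le> 1"
  shows "exp u \<ge> 1 + u + u\<^sup>2 / 3"
proof -
  obtain t where t: "exp u = (\<Sum>m<4. u ^ m / fact m) + exp t / fact 4 * u ^ 4"
    using Maclaurin_exp_le[of u 4] by blast
  have 1: "exp u = 1 + u + u\<^sup>2 / 2 + u ^ 3 / 6 + exp t / fact 4 * u ^ 4"
    unfolding t by (simp add: lessThan_nat_numeral fact_numeral)
  \<comment> \<open>One sixth of this inequality absorbs the cubic term, which leaves 1 / 2 - 1 / 6
    = 1 / 3 of the square.\<close>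
  have "u\<^sup>2 * (1 + u) \<ge> 0" using assms by (intro mult_nonneg_nonneg) auto
  then have 2: "u\<^sup>2 + u ^ 3 \<ge> 0" by (simp add: power3_eq_cube power2_eq_square algebra_simps)
  have "exp t / fact 4 * u ^ 4 \<ge> 0" by (intro mult_nonneg_nonneg) auto
  then show ?thesis using 1 2 by argo
qed

lemma bernoulli_mgf_upper:
  fixes q w :: real
  assumes "0 \<le> q" "q \<le> 1" "\<bar>w\<bar> \<le> 1"
  shows "q * exp (w * (1 - q)) + (1 - q) * exp (w * (0 - q)) \<le> exp (w\<^sup>2 * (q * (1 - q)))"
proof -
  have 1: "\<bar>w * (1 - q)\<bar> \<le> 1" "\<bar>w * (0 - q)\<bar> \<le> 1"
    using assms mult_mono[of "\<bar>w\<bar>" 1 "1 - q" 1] mult_mono[of "\<bar>w\<bar>" 1 q 1] by (auto simp: abs_mult)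
  have "q * exp (w * (1 - q)) + (1 - q) * exp (w * (0 - q)) \<le>
    q * (1 + w * (1 - q) + (w * (1 - q))\<^sup>2) + (1 - q) * (1 + w * (0 - q) + (w * (0 - q))\<^sup>2)"
    using assms 1 by (intro add_mono mult_left_mono exp_le_quadratic) auto
  also have "\<dots> = 1 + w\<^sup>2 * (q * (1 - q))" by (simp add: power2_eq_square algebra_simps)
  also have "\<dots> \<le> exp (w\<^sup>2 * (q * (1 - q)))" by (rule exp_ge_add_one_self)
  finally show ?thesis .
qed

text \<open>The linear terms cancel and the quadratic bound gives 1 + 2 z, where z is one sixth of
  the variance. Returning to \<open>exp z\<close> by \<open>exp z \<le> 1 + 2 * z\<close> costs
  half, hence 6 instead of 3. This lower bound is what makes anticoncentration possible.\<close>

lemma bernoulli_mgf_lower: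
  fixes q w :: real
  assumes "0 \<le> q" "q \<le> 1" "\<bar>w\<bar> \<le> 1"
  shows "q * exp (w * (1 - q)) + (1 - q) * exp (w * (0 - q)) \<ge> exp (w\<^sup>2 * (q * (1 - q)) / 6)"
proof -
  have 1: "\<bar>w * (1 - q)\<bar> \<le> 1" "\<bar>w * (0 - q)\<bar> \<le> 1"
    using assms mult_mono[of "\<bar>w\<bar>" 1 "1 - q" 1] mult_mono[of "\<bar>w\<bar>" 1 q 1] by (auto simp: abs_mult)
  define z where "z = w\<^sup>2 * (q * (1 - q)) / 6"
  have "w\<^sup>2 \<le> 1" "0 \<le> q * (1 - q)" "q * (1 - q) \<le> 1" using assms mult_mono[of q 1 "1 - q" 1]
    by (auto simp: abs_square_le_1)
  then have z: "0 \<le> z" "z \<le> 1 / 6" using mult_mono[of "w\<^sup>2" 1 "q * (1 - q)" 1]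
    by (auto simp: z_def)
  have "exp z \<le> 1 + z + z\<^sup>2" using z by (intro exp_le_quadratic) auto
  also have "\<dots> \<le> 1 + 2 * z" using z mult_right_mono[of z 1 z] by (simp add: power2_eq_square)
  also have "\<dots> = q * (1 + w * (1 - q) + (w * (1 - q))\<^sup>2 / 3) + (1 - q) * (1 + w * (0 - q) + (w * (0 - q))\<^sup>2 / 3)"
    unfolding z_def by (simp add: power2_eq_square algebra_simps add_divide_distrib diff_divide_distrib)
  also have "\<dots> \<le> q * exp (w * (1 - q)) + (1 - q) * exp (w * (0 - q))"
    using assms 1 by (intro add_mono mult_left_mono exp_ge_quadratic) auto
  finally show ?thesis unfolding z_def .
qed

lemma independent_bits_mgf_eq:
  fixes w :: "'a \<Rightarrow> real"
  assumes "finite V" "\<And>v. v \<in> V \<Longrightarrow> 0 \<le> q v \<and> q v \<le> 1"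
  shows "measure_pmf.expectation (independent_bits V q) (\<lambda>B. exp (\<Sum>v\<in>V. w v * (of_bool (B v) - q v))) =
    (\<Prod>v\<in>V. q v * exp (w v * (1 - q v)) + (1 - q v) * exp (w v * (0 - q v)))"
  using expectation_independent_bits_prod[OF assms, where g = "\<lambda>v b. exp (w v * (of_bool b - q v))"] assms(1)
  by (simp add: exp_sum)

lemma independent_bits_mgf_upper:
  fixes w :: "'a \<Rightarrow> real"
  assumes "finite V" "\<And>v. v \<in> V \<Longrightarrow> 0 \<le> q v \<and> q v \<le> 1" "\<And>v. v \<in> V \<Longrightarrow> \<bar>w v\<bar> \<le> 1"
  shows "measure_pmf.expectation (independent_bits V q) (\<lambda>B. exp (\<Sum>v\<in>V. w v * (of_bool (B v) - q v))) \<le>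
    exp (\<Sum>v\<in>V. (w v)\<^sup>2 * (q v * (1 - q v)))"
  using assms
  by (subst independent_bits_mgf_eq, simp, simp, subst exp_sum, simp)
    (intro prod_mono conjI bernoulli_mgf_upper add_nonneg_nonneg mult_nonneg_nonneg, auto)

lemma independent_bits_mgf_lower:
  fixes w :: "'a \<Rightarrow> real"
  assumes "finite V" "\<And>v. v \<in> V \<Longrightarrow> 0 \<le> q v \<and> q v \<le> 1" "\<And>v. v \<in> V \<Longrightarrow> \<bar>w v\<bar> \<le> 1"
  shows "exp (\<Sum>v\<in>V. (w v)\<^sup>2 * (q v * (1 - q v)) / 6) \<le>
    measure_pmf.expectation (independent_bits V q) (\<lambda>B. exp (\<Sum>v\<in>V. w v * (of_bool (B v) - q v)))"
  using assms
  by (subst independent_bits_mgf_eq, simp, simp, subst exp_sum, simp)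
    (intro prod_mono conjI bernoulli_mgf_lower, auto)

text \<open>The usual appeal to Cauchy--Schwarz is replaced by \<open>X \<le> t X\<^sup>2 / 2 + 1 / (2 t)\<close>
  with \<open>t = L / (2 U)\<close>.\<close>

lemma paley_zygmund:
  fixes X :: "'a \<Rightarrow> real"
  assumes fin: "finite (set_pmf p)" and "L > 0" "U > 0"
    and L: "L \<le> measure_pmf.expectation p X" and U: "measure_pmf.expectation p (\<lambda>x. (X x)\<^sup>2) \<le> U"
  shows "L\<^sup>2 / (4 * U) \<le> measure_pmf.prob p {x. X x \<ge> L / 2}"
proof -
  define t where "t = L / (2 * U)"
  have t: "t > 0" using assms by (simp add: t_def)
  have *: "X x \<le> L / 2 + (t * (X x)\<^sup>2 / 2 + indicator {x. X x \<ge> L / 2} x / (2 * t))" for x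
  proof (cases "X x \<ge> L / 2")
    case True
    have "0 \<le> (t * X x - 1)\<^sup>2" by simp
    then have "2 * t * X x \<le> t * (t * (X x)\<^sup>2) + 1" by (simp add: power2_eq_square algebra_simps)
    then have "X x \<le> t * (X x)\<^sup>2 / 2 + 1 / (2 * t)" using t by (simp add: field_simps)
    then show ?thesis using True assms by simp
  next
    case False
    moreover have "0 \<le> t * (X x)\<^sup>2 / 2" using t by simp
    ultimately show ?thesis by (simp del: zero_le_divide_iff zero_le_mult_iff)
  qed
  let ?P = "measure_pmf.prob p {x. X x \<ge> L / 2}"
  have "L \<le> measure_pmf.expectation p (\<lambda>x. L / 2 + (t * (X x)\<^sup>2 / 2 + indicator {x. X x \<ge> L / 2} x / (2 * t)))"
    using * by (intro order_trans[OF L] integral_mono_AE integrable_measure_pmf_finite fin) auto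
  also have "\<dots> = L / 2 + (t * measure_pmf.expectation p (\<lambda>x. (X x)\<^sup>2) / 2 + ?P / (2 * t))"
    by (simp add: integrable_measure_pmf_finite[OF fin])
  also have "\<dots> \<le> L / 2 + (t * U / 2 + ?P / (2 * t))"
    using U t by (intro add_mono mult_left_mono divide_right_mono) auto
  also have "\<dots> = L / 2 + (L / 4 + ?P * U / L)"
    using assms by (simp add: t_def field_simps)
  finally have "L / 4 * L \<le> ?P * U / L * L" using assms by (intro mult_right_mono) linarith+
  then show ?thesis using assms by (simp add: field_simps power2_eq_square)
qed

text \<open>The exponential moment of \<open>\<mu>\<close> times the sum exceeds 1 by a factor \<open>exp (\<mu>\<^sup>2 s / 6)\<close>,
  which is why a large \<open>\<mu>\<close> yields deviations of many standard deviations with constant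
  probability, without a central limit theorem.\<close>

lemma independent_bits_anticoncentration:
  fixes w :: "'a \<Rightarrow> real"
  assumes V: "finite V" "\<And>v. v \<in> V \<Longrightarrow> 0 \<le> q v \<and> q v \<le> 1"
    and "\<mu> > 0" and w: "\<And>v. v \<in> V \<Longrightarrow> \<bar>w v\<bar> * (2 * \<mu>) \<le> 1"
    and "0 \<le> s" and s: "s \<le> (\<Sum>v\<in>V. (w v)\<^sup>2 * (q v * (1 - q v)))" and S: "(\<Sum>v\<in>V. (w v)\<^sup>2) \<le> S"
  shows "exp (- \<mu>\<^sup>2 * S) / 4 \<le> measure_pmf.prob (independent_bits V q)
    {B. (\<Sum>v\<in>V. w v * (of_bool (B v) - q v)) \<ge> \<mu> * s / 6 - ln 2 / \<mu>}"
proof -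
  let ?P = "independent_bits V q"
  let ?Z = "\<lambda>B. \<Sum>v\<in>V. w v * (of_bool (B v) - q v)"
  define X where "X = (\<lambda>B. exp (\<mu> * ?Z B))"
  define L where "L = exp (\<mu>\<^sup>2 * s / 6)"
  have w1: "\<bar>\<mu> * w v\<bar> \<le> 1" "\<bar>2 * \<mu> * w v\<bar> \<le> 1" if "v \<in> V" for v
  proof -
    have "2 * (\<mu> * \<bar>w v\<bar>) \<le> 1" "0 \<le> \<mu> * \<bar>w v\<bar>" using w[OF that] \<open>\<mu> > 0\<close> by (auto simp: ac_simps)
    then show "\<bar>\<mu> * w v\<bar> \<le> 1" "\<bar>2 * \<mu> * w v\<bar> \<le> 1"
      using \<open>\<mu> > 0\<close> by (auto simp: abs_mult)
  qed
  have q0: "0 \<le> q v * (1 - q v)" "q v * (1 - q v) \<le> 1 / 4" if "v \<in> V" for v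
  proof -
    show "0 \<le> q v * (1 - q v)" using V(2)[OF that] by simp
    have "0 \<le> (q v - 1 / 2)\<^sup>2" by simp
    then show "q v * (1 - q v) \<le> 1 / 4" by (simp add: power2_eq_square algebra_simps)
  qed
  have "\<mu>\<^sup>2 * s / 6 \<le> \<mu>\<^sup>2 * (\<Sum>v\<in>V. (w v)\<^sup>2 * (q v * (1 - q v))) / 6"
    using s by (intro divide_right_mono mult_left_mono) auto
  also have "\<dots> = (\<Sum>v\<in>V. (\<mu> * w v)\<^sup>2 * (q v * (1 - q v)) / 6)"
    by (simp add: sum_distrib_left sum_divide_distrib power_mult_distrib ac_simps)
  finally have "L \<le> exp \<dots>" unfolding L_def by simp
  also have "\<dots> \<le> measure_pmf.expectation ?P (\<lambda>B. exp (\<Sum>v\<in>V. (\<mu> * w v) * (of_bool (B v) - q v)))"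
    using V w1 by (intro independent_bits_mgf_lower) auto
  also have "\<dots> = measure_pmf.expectation ?P X"
    unfolding X_def by (simp add: sum_distrib_left ac_simps)
  finally have 1: "L \<le> measure_pmf.expectation ?P X" .
  have "measure_pmf.expectation ?P (\<lambda>B. (X B)\<^sup>2) =
     measure_pmf.expectation ?P (\<lambda>B. exp (\<Sum>v\<in>V. (2 * \<mu> * w v) * (of_bool (B v) - q v)))"
    unfolding X_def by (simp add: sum_distrib_left ac_simps flip: exp_double)
  also have "\<dots> \<le> exp (\<Sum>v\<in>V. (2 * \<mu> * w v)\<^sup>2 * (q v * (1 - q v)))"
    using V w1 by (intro independent_bits_mgf_upper) auto
  \<comment> \<open>The factor 4 from doubling the exponent cancels against the maximal Bernoulli
    variance 1 / 4.\<close>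
  also have "(\<Sum>v\<in>V. (2 * \<mu> * w v)\<^sup>2 * (q v * (1 - q v))) \<le> (\<Sum>v\<in>V. (2 * \<mu> * w v)\<^sup>2 * (1 / 4))"
    using q0 by (intro sum_mono mult_left_mono) auto
  also have "\<dots> = \<mu>\<^sup>2 * (\<Sum>v\<in>V. (w v)\<^sup>2)"
    by (simp add: sum_distrib_left power_mult_distrib ac_simps)
  also have "\<dots> \<le> \<mu>\<^sup>2 * S" using S by (intro mult_left_mono) auto
  finally have 2: "measure_pmf.expectation ?P (\<lambda>B. (X B)\<^sup>2) \<le> exp (\<mu>\<^sup>2 * S)" by simp
  have "1 \<le> L" using \<open>0 \<le> s\<close> by (simp add: L_def)
  then have "exp (- \<mu>\<^sup>2 * S) / 4 \<le> L\<^sup>2 / (4 * exp (\<mu>\<^sup>2 * S))"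
    by (simp add: exp_minus field_simps)
  also have "\<dots> \<le> measure_pmf.prob ?P {B. X B \<ge> L / 2}"
    using 1 2 \<open>1 \<le> L\<close> by (intro paley_zygmund finite_set_independent_bits V) auto
  also have "\<dots> \<le> measure_pmf.prob ?P {B. ?Z B \<ge> \<mu> * s / 6 - ln 2 / \<mu>}"
  proof (intro measure_pmf.finite_measure_mono subsetI)
    fix B assume "B \<in> {B. X B \<ge> L / 2}"
    then have "ln (L / 2) \<le> ln (X B)" using \<open>1 \<le> L\<close> by (intro ln_mono) (simp_all add: X_def)
    then have "\<mu>\<^sup>2 * s / 6 - ln 2 \<le> \<mu> * ?Z B"
      by (simp add: X_def L_def ln_div)
    then have "\<mu> * (\<mu> * s / 6 - ln 2 / \<mu>) \<le> \<mu> * ?Z B"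
      using \<open>\<mu> > 0\<close> by (simp add: power2_eq_square algebra_simps)
    then show "B \<in> {B. ?Z B \<ge> \<mu> * s / 6 - ln 2 / \<mu>}" using \<open>\<mu> > 0\<close> by simp
  qed simp
  finally show ?thesis .
qed

lemma independent_bits_block_mgf:
  assumes "finite V" "\<And>v. v \<in> V \<Longrightarrow> 0 \<le> p v \<and> p v \<le> 1" "S \<subseteq> V" "\<bar>\<theta>\<bar> \<le> 1"
  shows "measure_pmf.expectation (independent_bits V p) (\<lambda>B. exp (\<theta> * (\<Sum>v\<in>S. of_bool (B v) - p v))) \<le>
    exp (\<theta>\<^sup>2 * (\<Sum>v\<in>S. p v))"
proof -
  have *: "(\<Sum>v\<in>V. (\<theta> * of_bool (v \<in> S)) * f v) = \<theta> * (\<Sum>v\<in>S. f v)" for f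
  proof -
    have "(\<Sum>v\<in>V. (\<theta> * of_bool (v \<in> S)) * f v) = (\<Sum>v\<in>S. (\<theta> * of_bool (v \<in> S)) * f v)"
      using assms by (intro sum.mono_neutral_right) auto
    then show ?thesis by (simp add: sum_distrib_left)
  qed
  have "measure_pmf.expectation (independent_bits V p) (\<lambda>B. exp (\<theta> * (\<Sum>v\<in>S. of_bool (B v) - p v))) \<le>
    exp (\<Sum>v\<in>V. (\<theta> * of_bool (v \<in> S))\<^sup>2 * (p v * (1 - p v)))"
    unfolding *[symmetric] using assms by (intro independent_bits_mgf_upper) auto
  also have "(\<Sum>v\<in>V. (\<theta> * of_bool (v \<in> S))\<^sup>2 * (p v * (1 - p v))) =
     (\<Sum>v\<in>V. (\<theta> * of_bool (v \<in> S)) * (\<theta> * (p v * (1 - p v))))"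
    by (intro sum.cong) (auto simp: power2_eq_square)
  also have "\<dots> = \<theta> * (\<Sum>v\<in>S. \<theta> * (p v * (1 - p v)))" by (rule *)
  also have "\<dots> = (\<Sum>v\<in>S. \<theta>\<^sup>2 * (p v * (1 - p v)))"
    by (simp add: sum_distrib_left power2_eq_square ac_simps)
  also have "\<dots> \<le> (\<Sum>v\<in>S. \<theta>\<^sup>2 * p v)"
    using assms by (intro sum_mono mult_left_mono) (auto simp: mult_left_le)
  finally show ?thesis by (simp add: sum_distrib_left)
qed

lemma independent_bits_chernoff:
  assumes "finite V" "\<And>v. v \<in> V \<Longrightarrow> 0 \<le> p v \<and> p v \<le> 1" "S \<subseteq> V" "0 < \<theta>" "\<theta> \<le> 1"
  shows "measure_pmf.prob (independent_bits V p) {B. \<bar>\<Sum>v\<in>S. of_bool (B v) - p v\<bar> \<ge> t} \<le>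
    2 * exp (\<theta>\<^sup>2 * (\<Sum>v\<in>S. p v) - \<theta> * t)"
proof -
  let ?P = "independent_bits V p"
  let ?D = "\<lambda>B. \<Sum>v\<in>S. of_bool (B v) - p v"
  have *: "measure_pmf.prob ?P {B. exp (\<theta>' * ?D B) \<ge> exp (\<theta> * t)} \<le> exp (\<theta>\<^sup>2 * (\<Sum>v\<in>S. p v) - \<theta> * t)"
    if "\<bar>\<theta>'\<bar> = \<theta>" for \<theta>'
  proof -
    have "measure_pmf.prob ?P {B. exp (\<theta>' * ?D B) \<ge> exp (\<theta> * t)} \<le>
      measure_pmf.expectation ?P (\<lambda>B. exp (\<theta>' * ?D B)) / exp (\<theta> * t)"
      using assms by (intro pmf_markov finite_set_independent_bits) auto
    also have "\<dots> \<le> exp (\<theta>'\<^sup>2 * (\<Sum>v\<in>S. p v)) / exp (\<theta> * t)"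
      using assms that by (intro divide_right_mono independent_bits_block_mgf) auto
    also have "\<theta>'\<^sup>2 = \<theta>\<^sup>2" using that by auto
    finally show ?thesis by (simp add: exp_diff)
  qed
  have "measure_pmf.prob ?P {B. \<bar>?D B\<bar> \<ge> t} \<le>
    measure_pmf.prob ?P ({B. exp (\<theta> * ?D B) \<ge> exp (\<theta> * t)} \<union> {B. exp ((- \<theta>) * ?D B) \<ge> exp (\<theta> * t)})"
  proof (intro measure_pmf.finite_measure_mono subsetI)
    fix B assume "B \<in> {B. \<bar>?D B\<bar> \<ge> t}"
    then have "t \<le> ?D B \<or> t \<le> - ?D B" by auto
    then show "B \<in> {B. exp (\<theta> * ?D B) \<ge> exp (\<theta> * t)} \<union> {B. exp ((- \<theta>) * ?D B) \<ge> exp (\<theta> * t)}"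
      using assms(4) mult_left_mono[of t "?D B" \<theta>] mult_left_mono[of t "- ?D B" \<theta>] by auto
  qed simp
  also have "\<dots> \<le> measure_pmf.prob ?P {B. exp (\<theta> * ?D B) \<ge> exp (\<theta> * t)} +
      measure_pmf.prob ?P {B. exp ((- \<theta>) * ?D B) \<ge> exp (\<theta> * t)}"
    by (intro measure_Un_le) auto
  also have "\<dots> \<le> 2 * exp (\<theta>\<^sup>2 * (\<Sum>v\<in>S. p v) - \<theta> * t)"
    using *[of \<theta>] *[of "- \<theta>"] assms by simp
  finally show ?thesis .
qed

section \<open>The voting process\<close>

definition sampled_from :: "'a set set \<Rightarrow> 'a \<Rightarrow> 'a set" where
  "sampled_from E v = (if neighbours E v = {} then {v} else neighbours E v)"

definition fraction_in :: "'a set set \<Rightarrow> 'a set \<Rightarrow> 'a \<Rightarrow> real" where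
  "fraction_in E A v = real (card (sampled_from E v \<inter> A)) / real (card (sampled_from E v))"

text \<open>The conditional probability of holding opinion 0 after the round: a vertex of
  \<open>A\<close> loses this opinion only if all k samples avoid \<open>A\<close>, any other vertex
  gains it only if all k samples lie in \<open>A\<close>.\<close>

definition adoption_prob :: "nat \<Rightarrow> 'a set set \<Rightarrow> 'a set \<Rightarrow> 'a \<Rightarrow> real" where
  "adoption_prob k E A v =
    (if v \<in> A then 1 - (1 - fraction_in E A v) ^ k else fraction_in E A v ^ k)"

lemma Pi_pmf_map_dependent:
  assumes "finite V"
  shows "map_pmf (\<lambda>s v. if v \<in> V then h v (s v) else d') (Pi_pmf V d p) =
    Pi_pmf V d' (\<lambda>v. map_pmf (h v) (p v))"
  unfolding map_pmf_def using assms by (subst Pi_pmf_bind[where d' = d]) auto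

lemma prob_replicate_pmf_subset:
  assumes "countable A"
  shows "measure_pmf.prob (replicate_pmf k p) {xs. set xs \<subseteq> A} = measure_pmf.prob p A ^ k"
proof (induction k)
  case (Suc k)
  have "measure_pmf.prob (replicate_pmf (Suc k) p) {xs. set xs \<subseteq> A} =
    measure_pmf.prob (map_pmf (\<lambda>(x, xs). x # xs) (pair_pmf p (replicate_pmf k p))) {xs. set xs \<subseteq> A}"
    by (simp add: map_pmf_def pair_pmf_def bind_assoc_pmf bind_return_pmf)
  also have "\<dots> = measure_pmf.prob (pair_pmf p (replicate_pmf k p)) (A \<times> {xs. set xs \<subseteq> A})"
    by (auto intro!: arg_cong2[where f = measure])
  also have "\<dots> = measure_pmf.prob p A * measure_pmf.prob (replicate_pmf k p) {xs. set xs \<subseteq> A}"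
    using assms countable_lists[OF assms] by (intro measure_pmf_prob_product) (auto simp: lists_eq_set)
  finally show ?case using Suc by simp
qed auto

lemma bool_pmf_eq_bernoulli: "(p :: bool pmf) = bernoulli_pmf (pmf p True)"
proof (rule pmf_eqI)
  have "pmf p False = 1 - pmf p True"
    using sum_pmf_eq_1[of UNIV p] by (simp add: UNIV_bool[symmetric]) (simp add: UNIV_bool)
  then show "pmf p b = pmf (bernoulli_pmf (pmf p True)) b" for b
    by (cases b) (simp_all add: pmf_le_1)
qed

lemma careful_rule_sampled:
  assumes "finite N" "N \<noteq> {}" "k \<ge> 1"
  shows "map_pmf (\<lambda>xs. careful_rule own (map (\<lambda>w. w \<in> A) xs)) (replicate_pmf k (pmf_of_set N)) =
    bernoulli_pmf (if own then 1 - (1 - card (N \<inter> A) / card N) ^ k else (card (N \<inter> A) / card N) ^ k)"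
    (is "?p = _")
proof -
  let ?R = "replicate_pmf k (pmf_of_set N)"
  \<comment> \<open>The sample list is nonempty because k \<ge> 1, so \<open>hd\<close> in the
    voting rule is a genuine opinion.\<close>
  have R: "set xs \<subseteq> N \<and> xs \<noteq> []" if "xs \<in> set_pmf ?R" for xs
    using that assms by (auto simp: set_replicate_pmf)
  have prob: "measure_pmf.prob (pmf_of_set N) B = card (N \<inter> B) / card N" for B
    using assms by (simp add: measure_pmf_of_set)
  have "pmf ?p True = (if own then 1 - (1 - card (N \<inter> A) / card N) ^ k else (card (N \<inter> A) / card N) ^ k)"
  proof (cases own)
    case True
    have "careful_rule own (map (\<lambda>w. w \<in> A) xs) \<longleftrightarrow> \<not> set xs \<subseteq> N - A" if "xs \<in> set_pmf ?R" for xs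
      using R[OF that] True by (cases xs) (auto simp: careful_rule_def)
    then have "pmf ?p True = measure_pmf.prob ?R (- {xs. set xs \<subseteq> N - A})"
      unfolding pmf_map by (intro measure_pmf.finite_measure_eq_AE) (auto simp: AE_measure_pmf_iff)
    also have "\<dots> = 1 - measure_pmf.prob (pmf_of_set N) (N - A) ^ k"
      using measure_pmf.prob_compl[of "{xs. set xs \<subseteq> N - A}" ?R] assms
      by (simp add: prob_replicate_pmf_subset countable_finite Compl_eq_Diff_UNIV)
    also have "card (N \<inter> (N - A)) = card N - card (N \<inter> A)"
      using assms card_Diff_subset_Int[of N A] by (simp add: Int_absorb1)
    then have "measure_pmf.prob (pmf_of_set N) (N - A) = 1 - card (N \<inter> A) / card N"
      using assms card_mono[of N "N \<inter> A"] by (simp add: prob of_nat_diff diff_divide_distrib)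
    finally show ?thesis using True by simp
  next
    case False
    have "careful_rule own (map (\<lambda>w. w \<in> A) xs) \<longleftrightarrow> set xs \<subseteq> N \<inter> A" if "xs \<in> set_pmf ?R" for xs
      using R[OF that] False by (cases xs) (auto simp: careful_rule_def)
    then have "pmf ?p True = measure_pmf.prob ?R {xs. set xs \<subseteq> N \<inter> A}"
      unfolding pmf_map by (intro measure_pmf.finite_measure_eq_AE) (auto simp: AE_measure_pmf_iff)
    also have "\<dots> = measure_pmf.prob (pmf_of_set N) (N \<inter> A) ^ k"
      using assms by (intro prob_replicate_pmf_subset countable_finite) simp
    finally show ?thesis using False by (simp add: prob)
  qed
  then show ?thesis using bool_pmf_eq_bernoulli[of ?p] by simp
qed

text \<open>The vertices sample independently, so given \<open>A\<close> a round is a vector of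
  independent bits. All estimates for one round go through this description.\<close>

lemma careful_update_distribution:
  assumes "finite V" "k \<ge> 1" "\<And>v. v \<in> V \<Longrightarrow> neighbours E v \<subseteq> V"
  shows "map_pmf (\<lambda>s. careful_update V s A) (round_samples k V E) =
    map_pmf (\<lambda>B. {v. B v}) (independent_bits V (adoption_prob k E A))"
proof -
  let ?h = "\<lambda>v xs. careful_rule (v \<in> A) (map (\<lambda>w. w \<in> A) xs)"
  have "independent_bits V (adoption_prob k E A) =
    Pi_pmf V False (\<lambda>v. map_pmf (?h v) (replicate_pmf k (pmf_of_set (sampled_from E v))))"
  proof (intro Pi_pmf_cong refl)
    fix v assume "v \<in> V"
    then have "finite (sampled_from E v)"
      using finite_subset[OF assms(3) assms(1)] by (simp add: sampled_from_def)
    moreover have "sampled_from E v \<noteq> {}" by (simp add: sampled_from_def)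
    ultimately show "bernoulli_pmf (adoption_prob k E A v) =
      map_pmf (?h v) (replicate_pmf k (pmf_of_set (sampled_from E v)))"
      using assms(2) by (simp add: careful_rule_sampled adoption_prob_def fraction_in_def)
  qed
  also have "\<dots> = map_pmf (\<lambda>s v. if v \<in> V then ?h v (s v) else False) (round_samples k V E)"
    unfolding round_samples_def sampled_from_def[abs_def]
    by (rule Pi_pmf_map_dependent[OF assms(1), symmetric])
  finally show ?thesis
    by (auto simp: map_pmf_comp careful_update_def intro!: map_pmf_cong)
qed

section \<open>Measurability of the process, and from a contracting potential to the tail of the
  consensus time\<close>

lemma opinion_set_Stream:
  "opinion_set V A (s ## \<omega>) (Suc t) = opinion_set V (careful_update V s A) \<omega> t"
  by (induction t) auto

lemma opinion_set_subset: "A \<subseteq> V \<Longrightarrow> opinion_set V A \<omega> t \<subseteq> V"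
  by (cases t) (auto simp: careful_update_def)

text \<open>There are finitely many possible states after the first round, so the event is a finite
  union, over these states, of an event of the head intersected with an event of the tail.\<close>

lemma pred_opinion_set:
  assumes "finite V" "A \<subseteq> V"
  shows "Measurable.pred (stream_space (measure_pmf M)) (\<lambda>\<omega>. opinion_set V A \<omega> t \<in> X)"
  using assms(2)
proof (induction t arbitrary: A)
  case (Suc t)
  have eq: "opinion_set V A \<omega> (Suc t) \<in> X \<longleftrightarrow>
    (\<exists>A'\<in>Pow V. careful_update V (shd \<omega>) A = A' \<and> opinion_set V A' (stl \<omega>) t \<in> X)" for \<omega>
    using opinion_set_Stream[of V A "shd \<omega>" "stl \<omega>" t] by (auto simp: careful_update_def)
  have [measurable]: "Measurable.pred (stream_space (measure_pmf M)) (\<lambda>\<omega>. opinion_set V A' (stl \<omega>) t \<in> X)"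
    if "A' \<in> Pow V" for A'
    using that by (intro measurable_compose[OF measurable_stl Suc.IH]) auto
  have [measurable]: "Measurable.pred (stream_space (measure_pmf M)) (\<lambda>\<omega>. careful_update V (shd \<omega>) A = A')" for A'
    by (rule measurable_compose[OF measurable_shd]) auto
  show ?case unfolding eq using assms(1)
    by (intro pred_intros_finite pred_intros_logic) auto
qed auto

lemma measurable_opinion_set:
  assumes "finite V" "A \<subseteq> V"
  shows "(\<lambda>\<omega>. opinion_set V A \<omega> t) \<in> stream_space (measure_pmf M) \<rightarrow>\<^sub>M count_space (Pow V)"
proof (rule measurable_count_space_eq2[THEN iffD2])
  show "finite (Pow V)" using assms by simp
  show "(\<lambda>\<omega>. opinion_set V A \<omega> t) \<in> space (stream_space (measure_pmf M)) \<rightarrow> Pow V \<and>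
    (\<forall>a\<in>Pow V. (\<lambda>\<omega>. opinion_set V A \<omega> t) -` {a} \<inter> space (stream_space (measure_pmf M)) \<in> sets (stream_space (measure_pmf M)))"
  proof (intro conjI ballI)
    show "(\<lambda>\<omega>. opinion_set V A \<omega> t) \<in> space (stream_space (measure_pmf M)) \<rightarrow> Pow V"
      using opinion_set_subset[OF assms(2)] by auto
    fix a
    have "{\<omega> \<in> space (stream_space (measure_pmf M)). opinion_set V A \<omega> t \<in> {a}} \<in> sets (stream_space (measure_pmf M))"
      using pred_opinion_set[OF assms] by (rule predE)
    then show "(\<lambda>\<omega>. opinion_set V A \<omega> t) -` {a} \<inter> space (stream_space (measure_pmf M)) \<in> sets (stream_space (measure_pmf M))"
      by (auto simp: vimage_def Int_def conj_commute elim!: back_subst[of "\<lambda>S. S \<in> _"])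
  qed
qed

text \<open>Peeling off the first round instead of the last lets the product structure of the stream
  space act as the Markov property: the tail is a fresh process started from the updated
  set.\<close>

lemma opinion_set_contraction:
  fixes \<Phi> :: "'a set \<Rightarrow> ennreal"
  assumes "finite V" "A \<subseteq> V"
    and step: "\<And>A. A \<subseteq> V \<Longrightarrow> (\<integral>\<^sup>+s. \<Phi> (careful_update V s A) \<partial>measure_pmf (round_samples k V E)) \<le> \<rho> * \<Phi> A"
  shows "(\<integral>\<^sup>+\<omega>. \<Phi> (opinion_set V A \<omega> t) \<partial>voting_space k V E) \<le> \<rho> ^ t * \<Phi> A"
  using assms(2)
proof (induction t arbitrary: A)
  case 0
  interpret S: prob_space "voting_space k V E"
    unfolding voting_space_def by (intro prob_space.prob_space_stream_space measure_pmf.prob_space_axioms)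
  show ?case using S.emeasure_space_1 by simp
next
  case (Suc t)
  let ?M = "measure_pmf (round_samples k V E)"
  have sub: "careful_update V s A \<subseteq> V" for s by (auto simp: careful_update_def)
  have [measurable]: "(\<lambda>\<omega>. \<Phi> (opinion_set V A \<omega> (Suc t))) \<in> borel_measurable (stream_space ?M)"
    by (rule measurable_compose[OF measurable_opinion_set[OF assms(1) Suc.prems]]) simp
  have "(\<integral>\<^sup>+\<omega>. \<Phi> (opinion_set V A \<omega> (Suc t)) \<partial>voting_space k V E) =
    (\<integral>\<^sup>+s. \<integral>\<^sup>+\<omega>. \<Phi> (opinion_set V (careful_update V s A) \<omega> t) \<partial>voting_space k V E \<partial>?M)"
    unfolding voting_space_def by (subst prob_space.nn_integral_stream_space[OF measure_pmf.prob_space_axioms]) (simp_all only: opinion_set_Stream, measurable)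
  also have "\<dots> \<le> (\<integral>\<^sup>+s. \<rho> ^ t * \<Phi> (careful_update V s A) \<partial>?M)"
    by (intro nn_integral_mono Suc.IH sub)
  also have "\<dots> = \<rho> ^ t * (\<integral>\<^sup>+s. \<Phi> (careful_update V s A) \<partial>?M)"
    by (rule nn_integral_cmult) simp
  also have "\<dots> \<le> \<rho> ^ t * (\<rho> * \<Phi> A)"
    by (intro mult_left_mono step Suc.prems) simp
  finally show ?case by (simp add: ac_simps)
qed

lemma consensus_time_le:
  assumes "opinion_set V A \<omega> t \<in> {{}, V}"
  shows "consensus_time V A \<omega> \<le> enat t"
  unfolding consensus_time_def by (rule Inf_lower) (use assms in blast)

lemma consensus_time_attained:
  assumes "consensus_time V A \<omega> \<noteq> \<infinity>"
  obtains t where "consensus_time V A \<omega> = enat t" "opinion_set V A \<omega> t \<in> {{}, V}"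
proof -
  let ?S = "{enat t | t. opinion_set V A \<omega> t \<in> {{}, V}}"
  have "?S \<noteq> {}" using assms unfolding consensus_time_def Inf_enat_def by presburger
  then have "(LEAST x. x \<in> ?S) \<in> ?S" by (metis (mono_tags, lifting) LeastI ex_in_conv)
  then have "consensus_time V A \<omega> \<in> ?S"
    using \<open>?S \<noteq> {}\<close> unfolding consensus_time_def Inf_enat_def by presburger
  then show ?thesis using that by blast
qed

text \<open>Iterated contraction makes the mean of \<open>\<Phi>\<close> at time \<open>t\<close> at
  most \<open>\<rho> ^ t\<close>, while \<open>\<Phi>\<close> is at least \<open>\<phi>\<close>
  outside consensus, so Markov's inequality applies. Consensus at time \<open>t\<close> bounds the
  first such time by \<open>t\<close>.\<close>

lemma consensus_time_tail:
  fixes \<Phi> :: "'a set \<Rightarrow> real"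
  assumes "finite V" "A \<subseteq> V" "0 \<le> \<rho>" "0 < \<phi>"
    and nonneg: "\<And>A. A \<subseteq> V \<Longrightarrow> 0 \<le> \<Phi> A"
    and le_1: "\<And>A. A \<subseteq> V \<Longrightarrow> \<Phi> A \<le> 1"
    and ge: "\<And>A. A \<subseteq> V \<Longrightarrow> A \<noteq> {} \<Longrightarrow> A \<noteq> V \<Longrightarrow> \<phi> \<le> \<Phi> A"
    and step: "\<And>A. A \<subseteq> V \<Longrightarrow>
      measure_pmf.expectation (round_samples k V E) (\<lambda>s. \<Phi> (careful_update V s A)) \<le> \<rho> * \<Phi> A"
    and T: "real t \<le> T"
  shows "1 - \<rho> ^ t / \<phi> \<le> measure (voting_space k V E)
    {\<omega> \<in> space (voting_space k V E). ereal_of_enat (consensus_time V A \<omega>) \<le> ereal T}"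
proof -
  interpret S: prob_space "voting_space k V E"
    unfolding voting_space_def by (intro prob_space.prob_space_stream_space measure_pmf.prob_space_axioms)
  let ?X = "opinion_set V A"
  let ?bad = "{\<omega> \<in> space (voting_space k V E). ?X \<omega> t \<notin> {{}, V}}"
  have meas: "(\<lambda>\<omega>. ?X \<omega> t) \<in> voting_space k V E \<rightarrow>\<^sub>M count_space (Pow V)" for t
    unfolding voting_space_def using assms(1,2) by (rule measurable_opinion_set)
  have bad: "?bad \<in> sets (voting_space k V E)"
  proof -
    have "?bad = (\<lambda>\<omega>. ?X \<omega> t) -` (Pow V - {{}, V}) \<inter> space (voting_space k V E)"
      using opinion_set_subset[OF assms(2)] by blast
    then show ?thesis using measurable_sets[OF meas[of t], of "Pow V - {{}, V}"] by simp
  qed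
  have sub: "careful_update V s A \<subseteq> V" for s A by (auto simp: careful_update_def)
  have "ennreal \<phi> * emeasure (voting_space k V E) ?bad = (\<integral>\<^sup>+\<omega>. ennreal \<phi> * indicator ?bad \<omega> \<partial>voting_space k V E)"
    using bad by (simp add: nn_integral_cmult_indicator)
  also have "\<dots> \<le> (\<integral>\<^sup>+\<omega>. ennreal (\<Phi> (?X \<omega> t)) \<partial>voting_space k V E)"
    using ge opinion_set_subset[OF assms(2)]
    by (intro nn_integral_mono) (auto simp: indicator_def intro!: ennreal_leI)
  also have "\<dots> \<le> ennreal \<rho> ^ t * ennreal (\<Phi> A)"
  proof (rule opinion_set_contraction[OF assms(1,2)])
    fix A assume "A \<subseteq> V"
    have "(\<integral>\<^sup>+s. ennreal (\<Phi> (careful_update V s A)) \<partial>measure_pmf (round_samples k V E)) =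
      ennreal (measure_pmf.expectation (round_samples k V E) (\<lambda>s. \<Phi> (careful_update V s A)))"
      using nonneg le_1 sub
      by (intro nn_integral_eq_integral measure_pmf.integrable_const_bound[where B = 1]) auto
    also have "\<dots> \<le> ennreal \<rho> * ennreal (\<Phi> A)"
      using step[OF \<open>A \<subseteq> V\<close>] assms(3) nonneg[OF \<open>A \<subseteq> V\<close>] by (simp add: ennreal_leI flip: ennreal_mult)
    finally show "(\<integral>\<^sup>+s. ennreal (\<Phi> (careful_update V s A)) \<partial>measure_pmf (round_samples k V E)) \<le>
      ennreal \<rho> * ennreal (\<Phi> A)" .
  qed
  also have "\<dots> = ennreal (\<rho> ^ t * \<Phi> A)"
    using assms(3) nonneg[OF assms(2)] by (simp add: ennreal_power ennreal_mult)
  finally have "\<phi> * S.prob ?bad \<le> \<rho> ^ t * \<Phi> A"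
    using assms(3,4) nonneg[OF assms(2)]
    by (simp add: S.emeasure_eq_measure flip: ennreal_mult)
  also have "\<dots> \<le> \<rho> ^ t" using assms(3) le_1[OF assms(2)] nonneg[OF assms(2)] by (intro mult_left_le) auto
  finally have 1: "S.prob ?bad \<le> \<rho> ^ t / \<phi>" using assms(4) by (simp add: field_simps)
  let ?good = "{\<omega> \<in> space (voting_space k V E). ereal_of_enat (consensus_time V A \<omega>) \<le> ereal T}"
  have good: "?good \<in> sets (voting_space k V E)"
  proof -
    \<comment> \<open>For measurability: a finite consensus time is attained, so the event is a
      countable union over the times up to \<open>T\<close>.\<close>
    have "?good = (\<Union>t\<in>{t. real t \<le> T}. (\<lambda>\<omega>. ?X \<omega> t) -` ({{}, V} \<inter> Pow V) \<inter> space (voting_space k V E))"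
    proof (intro set_eqI iffI)
      fix \<omega> assume \<omega>: "\<omega> \<in> ?good"
      then have "consensus_time V A \<omega> \<noteq> \<infinity>"
        by (cases "consensus_time V A \<omega>") auto
      then obtain t where t: "consensus_time V A \<omega> = enat t" "?X \<omega> t \<in> {{}, V}"
        by (rule consensus_time_attained)
      then show "\<omega> \<in> (\<Union>t\<in>{t. real t \<le> T}. (\<lambda>\<omega>. ?X \<omega> t) -` ({{}, V} \<inter> Pow V) \<inter> space (voting_space k V E))"
        using \<omega> by auto
    next
      fix \<omega> assume "\<omega> \<in> (\<Union>t\<in>{t. real t \<le> T}. (\<lambda>\<omega>. ?X \<omega> t) -` ({{}, V} \<inter> Pow V) \<inter> space (voting_space k V E))"
      then obtain t where t: "real t \<le> T" "?X \<omega> t \<in> {{}, V}" "\<omega> \<in> space (voting_space k V E)" by auto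
      have "ereal_of_enat (consensus_time V A \<omega>) \<le> ereal_of_enat (enat t)"
        using consensus_time_le[OF t(2)] by (simp only: ereal_of_enat_le_iff)
      also have "\<dots> \<le> ereal T" using t by simp
      finally show "\<omega> \<in> ?good" using t by simp
    qed
    also have "\<dots> \<in> sets (voting_space k V E)"
      by (intro sets.countable_UN'' measurable_sets[OF meas]) auto
    finally show ?thesis .
  qed
  have "1 - S.prob ?bad = S.prob (space (voting_space k V E) - ?bad)"
    using bad by (simp add: S.prob_compl)
  also have "\<dots> \<le> S.prob ?good"
  proof (intro S.finite_measure_mono good subsetI)
    fix \<omega> assume "\<omega> \<in> space (voting_space k V E) - ?bad"
    then have *: "\<omega> \<in> space (voting_space k V E)" "?X \<omega> t \<in> {{}, V}" by auto
    have "ereal_of_enat (consensus_time V A \<omega>) \<le> ereal_of_enat (enat t)"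
      using consensus_time_le[OF *(2)] by (simp only: ereal_of_enat_le_iff)
    also have "\<dots> \<le> ereal T" using T by simp
    finally show "\<omega> \<in> ?good" using * by simp
  qed
  finally show ?thesis using 1 by simp
qed

section \<open>The drift of the mean\<close>

lemma power_ge_tangent:
  fixes a z :: real
  assumes "0 \<le> a" "0 \<le> z"
  shows "a ^ k + real k * a ^ (k - 1) * (z - a) \<le> z ^ k"
proof (induction k)
  case (Suc k)
  have "a ^ Suc k + real (Suc k) * a ^ k * (z - a) \<le> z * (a ^ k + real k * a ^ (k - 1) * (z - a))"
  proof (cases k)
    case (Suc j)
    have "0 \<le> real k * a ^ (k - 1) * (z - a)\<^sup>2" using assms by simp
    then show ?thesis using Suc by (simp add: power2_eq_square algebra_simps)
  qed (simp add: algebra_simps)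
  also have "\<dots> \<le> z * z ^ k" using Suc assms by (intro mult_left_mono) auto
  finally show ?case by simp
qed simp

text \<open>Multiplication by \<open>z\<close> raises the quadratic coefficient to at most k + k^2,
  which (k + 1)^2 dominates; hence the crude constant k^2.\<close>

lemma power_le_tangent:
  fixes a z :: real
  assumes "0 \<le> a" "a \<le> 1" "0 \<le> z" "z \<le> 1"
  shows "z ^ k \<le> a ^ k + real k * a ^ (k - 1) * (z - a) + (real k)\<^sup>2 * (z - a)\<^sup>2"
proof (induction k)
  case (Suc k)
  have "z * z ^ k \<le> z * (a ^ k + real k * a ^ (k - 1) * (z - a) + (real k)\<^sup>2 * (z - a)\<^sup>2)"
    using Suc assms by (intro mult_left_mono) auto
  also have "\<dots> = a ^ Suc k + real (Suc k) * a ^ k * (z - a) +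
      (real k * a ^ (k - 1) + z * (real k)\<^sup>2) * (z - a)\<^sup>2"
    by (cases k) (simp_all add: power2_eq_square algebra_simps)
  also have "real k * a ^ (k - 1) + z * (real k)\<^sup>2 \<le> real k * 1 + 1 * (real k)\<^sup>2"
    using assms by (intro add_mono mult_left_mono mult_right_mono power_le_one) auto
  then have "real k * a ^ (k - 1) + z * (real k)\<^sup>2 \<le> (real (Suc k))\<^sup>2"
    by (simp add: power2_eq_square algebra_simps)
  then have "(real k * a ^ (k - 1) + z * (real k)\<^sup>2) * (z - a)\<^sup>2 \<le> (real (Suc k))\<^sup>2 * (z - a)\<^sup>2"
    by (intro mult_right_mono) auto
  finally show ?case by simp
qed simp

text \<open>To be used with a = 1 - \<alpha> and b = \<alpha>, where a - b is twice the bias. The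
  lower bound keeps a single term of the factorization of \<open>a ^ j - b ^ j\<close>, the upper
  bound is the tangent inequality.\<close>

lemma power_difference_bounds:
  fixes a b :: real
  assumes "0 \<le> b" "b \<le> a" "1 / 2 \<le> a" "a \<le> 1" "j \<ge> 1"
  shows "(a - b) * (1 / 2) ^ (j - 1) \<le> a ^ j - b ^ j" "a ^ j - b ^ j \<le> real j * (a - b)"
proof -
  obtain i where j: "j = Suc i" using assms by (cases j) auto
  have "(a - b) * (1 / 2) ^ i \<le> (a - b) * a ^ i"
    using assms by (intro mult_left_mono power_mono) auto
  also have "\<dots> \<le> a ^ j - b ^ j"
    using assms mult_left_mono[of "b ^ i" "a ^ i" b] power_mono[of b a i] by (simp add: j algebra_simps)
  finally show "(a - b) * (1 / 2) ^ (j - 1) \<le> a ^ j - b ^ j" by (simp add: j)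
  have "a ^ j - b ^ j \<le> real j * a ^ (j - 1) * (a - b)"
    using power_ge_tangent[of a b j] assms by (simp add: algebra_simps)
  also have "\<dots> \<le> real j * 1 * (a - b)"
    using assms by (intro mult_right_mono mult_left_mono power_le_one) auto
  finally show "a ^ j - b ^ j \<le> real j * (a - b)" by simp
qed

text \<open>Keeping the first factor on \<open>A\<close> yields the weight of \<open>A\<close>, so
  that the cross term of the drift remains small relative to this weight near consensus.\<close>

lemma weighted_cauchy_schwarz:
  fixes \<pi> y :: "'a \<Rightarrow> real"
  assumes "finite V" "A \<subseteq> V" "\<And>v. v \<in> V \<Longrightarrow> 0 \<le> \<pi> v"
  shows "(\<Sum>v\<in>A. \<pi> v * y v)\<^sup>2 \<le> (\<Sum>v\<in>A. \<pi> v) * (\<Sum>v\<in>V. \<pi> v * (y v)\<^sup>2)"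
proof -
  have pi: "0 \<le> \<pi> v" if "v \<in> A" for v using that assms by auto
  have "(\<Sum>v\<in>A. \<pi> v * y v)\<^sup>2 = (\<Sum>v\<in>A. sqrt (\<pi> v) * (sqrt (\<pi> v) * y v))\<^sup>2"
    using pi by (intro arg_cong[where f = "\<lambda>x. x\<^sup>2"] sum.cong) (auto simp flip: mult.assoc)
  also have "\<dots> \<le> (\<Sum>v\<in>A. (sqrt (\<pi> v))\<^sup>2) * (\<Sum>v\<in>A. (sqrt (\<pi> v) * y v)\<^sup>2)"
    by (rule Cauchy_Schwarz_ineq_sum)
  also have "(\<Sum>v\<in>A. (sqrt (\<pi> v))\<^sup>2) = (\<Sum>v\<in>A. \<pi> v)" using pi by (intro sum.cong) auto
  also have "(\<Sum>v\<in>A. (sqrt (\<pi> v) * y v)\<^sup>2) = (\<Sum>v\<in>A. \<pi> v * (y v)\<^sup>2)"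
    using pi by (intro sum.cong) (auto simp: power_mult_distrib)
  also have "(\<Sum>v\<in>A. \<pi> v) * (\<Sum>v\<in>A. \<pi> v * (y v)\<^sup>2) \<le> (\<Sum>v\<in>A. \<pi> v) * (\<Sum>v\<in>V. \<pi> v * (y v)\<^sup>2)"
    using assms pi by (intro mult_left_mono sum_mono2 sum_nonneg) auto
  finally show ?thesis .
qed

text \<open>In the Taylor expansion of the mean around \<open>x v = \<alpha>\<close>, stationarity of \<open>\<pi>\<close> makes the linear
  terms cancel up to the factor \<open>(1 - \<alpha>) ^ (k - 1) - \<alpha> ^ (k - 1)\<close>, which is of the order of
  the bias \<open>1 / 2 - \<alpha>\<close>.\<close>

lemma careful_mean_le:
  fixes \<pi> x :: "'a \<Rightarrow> real" and A V :: "'a set" and k :: nat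
  defines "\<alpha> \<equiv> sum \<pi> A"
  defines "\<beta> \<equiv> 1 / 2 - \<alpha>"
  defines "Q \<equiv> \<Sum>v\<in>V. \<pi> v * (x v - \<alpha>)\<^sup>2"
  assumes V: "finite V" "A \<subseteq> V" and pi: "\<And>v. v \<in> V \<Longrightarrow> 0 \<le> \<pi> v" "sum \<pi> V = 1"
    and x: "\<And>v. v \<in> V \<Longrightarrow> 0 \<le> x v \<and> x v \<le> 1" and stationary: "(\<Sum>v\<in>V. \<pi> v * x v) = \<alpha>"
    and "k \<ge> 2" "\<alpha> \<le> 1 / 2"
  shows "(\<Sum>v\<in>V. \<pi> v * (if v \<in> A then 1 - (1 - x v) ^ k else x v ^ k)) \<le>
    \<alpha> - (1 / 2) ^ (k - 2) * \<alpha> * \<beta> + 2 * (real k)\<^sup>2 * \<beta> * sqrt (\<alpha> * Q) + (real k)\<^sup>2 * Q"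
proof -
  obtain j where k: "k = Suc j" and j: "j \<ge> 1" using \<open>k \<ge> 2\<close> by (cases k) auto
  have "0 \<le> \<alpha>" unfolding \<alpha>_def using pi V by (intro sum_nonneg) auto
  have "0 \<le> Q" unfolding Q_def using pi by (intro sum_nonneg) auto
  have "0 \<le> \<beta>" using assms by simp
  define d where "d = (1 - \<alpha>) ^ j - \<alpha> ^ j"
  have d: "2 * \<beta> * (1 / 2) ^ (j - 1) \<le> d" "d \<le> real j * (2 * \<beta>)"
    using power_difference_bounds[of \<alpha> "1 - \<alpha>" j] \<open>0 \<le> \<alpha>\<close> \<open>\<alpha> \<le> 1 / 2\<close> j by (auto simp: d_def \<beta>_def)
  then have "0 \<le> d" using \<open>0 \<le> \<beta>\<close> by (auto elim: order_trans[rotated])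
  define S where "S = (\<Sum>v\<in>A. \<pi> v * (x v - \<alpha>))"
  let ?y = "\<lambda>v. x v - \<alpha>"
  let ?c1 = "1 - (1 - \<alpha>) ^ k - \<alpha> ^ k" and ?c2 = "real k * \<alpha> ^ j" and ?c3 = "real k * d"
  \<comment> \<open>One formula for both cases: \<open>?c1\<close> and \<open>?c3\<close> switch
    value and slope of the tangent between vertices outside and inside \<open>A\<close>. Inside
    \<open>A\<close> convexity has the favourable sign; the quadratic error arises from the vertices
    outside.\<close>
  have pt: "(if v \<in> A then 1 - (1 - x v) ^ k else x v ^ k) \<le>
    \<alpha> ^ k + ?c1 * of_bool (v \<in> A) + ?c2 * ?y v + ?c3 * (of_bool (v \<in> A) * ?y v) + (real k)\<^sup>2 * (?y v)\<^sup>2" if "v \<in> V" for v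
  proof (cases "v \<in> A")
    case True
    have "1 - (1 - x v) ^ k \<le> 1 - (1 - \<alpha>) ^ k + real k * (1 - \<alpha>) ^ j * ?y v"
      using power_ge_tangent[of "1 - \<alpha>" "1 - x v" k] x[OF that] \<open>\<alpha> \<le> 1 / 2\<close>
      by (simp add: k algebra_simps)
    also have "\<dots> \<le> 1 - (1 - \<alpha>) ^ k + real k * (1 - \<alpha>) ^ j * ?y v + (real k)\<^sup>2 * (?y v)\<^sup>2" by simp
    finally show ?thesis using True by (simp add: d_def algebra_simps)
  next
    case False
    then show ?thesis
      using power_le_tangent[of \<alpha> "x v" k] x[OF that] \<open>0 \<le> \<alpha>\<close> \<open>\<alpha> \<le> 1 / 2\<close> by (simp add: k)
  qed
  have onA: "(\<Sum>v\<in>V. \<pi> v * (of_bool (v \<in> A) * f v)) = (\<Sum>v\<in>A. \<pi> v * f v)" for f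
  proof -
    have "(\<Sum>v\<in>V. \<pi> v * (of_bool (v \<in> A) * f v)) = (\<Sum>v\<in>A. \<pi> v * (of_bool (v \<in> A) * f v))"
      using V by (intro sum.mono_neutral_right) auto
    then show ?thesis by simp
  qed
  have sum_y: "(\<Sum>v\<in>V. \<pi> v * ?y v) = 0"
    using stationary pi by (simp add: right_diff_distrib sum_subtractf flip: sum_distrib_right)
  have "(\<Sum>v\<in>V. \<pi> v * (if v \<in> A then 1 - (1 - x v) ^ k else x v ^ k)) \<le> (\<Sum>v\<in>V. \<pi> v *
    (\<alpha> ^ k + ?c1 * of_bool (v \<in> A) + ?c2 * ?y v + ?c3 * (of_bool (v \<in> A) * ?y v) + (real k)\<^sup>2 * (?y v)\<^sup>2))"
    using pt pi by (intro sum_mono mult_left_mono) auto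
  also have "\<dots> = \<alpha> ^ k * sum \<pi> V + ?c1 * (\<Sum>v\<in>V. \<pi> v * (of_bool (v \<in> A) * 1)) + ?c2 * (\<Sum>v\<in>V. \<pi> v * ?y v) +
     ?c3 * (\<Sum>v\<in>V. \<pi> v * (of_bool (v \<in> A) * ?y v)) + (real k)\<^sup>2 * Q"
    unfolding Q_def sum_distrib_left sum.distrib[symmetric] by (intro sum.cong refl) (simp only: algebra_simps mult_1_right)
  also have "\<dots> = \<alpha> ^ k + ?c1 * \<alpha> + ?c3 * S + (real k)\<^sup>2 * Q"
    unfolding onA sum_y using pi by (simp add: S_def \<alpha>_def)
  \<comment> \<open>The mean-field value, attained when every vertex sees exactly the fraction
    \<alpha>.\<close>
  also have "\<alpha> ^ k + ?c1 * \<alpha> = \<alpha> - \<alpha> * ((1 - \<alpha>) * d)"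
    by (simp add: k d_def algebra_simps)
  also have "\<dots> \<le> \<alpha> - \<alpha> * (1 / 2 * (2 * \<beta> * (1 / 2) ^ (j - 1)))"
    using d \<open>0 \<le> \<alpha>\<close> \<open>\<alpha> \<le> 1 / 2\<close> \<open>0 \<le> \<beta>\<close>
    by (intro diff_left_mono mult_left_mono mult_mono) auto
  also have "\<dots> = \<alpha> - (1 / 2) ^ (k - 2) * \<alpha> * \<beta>" by (simp add: k)
  also have "?c3 * S \<le> (2 * (real k)\<^sup>2 * \<beta>) * sqrt (\<alpha> * Q)"
  proof -
    have "S\<^sup>2 \<le> \<alpha> * Q"
      unfolding S_def Q_def \<alpha>_def using V pi by (intro weighted_cauchy_schwarz) auto
    then have S: "\<bar>S\<bar> \<le> sqrt (\<alpha> * Q)" using real_sqrt_le_mono by fastforce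
    have "?c3 \<le> real k * (real k * (2 * \<beta>))"
      using d \<open>0 \<le> \<beta>\<close> by (intro mult_left_mono order_trans[OF d(2)] mult_right_mono) (auto simp: k)
    then have "?c3 \<le> 2 * (real k)\<^sup>2 * \<beta>" by (simp add: power2_eq_square ac_simps)
    have "?c3 * S \<le> ?c3 * \<bar>S\<bar>" using \<open>0 \<le> d\<close> by (intro mult_left_mono) auto
    also have "\<dots> \<le> (2 * (real k)\<^sup>2 * \<beta>) * sqrt (\<alpha> * Q)"
      by (rule mult_mono[OF \<open>?c3 \<le> 2 * (real k)\<^sup>2 * \<beta>\<close> S]) (use \<open>0 \<le> \<beta>\<close> in auto)
    finally show ?thesis .
  qed
  finally show ?thesis by simp
qed

text \<open>Each of the two error terms of \<open>careful_mean_le\<close> takes at most a quarter of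
  the drift \<open>c * \<alpha> * \<beta>\<close>. The relative bound on \<open>Q\<close> handles
  the cross term always and the quadratic term if \<beta> \<ge> 1 / 4; for smaller \<beta> one has
  \<alpha> > 1 / 4, and a bound on \<open>Q\<close> proportional to \<beta> does it.\<close>

lemma careful_drift:
  fixes \<pi> x :: "'a \<Rightarrow> real" and A V :: "'a set" and k :: nat
  defines "\<alpha> \<equiv> sum \<pi> A"
  defines "\<beta> \<equiv> 1 / 2 - \<alpha>"
  defines "Q \<equiv> \<Sum>v\<in>V. \<pi> v * (x v - \<alpha>)\<^sup>2"
  defines "c \<equiv> (1 / 2) ^ (k - 2)"
  assumes V: "finite V" "A \<subseteq> V" and pi: "\<And>v. v \<in> V \<Longrightarrow> 0 \<le> \<pi> v" "sum \<pi> V = 1"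
    and x: "\<And>v. v \<in> V \<Longrightarrow> 0 \<le> x v \<and> x v \<le> 1" and stationary: "(\<Sum>v\<in>V. \<pi> v * x v) = \<alpha>"
    and "k \<ge> 2" "\<alpha> \<le> 1 / 2"
    and Q1: "Q \<le> (c / (8 * (real k)\<^sup>2))\<^sup>2 * \<alpha>" and Q2: "\<beta> < 1 / 4 \<Longrightarrow> Q \<le> c * \<beta> / (16 * (real k)\<^sup>2)"
  shows "(\<Sum>v\<in>V. \<pi> v * (if v \<in> A then 1 - (1 - x v) ^ k else x v ^ k)) \<le> \<alpha> - c / 2 * \<alpha> * \<beta>"
proof -
  have "0 \<le> \<alpha>" unfolding \<alpha>_def using pi V by (intro sum_nonneg) auto
  have "0 \<le> Q" unfolding Q_def using pi by (intro sum_nonneg) auto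
  have "0 \<le> \<beta>" using assms by simp
  have c: "0 < c" "c \<le> 1" unfolding c_def by (auto intro: power_le_one)
  have k: "real k > 0" "(real k)\<^sup>2 \<ge> 1" using \<open>k \<ge> 2\<close> by (auto simp: one_le_power)
  have "sqrt (\<alpha> * Q) \<le> sqrt ((c / (8 * (real k)\<^sup>2) * \<alpha>)\<^sup>2)"
    using mult_left_mono[OF Q1 \<open>0 \<le> \<alpha>\<close>] by (intro real_sqrt_le_mono) (simp add: power2_eq_square ac_simps)
  also have "\<dots> = c / (8 * (real k)\<^sup>2) * \<alpha>" using c \<open>0 \<le> \<alpha>\<close> by simp
  finally have "2 * (real k)\<^sup>2 * \<beta> * sqrt (\<alpha> * Q) \<le> 2 * (real k)\<^sup>2 * \<beta> * (c / (8 * (real k)\<^sup>2) * \<alpha>)"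
    using \<open>0 \<le> \<beta>\<close> by (intro mult_left_mono) auto
  also have "\<dots> = c * \<alpha> * \<beta> / 4" using k by (simp add: field_simps)
  finally have 1: "2 * (real k)\<^sup>2 * \<beta> * sqrt (\<alpha> * Q) \<le> c * \<alpha> * \<beta> / 4" .
  have 2: "(real k)\<^sup>2 * Q \<le> c * \<alpha> * \<beta> / 4"
  proof (cases "\<beta> < 1 / 4")
    case True
    have "(real k)\<^sup>2 * Q \<le> (real k)\<^sup>2 * (c * \<beta> / (16 * (real k)\<^sup>2))"
      using Q2[OF True] by (intro mult_left_mono) auto
    also have "\<dots> = c * \<beta> * (1 / 4) / 4" using k by (simp add: field_simps)
    also have "\<dots> \<le> c * \<beta> * \<alpha> / 4"
      using True c \<open>0 \<le> \<beta>\<close> by (intro divide_right_mono mult_left_mono) (auto simp: \<beta>_def)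
    finally show ?thesis by (simp add: ac_simps)
  next
    case False
    have "(real k)\<^sup>2 * Q \<le> (real k)\<^sup>2 * ((c / (8 * (real k)\<^sup>2))\<^sup>2 * \<alpha>)"
      using Q1 by (intro mult_left_mono) auto
    also have "\<dots> = c * \<alpha> * (c / (64 * (real k)\<^sup>2))" using k by (simp add: field_simps power2_eq_square)
    also have "\<dots> \<le> c * \<alpha> * (1 / 16)"
    proof -
      have "c / (64 * (real k)\<^sup>2) \<le> 1 / (64 * 1)" using c k by (intro frac_le mult_left_mono) auto
      then show ?thesis using c \<open>0 \<le> \<alpha>\<close> by (intro mult_left_mono) auto
    qed
    also have "\<dots> \<le> c * \<alpha> * (\<beta> / 4)" using False c \<open>0 \<le> \<alpha>\<close> by (intro mult_left_mono) auto
    finally show ?thesis by simp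
  qed
  have "(\<Sum>v\<in>V. \<pi> v * (if v \<in> A then 1 - (1 - x v) ^ k else x v ^ k)) \<le>
    \<alpha> - c * \<alpha> * \<beta> + 2 * (real k)\<^sup>2 * \<beta> * sqrt (\<alpha> * Q) + (real k)\<^sup>2 * Q"
    unfolding c_def Q_def \<beta>_def \<alpha>_def
    using assms(5-12) by (intro careful_mean_le) (auto simp: \<alpha>_def)
  then show ?thesis using 1 2 by simp
qed

section \<open>The potential and its contraction\<close>

lemma sampled_from_nonempty: "sampled_from E v \<noteq> {}"
  by (simp add: sampled_from_def)

lemma map_pmf_Not_bernoulli:
  assumes "0 \<le> q" "q \<le> 1"
  shows "map_pmf Not (bernoulli_pmf q) = bernoulli_pmf (1 - q)"
proof (rule pmf_eqI)
  show "pmf (map_pmf Not (bernoulli_pmf q)) b = pmf (bernoulli_pmf (1 - q)) b" for b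
    using pmf_map_inj'[of Not "bernoulli_pmf q" "\<not> b"] assms by (cases b) (auto simp: inj_def)
qed

text \<open>The rule treats both opinions alike; this allows opinion 0 to be taken as the
  minority.\<close>

lemma adoption_prob_complement:
  assumes "finite V" "A \<subseteq> V" "v \<in> V" "neighbours E v \<subseteq> V"
  shows "adoption_prob k E (V - A) v = 1 - adoption_prob k E A v"
proof -
  have sub: "sampled_from E v \<subseteq> V" using assms by (auto simp: sampled_from_def)
  then have fin: "finite (sampled_from E v)" using assms(1) by (rule finite_subset)
  then have "card (sampled_from E v) > 0" using sampled_from_nonempty[of E v] card_gt_0_iff by blast
  moreover have "sampled_from E v \<inter> (V - A) = sampled_from E v - A" using sub by auto
  moreover have "card (sampled_from E v - A) + card (sampled_from E v \<inter> A) = card (sampled_from E v)"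
    using fin card_Diff_subset_Int[of "sampled_from E v" A] card_mono[OF fin, of "sampled_from E v \<inter> A"] by simp
  ultimately have "fraction_in E (V - A) v = 1 - fraction_in E A v"
    by (simp add: fraction_in_def field_simps flip: of_nat_add)
  then show ?thesis using assms by (simp add: adoption_prob_def)
qed

lemma fraction_in_bounds: "0 \<le> fraction_in E A v" "fraction_in E A v \<le> 1"
proof -
  show "0 \<le> fraction_in E A v" by (simp add: fraction_in_def)
  show "fraction_in E A v \<le> 1"
  proof (cases "finite (sampled_from E v)")
    case True
    then have "real (card (sampled_from E v \<inter> A)) \<le> real (card (sampled_from E v))"
      by (simp add: card_mono)
    then show ?thesis unfolding fraction_in_def by (intro divide_le_eq_1[THEN iffD2]) linarith
  qed (simp add: fraction_in_def)
qed

lemma adoption_prob_bounds: "0 \<le> adoption_prob k E A v" "adoption_prob k E A v \<le> 1"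
  using fraction_in_bounds[of E A v] by (auto simp: adoption_prob_def power_le_one)

text \<open>\<open>\<pi>\<close> stands for the stationary distribution of the simple random walk. The two mixing bounds are
  needed near balance and near consensus, respectively.\<close>

locale voting_expander =
  fixes V :: "'a set" and E :: "'a set set" and \<pi> :: "'a \<Rightarrow> real" and k :: nat and \<kappa> :: real
  assumes finite_V: "finite V"
    and neighbours_subset: "v \<in> V \<Longrightarrow> neighbours E v \<subseteq> V"
    and k_ge_2: "k \<ge> 2"
    and sum_pi: "sum \<pi> V = 1"
    and pi_ge: "v \<in> V \<Longrightarrow> 1 / (4 * real (card V)) \<le> \<pi> v"
    and pi_le: "v \<in> V \<Longrightarrow> \<pi> v \<le> 4 / real (card V)"
    and stationary: "A \<subseteq> V \<Longrightarrow> (\<Sum>v\<in>V. \<pi> v * fraction_in E A v) = sum \<pi> A"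
    and mixing: "A \<subseteq> V \<Longrightarrow>
      (\<Sum>v\<in>V. \<pi> v * (fraction_in E A v - sum \<pi> A)\<^sup>2) \<le> \<kappa> / sqrt (real (card V))"
    and mixing_relative: "A \<subseteq> V \<Longrightarrow>
      (\<Sum>v\<in>V. \<pi> v * (fraction_in E A v - sum \<pi> A)\<^sup>2) \<le>
        ((1 / 2) ^ (k - 2) / (8 * (real k)\<^sup>2))\<^sup>2 * sum \<pi> A"
begin

text \<open>The sign is such that a positive bias means that \<open>A\<close>, the set of opinion 0,
  is the minority by weight.\<close>

definition bias :: "'a set \<Rightarrow> real" where
  "bias A = 1 / 2 - sum \<pi> A"

text \<open>With \<open>\<alpha> = 1 / 2 - \<beta>\<close> the stationary weight of the minority, this is
  \<open>min 1 (R \<alpha> / (sqrt n \<beta>))\<close>, written such that no denominator vanishes. It is constant where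
  the random fluctuations dominate the drift.\<close>

definition potential :: "real \<Rightarrow> real \<Rightarrow> real" where
  "potential R \<beta> = R * (1 / 2 - \<beta>) / max (R * (1 / 2 - \<beta>)) (sqrt (real (card V)) * \<beta>)"

abbreviation "n \<equiv> real (card V)"

lemma n_pos: "n > 0"
  using sum_pi finite_V by (cases "V = {}") (auto simp: card_gt_0_iff)

lemma pi_nonneg: "v \<in> V \<Longrightarrow> 0 \<le> \<pi> v"
  using pi_ge n_pos by (meson divide_nonneg_nonneg mult_nonneg_nonneg of_nat_0_le_iff order_trans zero_le_numeral zero_le_one)

lemma sum_pi_bounds: "A \<subseteq> V \<Longrightarrow> 0 \<le> sum \<pi> A" "A \<subseteq> V \<Longrightarrow> sum \<pi> A \<le> 1"
  using sum_nonneg[of A \<pi>] sum_mono2[OF finite_V, of A \<pi>] pi_nonneg sum_pi by auto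

lemma bias_bound: "A \<subseteq> V \<Longrightarrow> \<bar>bias A\<bar> \<le> 1 / 2"
  using sum_pi_bounds[of A] unfolding bias_def by linarith

lemma bias_complement: "A \<subseteq> V \<Longrightarrow> bias (V - A) = - bias A"
  using sum_diff[of V A \<pi>] finite_V sum_pi by (simp add: bias_def)

lemma potential_denominator_pos:
  assumes "R > 0" "\<beta> \<le> 1 / 2"
  shows "0 < max (R * (1 / 2 - \<beta>)) (sqrt n * \<beta>)"
proof (cases "\<beta> = 1 / 2")
  case True
  then show ?thesis using n_pos by (auto simp: less_max_iff_disj)
next
  case False
  then show ?thesis using assms by (auto simp: less_max_iff_disj)
qed

lemma potential_nonneg: "R > 0 \<Longrightarrow> \<beta> \<le> 1 / 2 \<Longrightarrow> 0 \<le> potential R \<beta>"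
  unfolding potential_def using potential_denominator_pos[of R \<beta>] by (intro divide_nonneg_pos) auto

lemma potential_le_1: "R > 0 \<Longrightarrow> \<beta> \<le> 1 / 2 \<Longrightarrow> potential R \<beta> \<le> 1"
  unfolding potential_def using potential_denominator_pos[of R \<beta>] by (subst divide_le_eq_1_pos) auto

lemma potential_le:
  assumes "R > 0" "0 < \<beta>" "\<beta> \<le> 1 / 2"
  shows "potential R \<beta> \<le> R * (1 / 2 - \<beta>) / (sqrt n * \<beta>)"
  unfolding potential_def using assms n_pos by (intro divide_left_mono mult_pos_pos potential_denominator_pos) auto

lemma potential_eq:
  assumes "R * (1 / 2 - \<beta>) \<le> sqrt n * \<beta>"
  shows "potential R \<beta> = R * (1 / 2 - \<beta>) / (sqrt n * \<beta>)"
  unfolding potential_def using assms by (simp add: max_absorb2)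

text \<open>Both opinions are present, so the minority has at least the weight 1 / (4 n) of one
  vertex, while the denominator is at most sqrt n.\<close>

lemma potential_ge:
  assumes "A \<subseteq> V" "A \<noteq> {}" "A \<noteq> V" "R \<ge> 1" "R \<le> sqrt n" "sqrt n \<ge> 4"
  shows "1 / n\<^sup>2 \<le> potential R \<bar>bias A\<bar>"
proof -
  have *: "1 / (4 * n) \<le> sum \<pi> B" if B: "B \<subseteq> V" "B \<noteq> {}" for B
  proof -
    obtain v where v: "v \<in> B" using B by auto
    have "1 / (4 * n) \<le> \<pi> v" using pi_ge v B by auto
    also have "\<dots> \<le> sum \<pi> B"
      using v B finite_subset[OF B(1) finite_V] pi_nonneg by (intro member_le_sum) auto
    finally show ?thesis .
  qed
  have "1 / (4 * n) \<le> 1 / 2 - \<bar>bias A\<bar>"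
    using *[OF assms(1,2)] *[of "V - A"] bias_complement[OF assms(1)] assms(1,3) by (auto simp: bias_def)
  then have "1 * (1 / (4 * n)) \<le> R * (1 / 2 - \<bar>bias A\<bar>)"
    using assms n_pos by (intro mult_mono) auto
  moreover have "max (R * (1 / 2 - \<bar>bias A\<bar>)) (sqrt n * \<bar>bias A\<bar>) \<le> sqrt n"
  proof (rule max.boundedI)
    show "R * (1 / 2 - \<bar>bias A\<bar>) \<le> sqrt n"
      using assms bias_bound[OF assms(1)] mult_mono[of R "sqrt n" "1 / 2 - \<bar>bias A\<bar>" 1] by simp
    show "sqrt n * \<bar>bias A\<bar> \<le> sqrt n"
      using bias_bound[OF assms(1)] mult_left_mono[of "\<bar>bias A\<bar>" 1 "sqrt n"] by simp
  qed
  ultimately have "(1 * (1 / (4 * n))) / sqrt n \<le> potential R \<bar>bias A\<bar>"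
    unfolding potential_def using n_pos assms bias_bound[OF assms(1)]
    by (intro frac_le potential_denominator_pos) auto
  moreover have "1 / n\<^sup>2 \<le> (1 * (1 / (4 * n))) / sqrt n"
  proof -
    have "4 * n * sqrt n \<le> sqrt n * n * sqrt n" using assms n_pos by (intro mult_right_mono) auto
    also have "\<dots> = n\<^sup>2" using n_pos by (simp add: power2_eq_square)
    finally have "1 / n\<^sup>2 \<le> 1 / (4 * n * sqrt n)" using n_pos by (intro divide_left_mono) auto
    then show ?thesis by simp
  qed
  ultimately show ?thesis by linarith
qed

section \<open>One round: mean, fluctuation and exchange of opinions\<close>

definition next_opinion :: "'a set \<Rightarrow> ('a \<Rightarrow> bool) pmf" where
  "next_opinion A = independent_bits V (adoption_prob k E A)"

definition mean_weight :: "'a set \<Rightarrow> real" where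
  "mean_weight A = (\<Sum>v\<in>V. \<pi> v * adoption_prob k E A v)"

definition fluctuation :: "'a set \<Rightarrow> ('a \<Rightarrow> bool) \<Rightarrow> real" where
  "fluctuation A B = (\<Sum>v\<in>V. \<pi> v * (of_bool (B v) - adoption_prob k E A v))"

lemma finite_next_opinion: "finite (set_pmf (next_opinion A))"
  unfolding next_opinion_def by (rule finite_set_independent_bits[OF finite_V])

lemma integrable_next_opinion: "integrable (measure_pmf (next_opinion A)) (F :: _ \<Rightarrow> real)"
  by (intro integrable_measure_pmf_finite finite_next_opinion)

lemma next_opinion_subset: "B \<in> set_pmf (next_opinion A) \<Longrightarrow> {v. B v} \<subseteq> V"
  using set_Pi_pmf_subset[OF finite_V, of False "\<lambda>v. bernoulli_pmf (adoption_prob k E A v)"]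
  by (auto simp: next_opinion_def)

lemma bias_next_opinion:
  assumes "B \<in> set_pmf (next_opinion A)"
  shows "bias {v. B v} = 1 / 2 - mean_weight A - fluctuation A B"
proof -
  have "sum \<pi> {v. B v} = (\<Sum>v\<in>V. \<pi> v * of_bool (B v))"
    using next_opinion_subset[OF assms] finite_V
    by (intro sum.mono_neutral_cong_left) auto
  then show ?thesis
    by (simp add: bias_def mean_weight_def fluctuation_def right_diff_distrib sum_subtractf)
qed

lemma expectation_fluctuation: "measure_pmf.expectation (next_opinion A) (fluctuation A) = 0"
  unfolding next_opinion_def fluctuation_def[abs_def]
  by (intro expectation_independent_bits_sum finite_V) (auto simp: adoption_prob_bounds)

lemma expectation_update:
  assumes "A \<subseteq> V"
  shows "measure_pmf.expectation (round_samples k V E) (\<lambda>s. F (careful_update V s A)) =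
    measure_pmf.expectation (next_opinion A) (\<lambda>B. F {v. B v} :: real)"
proof -
  have "measure_pmf.expectation (map_pmf (\<lambda>s. careful_update V s A) (round_samples k V E)) F =
    measure_pmf.expectation (map_pmf (\<lambda>B. {v. B v}) (next_opinion A)) F"
    unfolding next_opinion_def using k_ge_2 neighbours_subset
    by (subst careful_update_distribution[OF finite_V]) auto
  then show ?thesis by simp
qed

lemma next_opinion_complement:
  assumes "A \<subseteq> V"
  shows "next_opinion (V - A) = map_pmf (\<lambda>B v. if v \<in> V then \<not> B v else False) (next_opinion A)"
proof -
  have "next_opinion (V - A) = Pi_pmf V False (\<lambda>v. map_pmf Not (bernoulli_pmf (adoption_prob k E A v)))"
    unfolding next_opinion_def
  proof (intro Pi_pmf_cong refl)
    fix v assume "v \<in> V"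
    then show "bernoulli_pmf (adoption_prob k E (V - A) v) = map_pmf Not (bernoulli_pmf (adoption_prob k E A v))"
      using adoption_prob_complement[OF finite_V assms _ neighbours_subset]
      by (simp add: map_pmf_Not_bernoulli adoption_prob_bounds)
  qed
  then show ?thesis
    unfolding next_opinion_def
    by (simp only: Pi_pmf_map_dependent[OF finite_V, of "\<lambda>_. Not" False False, symmetric])
qed

lemma expectation_potential_complement:
  assumes "A \<subseteq> V"
  shows "measure_pmf.expectation (next_opinion (V - A)) (\<lambda>B. potential R \<bar>bias {v. B v}\<bar>) =
    measure_pmf.expectation (next_opinion A) (\<lambda>B. potential R \<bar>bias {v. B v}\<bar>)"
proof -
  have "\<bar>bias {v. if v \<in> V then \<not> B v else False}\<bar> = \<bar>bias {v. B v}\<bar>" if "B \<in> set_pmf (next_opinion A)" for B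
  proof -
    have "{v. if v \<in> V then \<not> B v else False} = V - {v. B v}" by auto
    then show ?thesis using bias_complement[OF next_opinion_subset[OF that]] by simp
  qed
  then show ?thesis
    unfolding next_opinion_complement[OF assms] integral_map_pmf
    by (intro integral_cong_AE) (simp_all add: AE_measure_pmf_iff)
qed

lemma mean_weight_le:
  assumes "A \<subseteq> V" "0 \<le> bias A"
    and "bias A < 1 / 4 \<Longrightarrow> \<kappa> / sqrt n \<le> (1 / 2) ^ (k - 2) * bias A / (16 * (real k)\<^sup>2)"
  shows "mean_weight A \<le> sum \<pi> A - (1 / 2) ^ (k - 2) / 2 * sum \<pi> A * bias A"
  unfolding mean_weight_def adoption_prob_def bias_def
proof (rule careful_drift)
  show "(\<Sum>v\<in>V. \<pi> v * (fraction_in E A v - sum \<pi> A)\<^sup>2) \<le> (1 / 2) ^ (k - 2) * (1 / 2 - sum \<pi> A) / (16 * (real k)\<^sup>2)"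
    if "1 / 2 - sum \<pi> A < 1 / 4"
    using mixing[OF assms(1)] assms(3) that by (simp add: bias_def)
qed (use assms mixing_relative stationary finite_V sum_pi k_ge_2 pi_nonneg fraction_in_bounds in \<open>auto simp: bias_def\<close>)

text \<open>Near balance the mixing bound keeps the fraction seen by most vertices, in the sense of
  \<pi>, within 1 / 8 of \<alpha>, hence inside [1 / 4, 3 / 4]. Their next opinions are truly
  random, so sqrt n times the fluctuation has variance bounded below, and the anticoncentration
  bound applies.\<close>

lemma escape_balanced:
  assumes "A \<subseteq> V" "sqrt n * \<bar>bias A\<bar> \<le> R / 2" "R \<ge> 1" "4 * R \<le> sqrt n" "128 * \<kappa> \<le> sqrt n"
    and mu: "\<mu> = 192 * 4 ^ k * (R + 1)" "8 * \<mu> \<le> sqrt n"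
  shows "exp (- 4 * \<mu>\<^sup>2) / 4 \<le>
    measure_pmf.prob (next_opinion A) {B. R \<le> sqrt n * \<bar>1 / 2 - mean_weight A - fluctuation A B\<bar>}"
proof -
  \<comment> \<open>The direction in which the mean already leans, so that the mean cannot cancel
    the fluctuation.\<close>
  define \<sigma> :: real where "\<sigma> = (if mean_weight A \<le> 1 / 2 then - 1 else 1)"
  define q where "q = adoption_prob k E A"
  \<comment> \<open>The lower bound for the variance: 1 / 4 from the least weight,
    \<open>(1 / 4) ^ k / 4\<close> from one typical vertex, and 1 / 2 from averaging over the
    atypical ones.\<close>
  define s where "s = (1 / 4) ^ k / (32 :: real)"
  define x where "x = fraction_in E A"
  define \<alpha> where "\<alpha> = sum \<pi> A"
  have sq: "\<sigma>\<^sup>2 = 1" "\<bar>\<sigma>\<bar> = 1" by (auto simp: \<sigma>_def)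
  have sn: "sqrt n > 0" "sqrt n * sqrt n = n" using n_pos by auto
  have q: "0 \<le> q v" "q v \<le> 1" for v by (auto simp: q_def adoption_prob_bounds)
  have mu1: "\<mu> \<ge> 1" unfolding mu using assms(3) mult_mono[of 1 "192 * 4 ^ k" 1 "R + 1"] mult_mono[of 1 192 1 "4 ^ k :: real"]
    by auto
  have alpha: "\<bar>1 / 2 - \<alpha>\<bar> \<le> 1 / 8"
  proof -
    have "sqrt n * \<bar>bias A\<bar> \<le> sqrt n * (1 / 8)" using assms by simp
    then show ?thesis using sn by (simp add: bias_def \<alpha>_def)
  qed
  \<comment> \<open>Valid for every vertex, as the left-hand side is nonpositive for atypical ones;
    its average over \<pi> is controlled by the mixing bound.\<close>
  have var: "(1 / 4) ^ k / 4 * (1 - 64 * (x v - \<alpha>)\<^sup>2) \<le> q v * (1 - q v)" for v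
  proof (cases "\<bar>x v - \<alpha>\<bar> \<le> 1 / 8")
    case True
    have x: "1 / 4 \<le> x v" "x v \<le> 3 / 4" using True alpha by linarith+
    have *: "(1 / 4) ^ k \<le> z ^ k" "z ^ k \<le> 3 / 4" if "1 / 4 \<le> z" "z \<le> 3 / 4" for z :: real
    proof -
      show "(1 / 4) ^ k \<le> z ^ k" using that by (intro power_mono) auto
      have "z ^ k \<le> z ^ 1" using that k_ge_2 by (intro power_decreasing) auto
      then show "z ^ k \<le> 3 / 4" using that by simp
    qed
    have "(1 / 4) ^ k * (1 / 4) \<le> q v * (1 - q v)"
    proof (cases "v \<in> A")
      case True
      have "(1 / 4) * (1 / 4) ^ k \<le> (1 - (1 - x v) ^ k) * (1 - x v) ^ k"
        using *[of "1 - x v"] x by (intro mult_mono) auto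
      then show ?thesis using True by (simp add: q_def adoption_prob_def x_def)
    next
      case False
      have "(1 / 4) ^ k * (1 / 4) \<le> x v ^ k * (1 - x v ^ k)"
        using *[of "x v"] x by (intro mult_mono) auto
      then show ?thesis using False by (simp add: q_def adoption_prob_def x_def)
    qed
    moreover have "(1 / 4) ^ k / 4 * (1 - 64 * (x v - \<alpha>)\<^sup>2) \<le> (1 / 4) ^ k / 4 * (1 :: real)"
      by (intro mult_left_mono) auto
    ultimately show ?thesis by linarith
  next
    case False
    then have "(1 / 8)\<^sup>2 \<le> \<bar>x v - \<alpha>\<bar>\<^sup>2" by (intro power_mono) auto
    then have "(1 / 4) ^ k / 4 * (1 - 64 * (x v - \<alpha>)\<^sup>2) \<le> 0"
      by (intro mult_nonneg_nonpos) (auto simp: power2_eq_square)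
    also have "0 \<le> q v * (1 - q v)" using q[of v] by simp
    finally show ?thesis .
  qed
  have "s \<le> (1 / 4) ^ k / 16 * (1 - 64 * (\<Sum>v\<in>V. \<pi> v * (x v - \<alpha>)\<^sup>2))"
  proof -
    have "(\<Sum>v\<in>V. \<pi> v * (x v - \<alpha>)\<^sup>2) \<le> \<kappa> / sqrt n"
      unfolding x_def \<alpha>_def by (rule mixing[OF assms(1)])
    also have "\<dots> \<le> 1 / 128" using assms(5) sn by (simp add: field_simps)
    finally have "(1 / 4) ^ k / 16 * (1 / 2) \<le> (1 / 4) ^ k / 16 * (1 - 64 * (\<Sum>v\<in>V. \<pi> v * (x v - \<alpha>)\<^sup>2))"
      by (intro mult_left_mono) auto
    then show ?thesis by (simp add: s_def)
  qed
  also have "\<dots> = (1 / 4) ^ k / 16 * (\<Sum>v\<in>V. \<pi> v * (1 - 64 * (x v - \<alpha>)\<^sup>2))"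
    using sum_pi by (simp add: right_diff_distrib sum_subtractf sum_distrib_left mult.left_commute)
  also have "\<dots> = (\<Sum>v\<in>V. n * (1 / (4 * n) * \<pi> v * ((1 / 4) ^ k / 4 * (1 - 64 * (x v - \<alpha>)\<^sup>2))))"
    unfolding sum_distrib_left using n_pos by (intro sum.cong) auto
  also have "\<dots> \<le> (\<Sum>v\<in>V. n * (\<pi> v * \<pi> v * (q v * (1 - q v))))"
  proof (intro sum_mono mult_left_mono)
    fix v assume v: "v \<in> V"
    have "1 / (4 * n) * \<pi> v * ((1 / 4) ^ k / 4 * (1 - 64 * (x v - \<alpha>)\<^sup>2)) \<le> 1 / (4 * n) * \<pi> v * (q v * (1 - q v))"
      using pi_nonneg[OF v] n_pos by (intro mult_left_mono var) auto
    also have "\<dots> \<le> \<pi> v * \<pi> v * (q v * (1 - q v))"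
      using pi_nonneg[OF v] pi_ge[OF v] q[of v] by (intro mult_right_mono) auto
    finally show "1 / (4 * n) * \<pi> v * ((1 / 4) ^ k / 4 * (1 - 64 * (x v - \<alpha>)\<^sup>2)) \<le> \<pi> v * \<pi> v * (q v * (1 - q v))" .
  qed auto
  also have "\<dots> = (\<Sum>v\<in>V. (\<sigma> * sqrt n * \<pi> v)\<^sup>2 * (q v * (1 - q v)))"
    by (simp add: power_mult_distrib sq) (simp add: power2_eq_square mult.assoc)
  finally have s: "s \<le> (\<Sum>v\<in>V. (\<sigma> * sqrt n * \<pi> v)\<^sup>2 * (q v * (1 - q v)))" .
  have S: "(\<Sum>v\<in>V. (\<sigma> * sqrt n * \<pi> v)\<^sup>2) \<le> 4"
  proof -
    have "(\<Sum>v\<in>V. (\<sigma> * sqrt n * \<pi> v)\<^sup>2) = (\<Sum>v\<in>V. n * \<pi> v * \<pi> v)"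
      by (simp add: power_mult_distrib sq) (simp add: power2_eq_square mult.assoc)
    also have "\<dots> \<le> (\<Sum>v\<in>V. 4 * \<pi> v)"
      using pi_le pi_nonneg n_pos by (intro sum_mono mult_right_mono) (auto simp: field_simps)
    also have "\<dots> = 4" using sum_pi by (simp flip: sum_distrib_left)
    finally show ?thesis .
  qed
  have w: "\<bar>\<sigma> * sqrt n * \<pi> v\<bar> * (2 * \<mu>) \<le> 1" if "v \<in> V" for v
  proof -
    have "\<bar>\<sigma> * sqrt n * \<pi> v\<bar> * (2 * \<mu>) = sqrt n * \<pi> v * (2 * \<mu>)"
      using pi_nonneg[OF that] sn by (simp add: abs_mult sq)
    also have "\<dots> \<le> sqrt n * (4 / n) * (sqrt n / 4)"
      using pi_le[OF that] pi_nonneg[OF that] sn mu(2) mu1 by (intro mult_mono) auto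
    also have "\<dots> = 1" using sn n_pos by (simp add: field_simps)
    finally show ?thesis .
  qed
  have "exp (- \<mu>\<^sup>2 * 4) / 4 \<le> measure_pmf.prob (independent_bits V q)
    {B. (\<Sum>v\<in>V. (\<sigma> * sqrt n * \<pi> v) * (of_bool (B v) - q v)) \<ge> \<mu> * s / 6 - ln 2 / \<mu>}"
    using q mu1 by (intro independent_bits_anticoncentration finite_V s S w) (auto simp: s_def)
  also have "\<dots> \<le> measure_pmf.prob (independent_bits V q) {B. R \<le> sqrt n * \<bar>1 / 2 - mean_weight A - fluctuation A B\<bar>}"
  proof (intro measure_pmf.finite_measure_mono subsetI)
    fix B assume "B \<in> {B. (\<Sum>v\<in>V. (\<sigma> * sqrt n * \<pi> v) * (of_bool (B v) - q v)) \<ge> \<mu> * s / 6 - ln 2 / \<mu>}"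
    moreover have "(\<Sum>v\<in>V. (\<sigma> * sqrt n * \<pi> v) * (of_bool (B v) - q v)) = sqrt n * (\<sigma> * fluctuation A B)"
      by (simp add: fluctuation_def q_def sum_distrib_left ac_simps)
    \<comment> \<open>The constant 192 is 6 times 32; the additional 1 pays for
      \<open>ln 2 / \<mu>\<close>.\<close>
    moreover have "\<mu> * s / 6 = R + 1"
      by (simp add: mu s_def field_simps)
    moreover have "ln 2 / \<mu> \<le> 1" using mu1 ln_2_less_1 by (simp add: divide_le_eq_1)
    ultimately have "R \<le> sqrt n * (\<sigma> * fluctuation A B)" by simp
    also have "\<dots> \<le> sqrt n * \<bar>1 / 2 - mean_weight A - fluctuation A B\<bar>"
      using sn by (intro mult_left_mono) (auto simp: \<sigma>_def)
    finally show "B \<in> {B. R \<le> sqrt n * \<bar>1 / 2 - mean_weight A - fluctuation A B\<bar>}" by simp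
  qed simp
  finally show ?thesis by (simp add: next_opinion_def q_def ac_simps)
qed

text \<open>Here the truncated ratio equals 1 and cannot grow. An escape beyond R / sqrt n brings it
  down to 1 / 2, so the mean drops by half the escape probability.\<close>

lemma contraction_balanced:
  assumes "A \<subseteq> V" "R \<ge> 1" "4 * R \<le> sqrt n" "128 * \<kappa> \<le> sqrt n"
    and mu: "\<mu> = 192 * 4 ^ k * (R + 1)" "8 * \<mu> \<le> sqrt n"
    and A: "sqrt n * \<bar>bias A\<bar> \<le> R * (1 / 2 - \<bar>bias A\<bar>)"
  shows "measure_pmf.expectation (next_opinion A) (\<lambda>B. potential R \<bar>bias {v. B v}\<bar>) \<le>
    (1 - exp (- 4 * \<mu>\<^sup>2) / 8) * potential R \<bar>bias A\<bar>"
proof -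
  let ?S = "{B. R \<le> sqrt n * \<bar>1 / 2 - mean_weight A - fluctuation A B\<bar>}"
  have sn: "sqrt n > 0" using n_pos by simp
  have R: "R * \<bar>bias A\<bar> \<ge> 0" using assms(2) by simp
  have "R * (1 / 2 - \<bar>bias A\<bar>) \<le> R / 2" using R by (simp add: algebra_simps)
  then have "sqrt n * \<bar>bias A\<bar> \<le> R / 2" using A by linarith
  then have esc: "exp (- 4 * \<mu>\<^sup>2) / 4 \<le> measure_pmf.prob (next_opinion A) ?S"
    by (rule escape_balanced[OF assms(1) _ assms(2-6)])
  have "potential R \<bar>bias A\<bar> = R * (1 / 2 - \<bar>bias A\<bar>) / (R * (1 / 2 - \<bar>bias A\<bar>))"
    using A by (simp add: potential_def max_absorb1)
  moreover have "R * (1 / 2 - \<bar>bias A\<bar>) > 0"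
    using potential_denominator_pos[of R "\<bar>bias A\<bar>"] A bias_bound[OF assms(1)] assms(2) by (simp add: max_absorb1)
  ultimately have pot: "potential R \<bar>bias A\<bar> = 1" by (metis divide_self less_irrefl)
  have "measure_pmf.expectation (next_opinion A) (\<lambda>B. potential R \<bar>bias {v. B v}\<bar>) \<le>
    measure_pmf.expectation (next_opinion A) (\<lambda>B. 1 - 1 / 2 * indicator ?S B)"
  proof (intro integral_mono_AE integrable_next_opinion AE_pmfI)
    fix B assume B: "B \<in> set_pmf (next_opinion A)"
    have b: "\<bar>bias {v. B v}\<bar> \<le> 1 / 2" using bias_bound[OF next_opinion_subset[OF B]] .
    show "potential R \<bar>bias {v. B v}\<bar> \<le> 1 - 1 / 2 * indicator ?S B"
    proof (cases "B \<in> ?S")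
      case True
      then have *: "R \<le> sqrt n * \<bar>bias {v. B v}\<bar>" by (simp add: bias_next_opinion[OF B])
      then have "0 < \<bar>bias {v. B v}\<bar>" using assms(2) by (cases "bias {v. B v} = 0") auto
      then have "potential R \<bar>bias {v. B v}\<bar> \<le> R * (1 / 2 - \<bar>bias {v. B v}\<bar>) / (sqrt n * \<bar>bias {v. B v}\<bar>)"
        using b assms(2) by (intro potential_le) auto
      also have "\<dots> \<le> R * (1 / 2) / R"
        using * assms(2) b by (intro frac_le mult_left_mono) auto
      finally show ?thesis using True assms(2) by simp
    next
      case False
      then show ?thesis using potential_le_1[of R "\<bar>bias {v. B v}\<bar>"] b assms(2) by simp
    qed
  qed
  also have "\<dots> = 1 - measure_pmf.prob (next_opinion A) ?S / 2"
    by (subst Bochner_Integration.integral_diff) (auto simp: integrable_next_opinion)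
  also have "\<dots> \<le> 1 - exp (- 4 * \<mu>\<^sup>2) / 8"
    using esc by linarith
  finally show ?thesis unfolding pot by (simp only: mult_1_right)
qed

text \<open>Unless the fluctuation reaches \<open>\<delta> * b\<close>, the new bias is at least
  \<open>(1 - \<delta>) * b\<close>, and the ratio is bounded by an affine function of the
  fluctuation, whose mean vanishes. On the exceptional event truncation bounds the potential by 1,
  and Chebyshev's inequality bounds the probability by a small multiple of the old
  potential.\<close>

lemma contraction_biased:
  defines "c \<equiv> (1 / 2) ^ (k - 2) / 2"
  assumes A: "A \<subseteq> V" and "0 \<le> bias A" and R: "R \<ge> 1" "32 * \<kappa> * (real k)\<^sup>2 \<le> c * R" "256 / c\<^sup>2 \<le> R"
    and n: "4 * R \<le> sqrt n"
    and biased: "R * (1 / 2 - bias A) < sqrt n * bias A"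
  shows "measure_pmf.expectation (next_opinion A) (\<lambda>B. potential R \<bar>bias {v. B v}\<bar>) \<le>
    (1 - c / 16) * potential R \<bar>bias A\<bar>"
proof -
  define \<alpha> where "\<alpha> = sum \<pi> A"
  define \<beta> where "\<beta> = bias A"
  define M where "M = mean_weight A"
  define b where "b = 1 / 2 - M"
  \<comment> \<open>Of the gain c / 2 from the drift, the affine part still retains c / 8 after the
    loss through \<delta>; the exceptional event may then spend c / 16.\<close>
  define \<delta> where "\<delta> = c / 16"
  have sn: "sqrt n > 0" using n_pos by simp
  have c: "0 < c" "c \<le> 1 / 2" unfolding c_def by (auto intro: power_le_one)
  have ab: "\<alpha> = 1 / 2 - \<beta>" by (simp add: \<alpha>_def \<beta>_def bias_def)
  have \<alpha>: "0 \<le> \<alpha>" unfolding \<alpha>_def using sum_pi_bounds[OF A] by simp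
  have beta: "R / 4 \<le> sqrt n * \<beta>"
  proof (cases "\<beta> < 1 / 4")
    case True
    then have "R * (1 / 4) \<le> R * (1 / 2 - \<beta>)" using R(1) by (intro mult_left_mono) auto
    then show ?thesis using biased by (simp add: \<beta>_def)
  next
    case False
    then have "sqrt n * (1 / 4) \<le> sqrt n * \<beta>" using sn by (intro mult_left_mono) auto
    then show ?thesis using n R(1) by simp
  qed
  then have "0 < sqrt n * \<beta>" using R(1) by simp
  then have "0 < \<beta>" using sn by (simp add: zero_less_mult_iff)
  have drift: "M \<le> \<alpha> - c * \<alpha> * \<beta>"
  proof -
    have "\<kappa> / sqrt n \<le> 2 * c * \<beta> / (16 * (real k)\<^sup>2)"
    proof -
      have "\<kappa> * (16 * (real k)\<^sup>2) \<le> 2 * c * (R / 4)" using R(2) by argo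
      also have "\<dots> \<le> 2 * c * (sqrt n * \<beta>)" using beta c by (intro mult_left_mono) auto
      finally have "\<kappa> \<le> 2 * c * (sqrt n * \<beta>) / (16 * (real k)\<^sup>2)"
        using k_ge_2 by (subst pos_le_divide_eq) auto
      then show ?thesis using sn by (subst pos_divide_le_eq) (auto simp: ac_simps)
    qed
    then show ?thesis
      using mean_weight_le[OF A \<open>0 \<le> bias A\<close>] by (simp add: c_def M_def \<alpha>_def \<beta>_def)
  qed
  have b: "\<beta> * (1 + c * \<alpha>) \<le> b" using drift by (simp add: b_def ab algebra_simps)
  have "0 < \<beta> * (1 + c * \<alpha>)" using \<open>0 < \<beta>\<close> c \<alpha> by (intro mult_pos_pos add_pos_nonneg) auto
  then have "0 < b" using b by linarith
  have "\<beta> * 1 \<le> \<beta> * (1 + c * \<alpha>)" using \<open>0 < \<beta>\<close> c \<alpha> by (intro mult_left_mono) auto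
  then have "\<beta> \<le> b" using b by linarith
  have d: "0 < \<delta>" "\<delta> < 1" using c by (auto simp: \<delta>_def)
  let ?T = "{B. \<delta> * b \<le> fluctuation A B}"
  have M: "M \<ge> 0" unfolding M_def mean_weight_def using pi_nonneg by (intro sum_nonneg mult_nonneg_nonneg) (auto simp: adoption_prob_bounds)
  have pos: "0 < sqrt n * ((1 - \<delta>) * b)" using sn d \<open>0 < b\<close> by simp
  have "measure_pmf.expectation (next_opinion A) (\<lambda>B. potential R \<bar>bias {v. B v}\<bar>) \<le>
    measure_pmf.expectation (next_opinion A) (\<lambda>B. R * (M + fluctuation A B) / (sqrt n * ((1 - \<delta>) * b)) + indicator ?T B)"
  proof (intro integral_mono_AE integrable_next_opinion AE_pmfI)
    fix B assume B: "B \<in> set_pmf (next_opinion A)"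
    have b': "\<bar>bias {v. B v}\<bar> \<le> 1 / 2" using bias_bound[OF next_opinion_subset[OF B]] .
    have eq: "bias {v. B v} = b - fluctuation A B" using bias_next_opinion[OF B] by (simp add: b_def M_def)
    have eq': "1 / 2 - bias {v. B v} = M + fluctuation A B" unfolding eq by (simp add: b_def)
    then have nn: "0 \<le> M + fluctuation A B" using b' by linarith
    show "potential R \<bar>bias {v. B v}\<bar> \<le> R * (M + fluctuation A B) / (sqrt n * ((1 - \<delta>) * b)) + indicator ?T B"
    proof (cases "B \<in> ?T")
      case True
      have "0 \<le> R * (M + fluctuation A B) / (sqrt n * ((1 - \<delta>) * b))"
        using nn R(1) pos by (intro divide_nonneg_pos) auto
      moreover have "potential R \<bar>bias {v. B v}\<bar> \<le> 1" using b' R(1) by (intro potential_le_1) auto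
      ultimately show ?thesis using True by simp
    next
      case False
      then have *: "(1 - \<delta>) * b \<le> bias {v. B v}" by (simp add: eq algebra_simps)
      moreover have "0 < (1 - \<delta>) * b" using d \<open>0 < b\<close> by simp
      ultimately have bpos: "0 < bias {v. B v}" by linarith
      then have "potential R \<bar>bias {v. B v}\<bar> \<le> R * (1 / 2 - bias {v. B v}) / (sqrt n * bias {v. B v})"
        using bpos potential_le[of R "bias {v. B v}"] b' R(1) by simp
      also have "\<dots> \<le> R * (M + fluctuation A B) / (sqrt n * ((1 - \<delta>) * b))"
        unfolding eq' using * sn pos nn R(1) bpos by (intro divide_left_mono mult_left_mono) auto
      finally show ?thesis using False by simp
    qed
  qed
  also have "\<dots> = R * M / (sqrt n * ((1 - \<delta>) * b)) + measure_pmf.prob (next_opinion A) ?T"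
    using expectation_fluctuation[of A]
    by (simp add: integrable_next_opinion ring_distribs add_divide_distrib)
  also have "measure_pmf.prob (next_opinion A) ?T \<le> (4 * \<alpha> / n) / (\<delta> * \<beta>)\<^sup>2"
  proof -
    have "measure_pmf.prob (next_opinion A) ?T \<le>
      (\<Sum>v\<in>V. (\<pi> v)\<^sup>2 * (adoption_prob k E A v * (1 - adoption_prob k E A v))) / (\<delta> * b)\<^sup>2"
      unfolding next_opinion_def fluctuation_def using d \<open>0 < b\<close> finite_V
      by (intro chebyshev_independent_bits) (auto simp: adoption_prob_bounds)
    \<comment> \<open>Only the factor 1 - q of the variance is dropped: the bound has to stay
      proportional to the mean weight, hence to \<alpha>, in order to compare with the potential
      near consensus.\<close>
    also have "(\<Sum>v\<in>V. (\<pi> v)\<^sup>2 * (adoption_prob k E A v * (1 - adoption_prob k E A v))) \<le>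
      (\<Sum>v\<in>V. 4 / n * (\<pi> v * adoption_prob k E A v))"
    proof (intro sum_mono)
      fix v assume v: "v \<in> V"
      have "(\<pi> v)\<^sup>2 * (adoption_prob k E A v * (1 - adoption_prob k E A v)) \<le> (\<pi> v)\<^sup>2 * adoption_prob k E A v"
        using adoption_prob_bounds[of k E A v] by (intro mult_left_mono mult_left_le) auto
      also have "\<dots> = \<pi> v * (\<pi> v * adoption_prob k E A v)" by (simp add: power2_eq_square)
      also have "\<dots> \<le> 4 / n * (\<pi> v * adoption_prob k E A v)"
        using pi_le[OF v] pi_nonneg[OF v] adoption_prob_bounds[of k E A v] by (intro mult_right_mono) auto
      finally show "(\<pi> v)\<^sup>2 * (adoption_prob k E A v * (1 - adoption_prob k E A v)) \<le> 4 / n * (\<pi> v * adoption_prob k E A v)" .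
    qed
    also have "\<dots> = 4 / n * M" by (simp add: M_def mean_weight_def sum_distrib_left)
    also have "4 / n * M / (\<delta> * b)\<^sup>2 \<le> (4 / n * \<alpha>) / (\<delta> * \<beta>)\<^sup>2"
    proof (intro frac_le mult_left_mono)
      have "0 \<le> c * \<alpha> * \<beta>" using c \<alpha> \<open>0 < \<beta>\<close> by simp
      then show "M \<le> \<alpha>" using drift by simp
      show "(\<delta> * \<beta>)\<^sup>2 \<le> (\<delta> * b)\<^sup>2" using \<open>\<beta> \<le> b\<close> \<open>0 < \<beta>\<close> d by (intro power_mono mult_left_mono) auto
    qed (use \<alpha> d \<open>0 < \<beta>\<close> n_pos in auto)
    finally show ?thesis by (simp add: divide_right_mono)
  qed
  also have "(4 * \<alpha> / n) / (\<delta> * \<beta>)\<^sup>2 \<le> c / 16 * (R * \<alpha> / (sqrt n * \<beta>))"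
  proof -
    \<comment> \<open>The claim reduces to
      \<open>16384 \<le> R * c ^ 3 * (sqrt n * \<beta>)\<close>. As \<open>sqrt n * \<beta>\<close>
      is at least R / 4, it suffices that \<open>65536 \<le> R * R * c ^ 3\<close>, and 65536 is the
      square of 256.\<close>
    have "256 \<le> R * c\<^sup>2" using R(3) c by (simp add: divide_le_eq)
    have "c \<le> 1" using c by simp
    have "65536 \<le> (R * c\<^sup>2) * (R * c\<^sup>2)" using mult_mono[OF \<open>256 \<le> R * c\<^sup>2\<close> \<open>256 \<le> R * c\<^sup>2\<close>] R(1) by simp
    also have "\<dots> = R * R * c ^ 3 * c" by (simp add: power2_eq_square power3_eq_cube)
    also have "\<dots> \<le> R * R * c ^ 3 * 1" using c R(1) by (intro mult_left_mono) auto
    finally have 1: "65536 \<le> R * R * c ^ 3" by simp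
    have "16384 * \<alpha> * 4 \<le> R * R * c ^ 3 * \<alpha>" using mult_right_mono[OF 1 \<alpha>] by simp
    also have "\<dots> = (R * c ^ 3 * \<alpha>) * (R / 4) * 4" by simp
    also have "\<dots> \<le> (R * c ^ 3 * \<alpha>) * (sqrt n * \<beta>) * 4" using beta R(1) c \<alpha> by (intro mult_right_mono mult_left_mono) auto
    finally have 2: "16384 * \<alpha> \<le> R * c ^ 3 * \<alpha> * (sqrt n * \<beta>)" by (simp add: ac_simps)
    have "(4 * \<alpha> / n) / (\<delta> * \<beta>)\<^sup>2 = 1024 * \<alpha> / ((sqrt n * \<beta>)\<^sup>2 * c\<^sup>2)"
      using n_pos by (simp add: \<delta>_def power_mult_distrib power_divide field_simps)
    also have "\<dots> = 16384 * \<alpha> / (16 * (sqrt n * \<beta>)\<^sup>2 * c\<^sup>2)" by simp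
    also have "\<dots> \<le> R * c ^ 3 * \<alpha> * (sqrt n * \<beta>) / (16 * (sqrt n * \<beta>)\<^sup>2 * c\<^sup>2)"
      using 2 by (rule divide_right_mono) simp
    also have "\<dots> = c / 16 * (R * \<alpha> / (sqrt n * \<beta>))"
      using \<open>0 < sqrt n * \<beta>\<close> c by (simp add: power2_eq_square power3_eq_cube)
    finally show ?thesis .
  qed
  also have "R * M / (sqrt n * ((1 - \<delta>) * b)) \<le> (1 - c / 8) * (R * \<alpha> / (sqrt n * \<beta>))"
  proof -
    have cb: "c * \<beta> \<le> c * (1 / 2)" using \<alpha> c unfolding ab by (intro mult_left_mono) auto
    have "0 \<le> 1 - c * \<beta>" using cb c by linarith
    have ratio: "(1 - c * \<beta>) / ((1 - \<delta>) * (1 + c * \<alpha>)) \<le> 1 - c / 8"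
    proof -
      have "0 < (1 - \<delta>) * (1 + c * \<alpha>)" using d c \<alpha> by (intro mult_pos_pos add_pos_nonneg) auto
      moreover have "1 - c * \<beta> \<le> (1 - c / 8) * ((1 - \<delta>) * (1 + c * \<alpha>))"
      proof -
        have "0 \<le> c * \<alpha>" "c * \<alpha> \<le> c * (1 / 2)" using c \<alpha> \<open>0 < \<beta>\<close> ab by (auto intro: mult_left_mono)
        then have "1 + c * \<alpha> \<le> 2" using c by linarith
        have "(1 - 3 * c / 16) * (1 + c * \<alpha>) \<le> ((1 - c / 8) * (1 - \<delta>)) * (1 + c * \<alpha>)"
          using c \<alpha> \<open>0 \<le> c * \<alpha>\<close> by (intro mult_right_mono) (auto simp: \<delta>_def algebra_simps)
        moreover have "c * (1 + c * \<alpha>) \<le> c * 2"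
          using c \<open>1 + c * \<alpha> \<le> 2\<close> by (intro mult_left_mono) auto
        moreover have "(1 - 3 * c / 16) * (1 + c * \<alpha>) = 1 + c * \<alpha> - 3 / 16 * (c * (1 + c * \<alpha>))" by (simp add: algebra_simps)
        \<comment> \<open>Since \<alpha> + \<beta> = 1 / 2, the gain c / 2 is the same in every
          state.\<close>
        moreover have "1 - c * \<beta> = 1 + c * \<alpha> - c / 2" unfolding ab by (simp add: algebra_simps)
        ultimately show ?thesis using c unfolding mult.assoc by linarith
      qed
      ultimately show ?thesis by (simp add: divide_le_eq)
    qed
    have "R * M / (sqrt n * ((1 - \<delta>) * b)) \<le> R * (\<alpha> * (1 - c * \<beta>)) / (sqrt n * ((1 - \<delta>) * (\<beta> * (1 + c * \<alpha>))))"
    proof (rule frac_le)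
      have "M \<le> \<alpha> * (1 - c * \<beta>)" using drift by (simp add: algebra_simps)
      then show "R * M \<le> R * (\<alpha> * (1 - c * \<beta>))" using R(1) by (intro mult_left_mono) auto
      show "0 \<le> R * (\<alpha> * (1 - c * \<beta>))" using R(1) \<alpha> \<open>0 \<le> 1 - c * \<beta>\<close> by simp
      show "0 < sqrt n * ((1 - \<delta>) * (\<beta> * (1 + c * \<alpha>)))"
        using sn d \<open>0 < \<beta> * (1 + c * \<alpha>)\<close> by (intro mult_pos_pos[of "sqrt n"] mult_pos_pos[of "1 - \<delta>"]) auto
      show "sqrt n * ((1 - \<delta>) * (\<beta> * (1 + c * \<alpha>))) \<le> sqrt n * ((1 - \<delta>) * b)"
        using sn d b by (intro mult_left_mono) auto
    qed
    also have "\<dots> = (R * \<alpha> / (sqrt n * \<beta>)) * ((1 - c * \<beta>) / ((1 - \<delta>) * (1 + c * \<alpha>)))"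
      by (simp only: times_divide_times_eq ac_simps)
    also have "\<dots> \<le> (R * \<alpha> / (sqrt n * \<beta>)) * (1 - c / 8)"
      using ratio R(1) \<alpha> \<open>0 < sqrt n * \<beta>\<close> by (intro mult_left_mono divide_nonneg_pos) auto
    finally show ?thesis by (simp only: mult.commute)
  qed
  finally have "measure_pmf.expectation (next_opinion A) (\<lambda>B. potential R \<bar>bias {v. B v}\<bar>) \<le>
    (1 - c / 8) * (R * \<alpha> / (sqrt n * \<beta>)) + c / 16 * (R * \<alpha> / (sqrt n * \<beta>))" by simp
  also have "\<dots> = (1 - c / 16) * (R * \<alpha> / (sqrt n * \<beta>))"
    by (simp only: ring_distribs[symmetric], rule arg_cong[where f = "\<lambda>x. x * _"]) simp
  also have "R * \<alpha> / (sqrt n * \<beta>) = potential R \<bar>bias A\<bar>"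
    using potential_eq[of R \<beta>] biased \<open>0 < \<beta>\<close> ab by (simp add: \<beta>_def)
  finally show ?thesis .
qed

text \<open>The two regimes correspond to the two arguments of \<open>max\<close> in the potential;
  exchanging the opinions covers negative bias.\<close>

lemma potential_contraction:
  fixes R \<mu> :: real
  defines "c \<equiv> (1 / 2) ^ (k - 2) / 2"
  assumes A: "A \<subseteq> V" and R: "R \<ge> 1" "32 * \<kappa> * (real k)\<^sup>2 \<le> c * R" "256 / c\<^sup>2 \<le> R"
    and n: "4 * R \<le> sqrt n" "128 * \<kappa> \<le> sqrt n"
    and mu: "\<mu> = 192 * 4 ^ k * (R + 1)" "8 * \<mu> \<le> sqrt n"
  shows "measure_pmf.expectation (round_samples k V E) (\<lambda>s. potential R \<bar>bias (careful_update V s A)\<bar>) \<le>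
    (1 - min (c / 16) (exp (- 4 * \<mu>\<^sup>2) / 8)) * potential R \<bar>bias A\<bar>"
proof -
  define g where "g = min (c / 16) (exp (- 4 * \<mu>\<^sup>2) / 8)"
  have g: "g \<le> c / 16" "g \<le> exp (- 4 * \<mu>\<^sup>2) / 8" unfolding g_def by (rule min.cobounded1 min.cobounded2)+
  have R0: "R > 0" using R(1) by simp
  have mono: "(1 - x) * potential R \<bar>bias A\<bar> \<le> (1 - g) * potential R \<bar>bias A\<bar>" if "g \<le> x" "A \<subseteq> V" for x A
    using that(1) by (intro mult_right_mono potential_nonneg R0 bias_bound that(2)) simp
  have *: "measure_pmf.expectation (next_opinion A) (\<lambda>B. potential R \<bar>bias {v. B v}\<bar>) \<le> (1 - g) * potential R \<bar>bias A\<bar>"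
    if A: "A \<subseteq> V" and "0 \<le> bias A" for A
  proof (cases "R * (1 / 2 - bias A) < sqrt n * bias A")
    case True
    show ?thesis
      by (rule order_trans[OF contraction_biased[OF A \<open>0 \<le> bias A\<close> R[unfolded c_def] n(1) True] mono[OF g(1)[unfolded c_def] A]])
  next
    case False
    then have "sqrt n * \<bar>bias A\<bar> \<le> R * (1 / 2 - \<bar>bias A\<bar>)" using \<open>0 \<le> bias A\<close> by simp
    then show ?thesis
      by (rule order_trans[OF contraction_balanced[OF A R(1) n mu] mono[OF g(2) A]])
  qed
  have "measure_pmf.expectation (next_opinion A) (\<lambda>B. potential R \<bar>bias {v. B v}\<bar>) \<le> (1 - g) * potential R \<bar>bias A\<bar>"
  proof (cases "0 \<le> bias A")
    case True
    then show ?thesis by (rule *[OF A])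
  next
    case False
    then have "measure_pmf.expectation (next_opinion (V - A)) (\<lambda>B. potential R \<bar>bias {v. B v}\<bar>) \<le>
        (1 - g) * potential R \<bar>bias (V - A)\<bar>"
      by (intro *) (simp_all add: bias_complement[OF A])
    then show ?thesis
      by (simp only: expectation_potential_complement[OF A] bias_complement[OF A] abs_minus)
  qed
  then show ?thesis unfolding expectation_update[OF A, where F = "\<lambda>A. potential R \<bar>bias A\<bar>"] g_def .
qed

lemma consensus_time_bound:
  fixes R \<mu> :: real
  defines "c \<equiv> (1 / 2) ^ (k - 2) / 2"
  defines "\<gamma> \<equiv> min (c / 16) (exp (- 4 * \<mu>\<^sup>2) / 8)"
  assumes A: "A \<subseteq> V" and R: "R \<ge> 1" "32 * \<kappa> * (real k)\<^sup>2 \<le> c * R" "256 / c\<^sup>2 \<le> R"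
    and n: "4 * R \<le> sqrt n" "128 * \<kappa> \<le> sqrt n" "exp 1 \<le> n"
    and mu: "\<mu> = 192 * 4 ^ k * (R + 1)" "8 * \<mu> \<le> sqrt n"
  shows "1 - n powr (- 1) \<le> measure (voting_space k V E)
    {\<omega> \<in> space (voting_space k V E). ereal_of_enat (consensus_time V A \<omega>) \<le> ereal ((3 / \<gamma> + 1) * ln n)}"
proof -
  \<comment> \<open>Three times \<open>ln n / \<gamma>\<close>: the contraction reaches n^(-3), of
    which n^2 is lost to the least potential before consensus.\<close>
  define t where "t = nat \<lceil>3 / \<gamma> * ln n\<rceil>"
  have c: "0 < c" "c \<le> 1 / 2" unfolding c_def by (auto intro: power_le_one)
  then have \<gamma>: "0 < \<gamma>" "\<gamma> \<le> 1" by (auto simp: \<gamma>_def min_def)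
  have "1 \<le> ln n" using n(3) n_pos by (simp add: ln_ge_iff)
  have t: "3 / \<gamma> * ln n \<le> real t" "real t \<le> 3 / \<gamma> * ln n + 1"
    using \<gamma> \<open>1 \<le> ln n\<close> by (auto simp: t_def)
  have "(1 - \<gamma>) ^ t \<le> exp (- \<gamma>) ^ t" using exp_ge_add_one_self[of "- \<gamma>"] \<gamma> by (intro power_mono) auto
  also have "\<dots> = exp (- (\<gamma> * real t))" by (simp flip: exp_of_nat_mult)
  also have "\<dots> \<le> exp (- (\<gamma> * (3 / \<gamma> * ln n)))" using t \<gamma> by (intro exp_mono le_imp_neg_le mult_left_mono) auto
  also have "\<dots> = n powr (- 3)" using \<gamma> n_pos by (simp add: powr_def)
  finally have "(1 - \<gamma>) ^ t * n\<^sup>2 \<le> n powr (- 3) * n\<^sup>2" by (rule mult_right_mono) simp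
  also have "n powr (- 3) * n\<^sup>2 = n powr (- 3) * n powr 2" using n_pos by simp
  also have "\<dots> = n powr (- 1)" unfolding powr_add[symmetric] by simp
  finally have "(1 - \<gamma>) ^ t * n\<^sup>2 \<le> n powr (- 1)" .
  moreover have "(1 - \<gamma>) ^ t / (1 / n\<^sup>2) = (1 - \<gamma>) ^ t * n\<^sup>2" by simp
  ultimately have "1 - n powr (- 1) \<le> 1 - (1 - \<gamma>) ^ t / (1 / n\<^sup>2)" by linarith
  also have "\<dots> \<le> measure (voting_space k V E)
    {\<omega> \<in> space (voting_space k V E). ereal_of_enat (consensus_time V A \<omega>) \<le> ereal ((3 / \<gamma> + 1) * ln n)}"
  proof (rule consensus_time_tail[where \<Phi> = "\<lambda>A. potential R \<bar>bias A\<bar>"])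
    show "measure_pmf.expectation (round_samples k V E) (\<lambda>s. potential R \<bar>bias (careful_update V s A)\<bar>) \<le>
      (1 - \<gamma>) * potential R \<bar>bias A\<bar>" if "A \<subseteq> V" for A
      unfolding \<gamma>_def c_def by (rule potential_contraction[OF that R(1) R(2,3)[unfolded c_def] n(1,2) mu])
    \<comment> \<open>The additional \<open>ln n\<close> absorbs the rounding of
      \<open>t\<close>.\<close>
    show "real t \<le> (3 / \<gamma> + 1) * ln n" using t \<open>1 \<le> ln n\<close> by (simp add: algebra_simps)
    show "1 / n\<^sup>2 \<le> potential R \<bar>bias A\<bar>" if "A \<subseteq> V" "A \<noteq> {}" "A \<noteq> V" for A
      using that R(1) n by (intro potential_ge) auto
  qed (use finite_V A R(1) \<gamma> n_pos bias_bound in \<open>auto intro!: potential_nonneg potential_le_1\<close>)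
  finally show ?thesis .
qed

end

section \<open>Pseudorandom graphs\<close>

definition degree_in :: "'a set set \<Rightarrow> 'a set \<Rightarrow> 'a \<Rightarrow> real" where
  "degree_in E A v = real (card (neighbours E v \<inter> A))"

lemma neighbours_vertex_pairs: "E \<subseteq> vertex_pairs V \<Longrightarrow> neighbours E v \<subseteq> V"
  by (auto simp: neighbours_def vertex_pairs_def)

lemma degree_in_eq_sum:
  assumes "finite A"
  shows "degree_in E A v = (\<Sum>w\<in>A. of_bool ({v, w} \<in> E))"
proof -
  have "neighbours E v \<inter> A = {w \<in> A. {v, w} \<in> E}" by (auto simp: neighbours_def)
  then show ?thesis using assms by (simp add: degree_in_def sum.If_cases of_bool_def Int_def)
qed

text \<open>Double counting of adjacent pairs; it expresses that weights proportional to the degrees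
  are stationary.\<close>

lemma sum_degree_in:
  assumes "finite V" "A \<subseteq> V"
  shows "(\<Sum>v\<in>V. degree_in E A v) = (\<Sum>w\<in>A. degree_in E V w)"
proof -
  have fin: "finite A" using assms finite_subset by blast
  have "(\<Sum>v\<in>V. degree_in E A v) = (\<Sum>v\<in>V. \<Sum>w\<in>A. of_bool ({v, w} \<in> E))"
    by (simp only: degree_in_eq_sum[OF fin])
  also have "\<dots> = (\<Sum>w\<in>A. \<Sum>v\<in>V. of_bool ({w, v} \<in> E))"
    by (subst sum.swap) (simp only: insert_commute)
  finally show ?thesis by (simp only: degree_in_eq_sum[OF assms(1)])
qed

text \<open>Double counting of walks of length two between members of \<open>A\<close>. The terms
  with w' = w are degrees, the others codegrees.\<close>

lemma sum_degree_in_square: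
  assumes "finite V" "A \<subseteq> V" "\<And>v. neighbours E v \<subseteq> V"
  shows "(\<Sum>v\<in>V. (degree_in E A v)\<^sup>2) = (\<Sum>w\<in>A. \<Sum>w'\<in>A. degree_in E (neighbours E w) w')"
proof -
  have fin: "finite A" using assms finite_subset by blast
  have "(\<Sum>v\<in>V. (degree_in E A v)\<^sup>2) = (\<Sum>v\<in>V. \<Sum>w\<in>A. \<Sum>w'\<in>A. of_bool ({v, w} \<in> E) * of_bool ({v, w'} \<in> E))"
    by (simp only: degree_in_eq_sum[OF fin] power2_eq_square sum_product)
  also have "\<dots> = (\<Sum>w\<in>A. \<Sum>v\<in>V. \<Sum>w'\<in>A. of_bool ({v, w} \<in> E) * of_bool ({v, w'} \<in> E))"
    by (rule sum.swap)
  also have "\<dots> = (\<Sum>w\<in>A. \<Sum>w'\<in>A. \<Sum>v\<in>V. of_bool ({v, w} \<in> E) * of_bool ({v, w'} \<in> E))"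
    by (intro sum.cong refl sum.swap)
  also have "\<dots> = (\<Sum>w\<in>A. \<Sum>w'\<in>A. degree_in E (neighbours E w) w')"
  proof (intro sum.cong refl)
    fix w w'
    have "(\<Sum>v\<in>V. of_bool ({v, w} \<in> E) * of_bool ({v, w'} \<in> E)) = (\<Sum>v\<in>neighbours E w. of_bool ({w', v} \<in> E) :: real)"
      using assms(1) assms(3)[of w]
      by (intro sum.mono_neutral_cong_right) (auto simp: neighbours_def insert_commute)
    also have "\<dots> = degree_in E (neighbours E w) w'"
      by (simp only: degree_in_eq_sum[OF finite_subset[OF assms(3) assms(1)]])
    finally show "(\<Sum>v\<in>V. of_bool ({v, w} \<in> E) * of_bool ({v, w'} \<in> E)) = degree_in E (neighbours E w) w'" .
  qed
  finally show ?thesis .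
qed

text \<open>The mean minimizes the second moment. So the centre \<alpha> may be replaced by the
  density of \<open>A\<close>, which suits the discrepancy bound, or by 0, which suits small
  sets.\<close>

lemma variance_le_second_moment:
  fixes \<pi> x :: "'a \<Rightarrow> real"
  assumes "sum \<pi> V = 1" "(\<Sum>v\<in>V. \<pi> v * x v) = \<alpha>"
  shows "(\<Sum>v\<in>V. \<pi> v * (x v - \<alpha>)\<^sup>2) \<le> (\<Sum>v\<in>V. \<pi> v * (x v - s)\<^sup>2)"
proof -
  have eq: "\<pi> v * (x v - s)\<^sup>2 = \<pi> v * (x v - \<alpha>)\<^sup>2 + (2 * (\<alpha> - s) * (\<pi> v * x v) + (s\<^sup>2 - \<alpha>\<^sup>2) * \<pi> v)" for v
    by (simp add: power2_eq_square algebra_simps)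
  have "(\<Sum>v\<in>V. \<pi> v * (x v - s)\<^sup>2) = (\<Sum>v\<in>V. \<pi> v * (x v - \<alpha>)\<^sup>2) + (2 * (\<alpha> - s) * \<alpha> + (s\<^sup>2 - \<alpha>\<^sup>2))"
    unfolding eq sum.distrib using assms by (simp flip: sum_distrib_left)
  moreover have "2 * (\<alpha> - s) * \<alpha> + (s\<^sup>2 - \<alpha>\<^sup>2) = (\<alpha> - s)\<^sup>2"
    by (simp add: power2_eq_square algebra_simps)
  moreover have "0 \<le> (\<alpha> - s)\<^sup>2" by simp
  ultimately show ?thesis by linarith
qed

text \<open>For small \<open>A\<close> the discrepancy bound is too weak to control the walk relative to the weight
  of \<open>A\<close>; there the codegrees are used.\<close>

lemma pseudorandom_voting_expander:
  fixes V :: "'a set" and p L \<eta> c :: real and k :: nat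
  defines "n \<equiv> real (card V)"
  defines "\<epsilon> \<equiv> ((1 / 2) ^ (k - 2) / (8 * (real k)\<^sup>2))\<^sup>2"
  assumes V: "finite V" "V \<noteq> {}" and E: "E \<subseteq> vertex_pairs V" and "k \<ge> 2" and "0 < p" "0 < L"
    and degree: "\<And>v. v \<in> V \<Longrightarrow> n * p / 2 \<le> degree_in E V v" "\<And>v. v \<in> V \<Longrightarrow> degree_in E V v \<le> 2 * (n * p)"
    and discrepancy: "\<And>A. A \<subseteq> V \<Longrightarrow> (\<Sum>v\<in>V. (degree_in E A v - p * real (card A))\<^sup>2) \<le> L * n\<^sup>2 * p"
    and codegree: "\<And>v w. v \<in> V \<Longrightarrow> w \<in> V \<Longrightarrow> v \<noteq> w \<Longrightarrow> degree_in E (neighbours E v) w \<le> \<eta> * n\<^sup>2 * p ^ 3"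
    and \<eta>: "512 * L * \<eta> = \<epsilon>\<^sup>2" and np: "4 \<le> n * p * \<epsilon>" and p: "c \<le> p * sqrt n" "0 < c"
  shows "voting_expander V E (\<lambda>v. degree_in E V v / (\<Sum>w\<in>V. degree_in E V w)) k (16 * L / c)"
proof
  let ?d = "degree_in E V"
  define D where "D = (\<Sum>w\<in>V. ?d w)"
  let ?\<pi> = "\<lambda>v. ?d v / D"
  let ?x = "fraction_in E"
  have sub: "neighbours E v \<subseteq> V" for v using E by (rule neighbours_vertex_pairs)
  have n: "0 < n" unfolding n_def using V by (simp add: card_gt_0_iff)
  have m: "0 < n * p" using n \<open>0 < p\<close> by simp
  have d: "0 < ?d v" if "v \<in> V" for v using degree(1)[OF that] m by linarith
  have D: "n * (n * p / 2) \<le> D" "D \<le> n * (2 * (n * p))"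
    using sum_mono[OF degree(1), of V "\<lambda>v. v"] sum_mono[OF degree(2), of V "\<lambda>v. v"]
    by (simp_all add: D_def n_def)
  have "0 < n * (n * p / 2)" using n m by simp
  then have "0 < D" using D by linarith
  have k: "0 < \<epsilon>" unfolding \<epsilon>_def using \<open>k \<ge> 2\<close> by simp
  have x_eq: "?x A v = degree_in E A v / ?d v" if "v \<in> V" for v A
  proof -
    have "neighbours E v \<noteq> {}" using d[OF that] by (auto simp: degree_in_def)
    then show ?thesis using sub[of v] by (simp add: fraction_in_def sampled_from_def degree_in_def Int_absorb2)
  qed
  have sum_alpha: "sum ?\<pi> A = (\<Sum>v\<in>A. ?d v) / D" for A by (rule sum_divide_distrib[symmetric])
  have pi1: "sum ?\<pi> V = 1" using \<open>0 < D\<close> unfolding sum_alpha by (simp add: D_def[symmetric])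
  have stat: "(\<Sum>v\<in>V. ?\<pi> v * ?x A v) = sum ?\<pi> A" if "A \<subseteq> V" for A
  proof -
    have "(\<Sum>v\<in>V. ?\<pi> v * ?x A v) = (\<Sum>v\<in>V. degree_in E A v / D)"
      using less_imp_neq[OF d] by (intro sum.cong) (force simp: x_eq)+
    also have "\<dots> = sum ?\<pi> A" unfolding sum_alpha sum_divide_distrib[symmetric] sum_degree_in[OF V(1) that] ..
    finally show ?thesis .
  qed
  have second: "(\<Sum>v\<in>V. ?\<pi> v * (?x A v - s)\<^sup>2) \<le> 2 / (n * p) / D * (\<Sum>v\<in>V. (degree_in E A v - s * ?d v)\<^sup>2)" for A s
    unfolding sum_distrib_left
  proof (rule sum_mono)
    fix v assume v: "v \<in> V"
    have e: "?x A v - s = (degree_in E A v - s * ?d v) / ?d v"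
      using d[OF v] by (simp add: x_eq[OF v] diff_divide_distrib)
    have "?\<pi> v * (?x A v - s)\<^sup>2 = 1 / ?d v / D * (degree_in E A v - s * ?d v)\<^sup>2"
      using d[OF v] unfolding e power_divide by (simp add: power2_eq_square)
    also have "\<dots> \<le> 2 / (n * p) / D * (degree_in E A v - s * ?d v)\<^sup>2"
    proof (intro mult_right_mono divide_right_mono)
      have "1 / ?d v \<le> 1 / (n * p / 2)" using degree(1)[OF v] m d[OF v] by (intro divide_left_mono) auto
      then show "1 / ?d v \<le> 2 / (n * p)" by simp
    qed (use \<open>0 < D\<close> in auto)
    finally show "?\<pi> v * (?x A v - s)\<^sup>2 \<le> 2 / (n * p) / D * (degree_in E A v - s * ?d v)\<^sup>2" .
  qed
  have Q: "(\<Sum>v\<in>V. ?\<pi> v * (?x A v - sum ?\<pi> A)\<^sup>2) \<le> 16 * L / (n * p)" if A: "A \<subseteq> V" for A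
  proof -
    \<comment> \<open>Centred at the density, \<open>s * ?d v\<close> is close to
      \<open>p * real (card A)\<close>; the difference is governed by the discrepancy of
      \<open>V\<close> itself.\<close>
    define s where "s = real (card A) / n"
    have s: "0 \<le> s" "s \<le> 1" using n card_mono[OF V(1) A] by (auto simp: s_def n_def)
    have "(\<Sum>v\<in>V. (degree_in E A v - s * ?d v)\<^sup>2) \<le>
      (\<Sum>v\<in>V. 2 * (degree_in E A v - p * real (card A))\<^sup>2 + 2 * (?d v - p * n)\<^sup>2)"
    proof (rule sum_mono)
      fix v
      let ?a = "degree_in E A v - p * real (card A)" and ?b = "?d v - p * n"
      have e: "degree_in E A v - s * ?d v = ?a - s * ?b" using n by (simp add: s_def field_simps)
      have "(?a - s * ?b)\<^sup>2 \<le> 2 * ?a\<^sup>2 + 2 * (s * ?b)\<^sup>2"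
        using zero_le_power2[of "?a + s * ?b"] by (simp add: power2_eq_square algebra_simps)
      moreover have "(s * ?b)\<^sup>2 \<le> ?b\<^sup>2"
        using s by (simp add: power_mult_distrib mult_left_le_one_le power_le_one)
      ultimately show "(degree_in E A v - s * ?d v)\<^sup>2 \<le> 2 * ?a\<^sup>2 + 2 * ?b\<^sup>2"
        unfolding e by linarith
    qed
    also have "\<dots> = 2 * (\<Sum>v\<in>V. (degree_in E A v - p * real (card A))\<^sup>2) + 2 * (\<Sum>v\<in>V. (?d v - p * real (card V))\<^sup>2)"
      by (simp add: sum.distrib sum_distrib_left n_def)
    also have "\<dots> \<le> 2 * (L * n\<^sup>2 * p) + 2 * (L * n\<^sup>2 * p)"
      by (intro add_mono mult_left_mono discrepancy A) auto
    finally have disc: "(\<Sum>v\<in>V. (degree_in E A v - s * ?d v)\<^sup>2) \<le> 4 * (L * n\<^sup>2 * p)" by linarith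
    have "(\<Sum>v\<in>V. ?\<pi> v * (?x A v - sum ?\<pi> A)\<^sup>2) \<le> (\<Sum>v\<in>V. ?\<pi> v * (?x A v - s)\<^sup>2)"
      by (rule variance_le_second_moment[OF pi1 stat[OF A]])
    also have "\<dots> \<le> 2 / (n * p) / D * (\<Sum>v\<in>V. (degree_in E A v - s * ?d v)\<^sup>2)" by (rule second)
    also have "\<dots> \<le> 2 / (n * p) / D * (4 * (L * n\<^sup>2 * p))"
      using disc m \<open>0 < D\<close> by (intro mult_left_mono) auto
    also have "\<dots> \<le> 2 / (n * p) / (n * (n * p / 2)) * (4 * (L * n\<^sup>2 * p))"
      using D(1) \<open>0 < n * (n * p / 2)\<close> m n \<open>0 < L\<close> \<open>0 < p\<close> by (intro mult_right_mono divide_left_mono mult_pos_pos \<open>0 < D\<close>) auto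
    also have "\<dots> = 16 * L / (n * p)" using n \<open>0 < p\<close> by (simp add: field_simps power2_eq_square)
    finally show ?thesis .
  qed
  show "finite V" by fact
  show "neighbours E v \<subseteq> V" for v by (rule sub)
  show "2 \<le> k" by fact
  show "sum ?\<pi> V = 1" by (rule pi1)
  show "1 / (4 * real (card V)) \<le> ?\<pi> v" if "v \<in> V" for v
  proof -
    have "(n * p / 2) / (n * (2 * (n * p))) \<le> ?\<pi> v"
      using degree(1)[OF that] D m n \<open>0 < D\<close> by (intro frac_le) auto
    then show ?thesis using n \<open>0 < p\<close> by (simp add: n_def)
  qed
  show "?\<pi> v \<le> 4 / real (card V)" if "v \<in> V" for v
  proof -
    have "?\<pi> v \<le> 2 * (n * p) / (n * (n * p / 2))"
      using degree(2)[OF that] D m n \<open>0 < n * (n * p / 2)\<close> by (intro frac_le) auto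
    then show ?thesis using n \<open>0 < p\<close> by (simp add: n_def)
  qed
  fix A assume A: "A \<subseteq> V"
  show "(\<Sum>v\<in>V. ?\<pi> v * ?x A v) = sum ?\<pi> A" by (rule stat[OF A])
  show "(\<Sum>v\<in>V. ?\<pi> v * (?x A v - sum ?\<pi> A)\<^sup>2) \<le> 16 * L / c / sqrt (real (card V))"
  proof -
    have "c * sqrt n \<le> p * sqrt n * sqrt n" using p n by (intro mult_right_mono) auto
    also have "\<dots> = n * p" using n by (simp add: mult.assoc)
    finally have "c * sqrt n \<le> n * p" .
    then have "16 * L / (n * p) \<le> 16 * L / (c * sqrt n)"
      using p n m \<open>0 < L\<close> by (intro divide_left_mono) auto
    then show ?thesis using Q[OF A] by (simp add: n_def)
  qed
  show "(\<Sum>v\<in>V. ?\<pi> v * (?x A v - sum ?\<pi> A)\<^sup>2) \<le> ((1 / 2) ^ (k - 2) / (8 * (real k)\<^sup>2))\<^sup>2 * sum ?\<pi> A"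
    unfolding \<epsilon>_def[symmetric]
  \<comment> \<open>If the absolute bound \<open>Q\<close> is too weak, \<alpha> is at most of order
    1 / (n p), so that p times the size of \<open>A\<close> is bounded by a constant.\<close>
  proof (cases "16 * L / (n * p) \<le> \<epsilon> * sum ?\<pi> A")
    case True
    then show "(\<Sum>v\<in>V. ?\<pi> v * (?x A v - sum ?\<pi> A)\<^sup>2) \<le> \<epsilon> * sum ?\<pi> A" using Q[OF A] by linarith
  next
    case False
    define \<alpha> where "\<alpha> = sum ?\<pi> A"
    define a where "a = real (card A)"
    have fin: "finite A" using A V finite_subset by blast
    have "0 \<le> \<alpha>" unfolding \<alpha>_def using A d \<open>0 < D\<close> by (intro sum_nonneg divide_nonneg_pos) (auto intro: less_imp_le)
    have dA: "(\<Sum>v\<in>A. ?d v) = \<alpha> * D" using \<open>0 < D\<close> unfolding \<alpha>_def sum_alpha by simp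
    have a1: "a * (n * p / 2) \<le> \<alpha> * D"
      unfolding dA[symmetric] a_def using A degree(1) by (intro sum_bounded_below) auto
    have "\<epsilon> * \<alpha> < 16 * L / (n * p)" using False by (simp add: \<alpha>_def)
    then have "\<epsilon> * \<alpha> * (n * p) \<le> 16 * L" using m by (simp add: field_simps)
    have "\<epsilon> * (\<alpha> * D) \<le> \<epsilon> * (\<alpha> * (n * (2 * (n * p))))" using k \<open>0 \<le> \<alpha>\<close> D by (intro mult_left_mono) auto
    also have "\<dots> = (\<epsilon> * \<alpha> * (n * p)) * (2 * n)" by simp
    also have "\<dots> \<le> 16 * L * (2 * n)" using \<open>\<epsilon> * \<alpha> * (n * p) \<le> 16 * L\<close> n by (intro mult_right_mono) auto
    finally have "\<epsilon> * (\<alpha> * D) \<le> 32 * L * n" by simp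
    moreover have "\<epsilon> * (a * (n * p / 2)) \<le> \<epsilon> * (\<alpha> * D)" using a1 k by (intro mult_left_mono) auto
    moreover have "\<epsilon> * (a * (n * p / 2)) = (\<epsilon> * a * p) * n / 2" by simp
    ultimately have "(\<epsilon> * a * p) * n \<le> (64 * L) * n" by linarith
    then have a2: "\<epsilon> * a * p \<le> 64 * L" using n by (rule mult_right_le_imp_le)
    have "(\<Sum>v\<in>V. (degree_in E A v)\<^sup>2) = (\<Sum>w\<in>A. \<Sum>w'\<in>A. degree_in E (neighbours E w) w')"
      by (rule sum_degree_in_square[OF V(1) A sub])
    also have "\<dots> \<le> (\<Sum>w\<in>A. \<Sum>w'\<in>A. \<eta> * n\<^sup>2 * p ^ 3 + (if w' = w then ?d w else 0))"
    proof (intro sum_mono)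
      fix w w' assume w: "w \<in> A" "w' \<in> A"
      have "0 \<le> \<eta> * n\<^sup>2 * p ^ 3"
      proof -
        have "0 \<le> 512 * L * \<eta>" using \<eta> by simp
        then have "0 \<le> \<eta>" using \<open>0 < L\<close> by (simp add: zero_le_mult_iff)
        then show ?thesis using \<open>0 < p\<close> by simp
      qed
      moreover have "degree_in E (neighbours E w) w = ?d w"
        using sub[of w] by (simp add: degree_in_def Int_absorb2)
      ultimately show "degree_in E (neighbours E w) w' \<le> \<eta> * n\<^sup>2 * p ^ 3 + (if w' = w then ?d w else 0)"
        using codegree[of w w'] w A by auto
    qed
    also have "\<dots> = a * a * (\<eta> * n\<^sup>2 * p ^ 3) + \<alpha> * D"
      using fin by (simp add: sum.distrib dA a_def algebra_simps)
    finally have "(\<Sum>v\<in>V. (degree_in E A v)\<^sup>2) \<le> a * a * (\<eta> * n\<^sup>2 * p ^ 3) + \<alpha> * D" .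
    moreover have "a * a * (\<eta> * n\<^sup>2 * p ^ 3) \<le> \<alpha> * D * (n * p * \<epsilon> / 4)"
    proof -
      \<comment> \<open>One factor \<epsilon> is used up by the bound \<open>a2\<close> on the size
        of \<open>A\<close>, the other becomes the relative precision; the off-diagonal codegrees
        then take half of the available bound.\<close>
      have \<eta>': "\<eta> = \<epsilon>\<^sup>2 / (512 * L)" using \<eta> \<open>0 < L\<close> by (simp add: field_simps)
      have "a * a * (\<eta> * n\<^sup>2 * p ^ 3) = (a * (n * p / 2)) * (\<epsilon> * a * p) * (\<epsilon> * (n * p)) / (256 * L)"
        using \<open>0 < L\<close> by (simp add: \<eta>' field_simps power2_eq_square power3_eq_cube)
      also have "\<dots> \<le> (\<alpha> * D) * (64 * L) * (\<epsilon> * (n * p)) / (256 * L)"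
        by (rule divide_right_mono, rule mult_right_mono, rule mult_mono[OF a1 a2])
          (use k m \<open>0 < L\<close> \<open>0 \<le> \<alpha>\<close> \<open>0 < D\<close> \<open>0 < p\<close> in \<open>auto simp: a_def\<close>)
      also have "\<dots> = \<alpha> * D * (n * p * \<epsilon> / 4)" using \<open>0 < L\<close> by (simp add: field_simps)
      finally show ?thesis .
    qed
    \<comment> \<open>The diagonal terms, that is, the degrees, take the other half; here n p has to
      be large.\<close>
    moreover have "\<alpha> * D * 1 \<le> \<alpha> * D * (n * p * \<epsilon> / 4)"
      using np \<open>0 \<le> \<alpha>\<close> \<open>0 < D\<close> by (intro mult_left_mono) auto
    moreover have "\<alpha> * D * (n * p * \<epsilon> / 2) = 2 * (\<alpha> * D * (n * p * \<epsilon> / 4))" by simp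
    ultimately have sq: "(\<Sum>v\<in>V. (degree_in E A v)\<^sup>2) \<le> \<alpha> * D * (n * p * \<epsilon> / 2)" by linarith
    have "(\<Sum>v\<in>V. ?\<pi> v * (?x A v - sum ?\<pi> A)\<^sup>2) \<le> (\<Sum>v\<in>V. ?\<pi> v * (?x A v - 0)\<^sup>2)"
      by (rule variance_le_second_moment[OF pi1 stat[OF A]])
    also have "\<dots> \<le> 2 / (n * p) / D * (\<Sum>v\<in>V. (degree_in E A v - 0 * ?d v)\<^sup>2)" by (rule second)
    also have "\<dots> \<le> 2 / (n * p) / D * (\<alpha> * D * (n * p * \<epsilon> / 2))"
      using sq m \<open>0 < D\<close> by (intro mult_left_mono) auto
    also have "\<dots> = \<epsilon> * sum ?\<pi> A" using n \<open>0 < p\<close> \<open>0 < D\<close> unfolding \<alpha>_def[symmetric] by simp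
    finally show "(\<Sum>v\<in>V. ?\<pi> v * (?x A v - sum ?\<pi> A)\<^sup>2) \<le> \<epsilon> * sum ?\<pi> A" .
  qed
qed

section \<open>Sums of squares over independent blocks\<close>

text \<open>Comparison with the two-sided geometric series of ratio 1 / 2, whose sum is 3.\<close>

lemma sum_exp_neg_square_le:
  "(\<Sum>j\<in>{- int N..int N}. exp (- (real_of_int j)\<^sup>2)) \<le> 3"
proof -
  have pt: "exp (- (real_of_int j)\<^sup>2) \<le> (1 / 2) ^ nat \<bar>j\<bar>" for j
  proof -
    have "real (nat \<bar>j\<bar>) \<le> (real_of_int j)\<^sup>2"
    proof -
      have "\<bar>j\<bar> * 1 \<le> \<bar>j\<bar> * \<bar>j\<bar>" by (cases "j = 0") (auto intro: mult_left_mono simp del: abs_mult_self_eq)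
      then have "\<bar>j\<bar> \<le> j\<^sup>2" by (simp add: power2_eq_square)
      then have "real_of_int \<bar>j\<bar> \<le> real_of_int (j\<^sup>2)" by (simp only: of_int_le_iff)
      then show ?thesis by simp
    qed
    then have "exp (- (real_of_int j)\<^sup>2) \<le> exp (real (nat \<bar>j\<bar>) * (- 1))" by simp
    also have "\<dots> = exp (- 1) ^ nat \<bar>j\<bar>" by (rule exp_of_nat_mult)
    also have "\<dots> \<le> (1 / 2) ^ nat \<bar>j\<bar>"
      using exp_ge_add_one_self[of 1] by (intro power_mono) (auto simp: exp_minus field_simps)
    finally show ?thesis .
  qed
  have "(\<Sum>j\<in>{- int N..int N}. exp (- (real_of_int j)\<^sup>2)) \<le> (\<Sum>j\<in>{- int N..int N}. (1 / 2) ^ nat \<bar>j\<bar>)"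
    by (intro sum_mono pt)
  also have "\<dots> = 3 - 2 * (1 / 2) ^ N"
  proof (induction N)
    case (Suc N)
    have "{- int (Suc N)..int (Suc N)} = insert (- int (Suc N)) (insert (int (Suc N)) {- int N..int N})" by auto
    then have "(\<Sum>j\<in>{- int (Suc N)..int (Suc N)}. (1 / 2) ^ nat \<bar>j\<bar>) =
        (1 / 2) ^ Suc N + (1 / 2) ^ Suc N + (\<Sum>j\<in>{- int N..int N}. (1 / 2) ^ nat \<bar>j\<bar> :: real)"
      by (simp add: nat_add_distrib)
    also have "\<dots> = 3 - 2 * (1 / 2) ^ Suc N" unfolding Suc.IH by simp
    finally show ?case .
  qed simp
  finally show ?thesis by (smt (verit) zero_le_power zero_le_divide_1_iff)
qed

text \<open>A discrete substitute for the Gaussian linearization of \<open>exp (x\<^sup>2 / (8 m))\<close>: some grid point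
  \<open>j / sqrt m\<close> is close to the maximizer \<open>\<theta> = x / (4 m)\<close> of \<open>\<theta> x - 2 m \<theta>\<^sup>2\<close>. Only \<open>\<bar>\<theta>\<bar> \<le> 1\<close> is
  used, where the moment generating function of a binomial variable is sub-Gaussian.\<close>

definition square_majorant :: "real \<Rightarrow> real \<Rightarrow> real" where
  "square_majorant m x =
     (\<Sum>j\<in>{- \<lfloor>sqrt m\<rfloor>..\<lfloor>sqrt m\<rfloor>}. exp (1 / 2) * exp (real_of_int j / sqrt m * x - 2 * (real_of_int j)\<^sup>2))"

lemma square_majorant_nonneg: "0 \<le> square_majorant m x"
  unfolding square_majorant_def by (intro sum_nonneg) auto

text \<open>With y = x / (4 sqrt m), the exponent at grid index j is
  \<open>2 * y\<^sup>2 - 2 * (j - y)\<^sup>2\<close>. Rounding y loses at most 1 / 2, which the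
  factor \<open>exp (1 / 2)\<close> repays, and \<open>\<bar>x\<bar> \<le> 2 * m\<close> keeps the
  rounded index in range.\<close>

lemma exp_square_le_majorant:
  assumes "m \<ge> 1" "\<bar>x\<bar> \<le> 2 * m"
  shows "exp (x\<^sup>2 / (8 * m)) \<le> square_majorant m x"
proof -
  define r where "r = sqrt m"
  have r: "r \<ge> 1" "r\<^sup>2 = m" using assms by (auto simp: r_def)
  define y where "y = x / (4 * r)"
  define j where "j = round y"
  have y: "\<bar>y\<bar> \<le> r / 2"
  proof -
    have "\<bar>y\<bar> = \<bar>x\<bar> / (4 * r)" using r by (simp add: y_def abs_divide)
    also have "\<dots> \<le> 2 * r\<^sup>2 / (4 * r)" using assms r by (intro divide_right_mono) auto
    also have "\<dots> = r / 2" using r(1) by (simp add: power2_eq_square)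
    finally show ?thesis .
  qed
  have j: "\<bar>real_of_int j - y\<bar> \<le> 1 / 2" unfolding j_def by (rule of_int_round_abs_le)
  then have "\<bar>real_of_int j\<bar> \<le> r" using y r by linarith
  then have "real_of_int j \<le> r" "real_of_int (- j) \<le> r" by auto
  then have mem: "j \<in> {- \<lfloor>sqrt m\<rfloor>..\<lfloor>sqrt m\<rfloor>}"
    unfolding r_def[symmetric] using le_floor_iff[of j r] le_floor_iff[of "- j" r] by auto
  have "\<bar>real_of_int j - y\<bar>\<^sup>2 \<le> (1 / 2)\<^sup>2" using j by (intro power_mono) auto
  then have sq: "(real_of_int j - y)\<^sup>2 \<le> 1 / 4" by (simp add: power2_eq_square)
  have "x = 4 * r * y" using r by (simp add: y_def)
  then have "x\<^sup>2 / (8 * m) = 2 * y\<^sup>2" "real_of_int j / r * x = 4 * real_of_int j * y"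
    using r by (auto simp: power_mult_distrib simp flip: r(2))
  moreover have "2 * y\<^sup>2 - 2 * (real_of_int j - y)\<^sup>2 = 4 * real_of_int j * y - 2 * (real_of_int j)\<^sup>2"
    by (simp add: power2_eq_square algebra_simps)
  ultimately have "x\<^sup>2 / (8 * m) \<le> 1 / 2 + (real_of_int j / sqrt m * x - 2 * (real_of_int j)\<^sup>2)"
    using sq unfolding r_def[symmetric] by linarith
  then have "exp (x\<^sup>2 / (8 * m)) \<le> exp (1 / 2) * exp (real_of_int j / sqrt m * x - 2 * (real_of_int j)\<^sup>2)"
    by (simp flip: exp_add)
  also have "\<dots> \<le> square_majorant m x"
    unfolding square_majorant_def using mem by (intro member_le_sum) auto
  finally show ?thesis .
qed

text \<open>The moment generating function at j / sqrt m costs \<open>exp (j\<^sup>2)\<close>, half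
  of the exponent of the weight \<open>exp (- 2 * j\<^sup>2)\<close>; what remains is summable with
  a bound independent of m.\<close>

lemma expectation_square_majorant:
  assumes "finite V" "0 \<le> p" "p \<le> 1" "S \<subseteq> V" "m \<ge> 1" "p * real (card S) \<le> m"
  shows "measure_pmf.expectation (independent_bits V (\<lambda>_. p)) (\<lambda>B. square_majorant m (\<Sum>v\<in>S. of_bool (B v) - p)) \<le> 8"
proof -
  let ?E = "measure_pmf.expectation (independent_bits V (\<lambda>_. p))"
  let ?D = "\<lambda>B. \<Sum>v\<in>S. of_bool (B v) - p"
  let ?J = "{- \<lfloor>sqrt m\<rfloor>..\<lfloor>sqrt m\<rfloor>}"
  have "?E (\<lambda>B. square_majorant m (?D B)) =
    (\<Sum>j\<in>?J. exp (1 / 2) * (exp (- 2 * (real_of_int j)\<^sup>2) * ?E (\<lambda>B. exp (real_of_int j / sqrt m * ?D B))))"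
    unfolding square_majorant_def
    by (simp add: Bochner_Integration.integral_sum integrable_independent_bits[OF assms(1)] diff_conv_add_uminus exp_add mult.commute del: add_uminus_conv_diff)
  also have "\<dots> \<le> (\<Sum>j\<in>?J. exp (1 / 2) * (exp (- 2 * (real_of_int j)\<^sup>2) * exp ((real_of_int j)\<^sup>2)))"
  proof (intro sum_mono mult_left_mono)
    fix j assume j: "j \<in> ?J"
    have "\<bar>real_of_int j\<bar> \<le> sqrt m"
      using j le_floor_iff[of j "sqrt m"] le_floor_iff[of "- j" "sqrt m"] by auto
    then have 1: "\<bar>real_of_int j / sqrt m\<bar> \<le> 1" using assms(5) by (simp add: abs_divide)
    have "?E (\<lambda>B. exp (real_of_int j / sqrt m * ?D B)) \<le> exp ((real_of_int j / sqrt m)\<^sup>2 * (\<Sum>v\<in>S. p))"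
      using assms 1 by (intro independent_bits_block_mgf) auto
    also have "\<dots> \<le> exp ((real_of_int j / sqrt m)\<^sup>2 * m)"
      using assms by (intro exp_mono mult_left_mono) (auto simp: mult.commute)
    also have "\<dots> = exp ((real_of_int j)\<^sup>2)" using assms(5) by (simp add: power_divide)
    finally show "?E (\<lambda>B. exp (real_of_int j / sqrt m * ?D B)) \<le> exp ((real_of_int j)\<^sup>2)" .
  qed auto
  also have "\<dots> = exp (1 / 2) * (\<Sum>j\<in>?J. exp (- (real_of_int j)\<^sup>2))"
    by (simp add: sum_distrib_left flip: exp_add)
  also have "\<dots> \<le> exp (1 / 2) * 3"
    using sum_exp_neg_square_le[of "nat \<lfloor>sqrt m\<rfloor>"] assms(5) by (intro mult_left_mono) auto
  also have "\<dots> \<le> 8" using exp_le_quadratic[of "1 / 2"] by (simp add: power2_eq_square)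
  finally show ?thesis .
qed

text \<open>Exponential Markov inequality for the product of the majorants, which are independent.
  The bound on the individual deviations is part of the event because the majorant dominates only in
  that range.\<close>

lemma block_square_sum_tail:
  assumes "finite V" "0 \<le> p" "p \<le> 1" "finite I" "disjoint_family_on S I"
    and S: "\<And>i. i \<in> I \<Longrightarrow> S i \<subseteq> V" "\<And>i. i \<in> I \<Longrightarrow> p * real (card (S i)) \<le> m" and "m \<ge> 1"
  shows "measure_pmf.prob (independent_bits V (\<lambda>_. p))
      {B. (\<forall>i\<in>I. \<bar>\<Sum>e\<in>S i. of_bool (B e) - p\<bar> \<le> 2 * m) \<and> T \<le> (\<Sum>i\<in>I. (\<Sum>e\<in>S i. of_bool (B e) - p)\<^sup>2)}
    \<le> 8 ^ card I * exp (- T / (8 * m))"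
proof -
  let ?P = "independent_bits V (\<lambda>_. p)"
  let ?D = "\<lambda>i B. \<Sum>e\<in>S i. of_bool (B e) - p"
  let ?G = "\<lambda>B. \<Prod>i\<in>I. square_majorant m (?D i B)"
  have "measure_pmf.expectation ?P ?G = (\<Prod>i\<in>I. measure_pmf.expectation ?P (\<lambda>B. square_majorant m (?D i B)))"
  proof (rule expectation_independent_bits_prod_blocks[OF assms(1) _ assms(4,5)])
    show "0 \<le> p \<and> p \<le> 1" using assms(2,3) by simp
  next
    fix i and B B' :: "'a \<Rightarrow> bool" assume "\<And>v. v \<in> S i \<Longrightarrow> B v = B' v"
    then have "?D i B = ?D i B'" by (intro sum.cong) auto
    then show "square_majorant m (?D i B) = square_majorant m (?D i B')" by simp
  qed
  also have "\<dots> \<le> (\<Prod>i\<in>I. 8)"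
    using assms(1-3) S \<open>m \<ge> 1\<close> by (intro prod_mono conjI expectation_square_majorant Bochner_Integration.integral_nonneg) (auto simp: square_majorant_nonneg)
  also have "(\<Prod>i\<in>I. 8) = (8 ^ card I :: real)" by simp
  finally have E: "measure_pmf.expectation ?P ?G \<le> 8 ^ card I" .
  have "measure_pmf.prob ?P {B. (\<forall>i\<in>I. \<bar>?D i B\<bar> \<le> 2 * m) \<and> T \<le> (\<Sum>i\<in>I. (?D i B)\<^sup>2)} \<le>
    measure_pmf.prob ?P {B. exp (T / (8 * m)) \<le> ?G B}"
  proof (intro measure_pmf.finite_measure_mono subsetI)
    fix B assume "B \<in> {B. (\<forall>i\<in>I. \<bar>?D i B\<bar> \<le> 2 * m) \<and> T \<le> (\<Sum>i\<in>I. (?D i B)\<^sup>2)}"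
    then have B: "\<And>i. i \<in> I \<Longrightarrow> \<bar>?D i B\<bar> \<le> 2 * m" "T \<le> (\<Sum>i\<in>I. (?D i B)\<^sup>2)" by auto
    have "exp (T / (8 * m)) \<le> exp ((\<Sum>i\<in>I. (?D i B)\<^sup>2) / (8 * m))"
      using B(2) assms by (intro exp_mono divide_right_mono) auto
    also have "\<dots> = (\<Prod>i\<in>I. exp ((?D i B)\<^sup>2 / (8 * m)))"
      using assms by (simp add: sum_divide_distrib exp_sum)
    also have "\<dots> \<le> ?G B"
      using B(1) assms by (intro prod_mono) (auto intro: exp_square_le_majorant)
    finally show "B \<in> {B. exp (T / (8 * m)) \<le> ?G B}" by simp
  qed simp
  also have "\<dots> \<le> measure_pmf.expectation ?P ?G / exp (T / (8 * m))"
    using assms by (intro pmf_markov finite_set_independent_bits prod_nonneg) (auto simp: square_majorant_nonneg)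
  also have "\<dots> \<le> 8 ^ card I / exp (T / (8 * m))" using E by (rule divide_right_mono) simp
  also have "\<dots> = 8 ^ card I * exp (- T / (8 * m))"
    unfolding minus_divide_left[symmetric] exp_minus by (simp only: field_class.field_divide_inverse)
  finally show ?thesis .
qed

section \<open>The random graph\<close>

definition graph_of :: "'a set \<Rightarrow> ('a set \<Rightarrow> bool) \<Rightarrow> 'a set set" where
  "graph_of V B = {e \<in> vertex_pairs V. B e}"

definition star :: "'a \<Rightarrow> 'a set \<Rightarrow> 'a set set" where
  "star v A = (\<lambda>w. {v, w}) ` (A - {v})"

lemma finite_vertex_pairs: "finite V \<Longrightarrow> finite (vertex_pairs V)"
  by (rule finite_subset[of _ "Pow V"]) (auto simp: vertex_pairs_def)

lemma inj_on_star: "inj_on (\<lambda>w. {v, w}) A"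
  by (auto simp: inj_on_def doubleton_eq_iff)

lemma card_star: "card (star v A) = card (A - {v})"
  unfolding star_def by (intro card_image inj_on_star)

lemma star_subset: "v \<in> V \<Longrightarrow> A \<subseteq> V \<Longrightarrow> star v A \<subseteq> vertex_pairs V"
  by (auto simp: star_def vertex_pairs_def card_insert_if)

lemma degree_in_graph_of:
  assumes "finite V" "v \<in> V" "A \<subseteq> V"
  shows "degree_in (graph_of V B) A v = (\<Sum>e\<in>star v A. of_bool (B e))"
proof -
  have fin: "finite A" using assms finite_subset by blast
  have "degree_in (graph_of V B) A v = (\<Sum>w\<in>A. of_bool ({v, w} \<in> graph_of V B))"
    by (rule degree_in_eq_sum[OF fin])
  also have "\<dots> = (\<Sum>w\<in>A - {v}. of_bool (B {v, w}))"
    using assms fin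
    by (intro sum.mono_neutral_cong_right) (auto simp: graph_of_def vertex_pairs_def card_insert_if subset_iff)
  also have "\<dots> = (\<Sum>e\<in>star v A. of_bool (B e))"
    unfolding star_def by (subst sum.reindex[OF inj_on_star]) simp
  finally show ?thesis .
qed

definition deviation :: "real \<Rightarrow> ('b \<Rightarrow> bool) \<Rightarrow> 'b set \<Rightarrow> real" where
  "deviation p B S = (\<Sum>e\<in>S. of_bool (B e) - p)"

lemma deviation_eq: "deviation p B S = (\<Sum>e\<in>S. of_bool (B e)) - p * real (card S)"
  by (simp add: deviation_def sum_subtractf mult.commute)

lemma prob_UN_le:
  assumes "finite I" "\<And>i. i \<in> I \<Longrightarrow> measure_pmf.prob P (A i) \<le> b"
  shows "measure_pmf.prob P (\<Union>i\<in>I. A i) \<le> real (card I) * b"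
proof -
  have "measure_pmf.prob P (\<Union>i\<in>I. A i) \<le> (\<Sum>i\<in>I. measure_pmf.prob P (A i))"
    using assms(1) by (intro measure_pmf.finite_measure_subadditive_finite) auto
  also have "\<dots> \<le> real (card I) * b" using assms(2) by (intro sum_bounded_above) auto
  finally show ?thesis .
qed

lemma expectation_all_true:
  assumes "finite V" "0 \<le> p" "p \<le> 1" "F \<subseteq> V"
  shows "measure_pmf.expectation (independent_bits V (\<lambda>_. p)) (\<lambda>B. \<Prod>v\<in>F. of_bool (B v)) = p ^ card F"
proof -
  have *: "(\<Prod>v\<in>F. of_bool (B v)) = (\<Prod>v\<in>V. if v \<in> F then of_bool (B v) else (1 :: real))" for B
    using assms by (intro prod.mono_neutral_cong_left) auto
  have "measure_pmf.expectation (independent_bits V (\<lambda>_. p)) (\<lambda>B. \<Prod>v\<in>F. of_bool (B v)) =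
    (\<Prod>v\<in>V. p * (if v \<in> F then of_bool True else 1) + (1 - p) * (if v \<in> F then of_bool False else 1))"
    unfolding * using assms
    by (intro expectation_independent_bits_prod[where g = "\<lambda>v b. if v \<in> F then of_bool b else 1"]) auto
  also have "\<dots> = (\<Prod>v\<in>F. p)" using assms by (intro prod.mono_neutral_cong_right) auto
  finally show ?thesis by simp
qed

text \<open>For different middle vertices u the two edges joining u to v and w form disjoint blocks,
  so the codegree is a sum of independent indicators of mean p^2. The exponential Markov inequality
  is used with parameter 1 and \<open>exp 1 - 1 \<le> 2\<close>.\<close>

lemma codegree_tail:
  assumes "finite V" "0 \<le> p" "p \<le> 1" "v \<in> V" "w \<in> V" "v \<noteq> w"
  shows "measure_pmf.prob (independent_bits (vertex_pairs V) (\<lambda>_. p))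
    {B. t \<le> degree_in (graph_of V B) (neighbours (graph_of V B) v) w} \<le> exp (2 * (real (card V) * p\<^sup>2) - t)"
proof -
  let ?P = "independent_bits (vertex_pairs V) (\<lambda>_. p)"
  let ?U = "V - {v, w}"
  let ?f = "\<lambda>u B. of_bool (B {v, u}) * of_bool (B {w, u}) :: real"
  have finP: "finite (vertex_pairs V)" using assms(1) by (rule finite_vertex_pairs)
  have eq: "degree_in (graph_of V B) (neighbours (graph_of V B) v) w = (\<Sum>u\<in>?U. ?f u B)" for B
  proof -
    let ?N = "neighbours (graph_of V B) v"
    have N: "?N = {u \<in> V - {v}. B {v, u}}"
      using assms by (auto simp: neighbours_def graph_of_def vertex_pairs_def card_insert_if)
    have "degree_in (graph_of V B) ?N w = (\<Sum>u\<in>?N. of_bool ({w, u} \<in> graph_of V B))"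
      using assms by (intro degree_in_eq_sum) (simp add: N)
    also have "\<dots> = (\<Sum>u\<in>?U. ?f u B)"
      unfolding N using assms
      by (intro sum.mono_neutral_cong) (auto simp: graph_of_def vertex_pairs_def card_insert_if)
    finally show ?thesis .
  qed
  have "measure_pmf.expectation ?P (\<lambda>B. \<Prod>u\<in>?U. exp (?f u B)) = (\<Prod>u\<in>?U. measure_pmf.expectation ?P (\<lambda>B. exp (?f u B)))"
  proof (rule expectation_independent_bits_prod_blocks[OF finP, where S = "\<lambda>u. {{v, u}, {w, u}}"])
    show "disjoint_family_on (\<lambda>u. {{v, u}, {w, u}}) ?U"
      by (auto simp: disjoint_family_on_def doubleton_eq_iff)
    show "exp (?f u B) = exp (?f u B')" if "\<And>e. e \<in> {{v, u}, {w, u}} \<Longrightarrow> B e = B' e" for u B B'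
      using that[of "{v, u}"] that[of "{w, u}"] by simp
  qed (use assms(1-3) in auto)
  also have "\<dots> \<le> (\<Prod>u\<in>?U. exp (2 * p\<^sup>2))"
  proof (intro prod_mono conjI)
    fix u assume u: "u \<in> ?U"
    have ne: "{v, u} \<noteq> {w, u}" using assms(6) by (auto simp: doubleton_eq_iff)
    have sub: "{{v, u}, {w, u}} \<subseteq> vertex_pairs V"
      using u assms by (auto simp: vertex_pairs_def card_insert_if)
    have "measure_pmf.expectation ?P (\<lambda>B. exp (?f u B)) = measure_pmf.expectation ?P (\<lambda>B. 1 + (exp 1 - 1) * (\<Prod>e\<in>{{v, u}, {w, u}}. of_bool (B e)))"
      using ne by (intro Bochner_Integration.integral_cong) auto
    also have "\<dots> = 1 + (exp 1 - 1) * p ^ card {{v, u}, {w, u}}"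
      using expectation_all_true[OF finP assms(2,3) sub] by (simp add: integrable_independent_bits[OF finP])
    also have "\<dots> = 1 + (exp 1 - 1) * p\<^sup>2" using ne by (simp add: power2_eq_square)
    also have "\<dots> \<le> 1 + 2 * p\<^sup>2" using exp_le by (intro add_left_mono mult_right_mono) auto
    also have "\<dots> \<le> exp (2 * p\<^sup>2)" by (rule exp_ge_add_one_self)
    finally show "measure_pmf.expectation ?P (\<lambda>B. exp (?f u B)) \<le> exp (2 * p\<^sup>2)" .
  qed simp
  also have "\<dots> = exp (real (card ?U) * (2 * p\<^sup>2))" by (simp only: prod_constant exp_of_nat_mult)
  also have "\<dots> \<le> exp (real (card V) * (2 * p\<^sup>2))"
    using assms(1) by (intro exp_mono mult_right_mono) (auto intro: card_mono)
  finally have E: "measure_pmf.expectation ?P (\<lambda>B. \<Prod>u\<in>?U. exp (?f u B)) \<le> exp (real (card V) * (2 * p\<^sup>2))" .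
  have "measure_pmf.prob ?P {B. t \<le> degree_in (graph_of V B) (neighbours (graph_of V B) v) w} =
    measure_pmf.prob ?P {B. exp t \<le> (\<Prod>u\<in>?U. exp (?f u B))}"
    unfolding eq using assms(1) by (simp add: exp_sum[symmetric])
  also have "\<dots> \<le> measure_pmf.expectation ?P (\<lambda>B. \<Prod>u\<in>?U. exp (?f u B)) / exp t"
    by (intro pmf_markov finite_set_independent_bits finP prod_nonneg) auto
  also have "\<dots> \<le> exp (real (card V) * (2 * p\<^sup>2)) / exp t" using E by (rule divide_right_mono) simp
  also have "\<dots> = exp (2 * (real (card V) * p\<^sup>2) - t)" by (simp add: exp_diff mult.left_commute)
  finally show ?thesis .
qed

text \<open>Chernoff's bound with \<theta> = 1 / 8, the minimizer of
  \<open>\<theta>\<^sup>2 - \<theta> / 4\<close>.\<close>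

lemma degree_deviation_tail:
  assumes "finite V" "0 \<le> p" "p \<le> 1" "v \<in> V"
  shows "measure_pmf.prob (independent_bits (vertex_pairs V) (\<lambda>_. p))
    {B. real (card V) * p / 4 \<le> \<bar>deviation p B (star v V)\<bar>} \<le> 2 * exp (- (real (card V) * p / 64))"
proof -
  have "measure_pmf.prob (independent_bits (vertex_pairs V) (\<lambda>_. p))
    {B. real (card V) * p / 4 \<le> \<bar>deviation p B (star v V)\<bar>} \<le>
    2 * exp ((1 / 8)\<^sup>2 * (\<Sum>e\<in>star v V. p) - 1 / 8 * (real (card V) * p / 4))"
    unfolding deviation_def using assms
    by (intro independent_bits_chernoff finite_vertex_pairs star_subset) auto
  also have "(1 / 8)\<^sup>2 * (\<Sum>e\<in>star v V. p) - 1 / 8 * (real (card V) * p / 4) \<le> - (real (card V) * p / 64)"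
  proof -
    have "real (card (star v V)) \<le> real (card V)"
      unfolding card_star using assms(1) by (simp add: card_mono)
    then have "real (card (star v V)) * p \<le> real (card V) * p" using assms(2) by (rule mult_right_mono)
    then show ?thesis by (simp add: power2_eq_square)
  qed
  finally show ?thesis by simp
qed

text \<open>Counting every edge at its larger, respectively smaller, endpoint makes the contributions of
  different vertices independent.\<close>

lemma discrepancy_tail:
  fixes n :: nat and p :: real
  assumes p: "0 \<le> p" "p \<le> 1" and np: "1 \<le> real n * p" and A: "A \<subseteq> {..<n}"
  shows "measure_pmf.prob (independent_bits (vertex_pairs {..<n}) (\<lambda>_. p))
    {B. (\<forall>v<n. \<bar>deviation p B (star v {..<n})\<bar> \<le> real n * p / 4) \<and>
        243 * (real n)\<^sup>2 * p < (\<Sum>v<n. (degree_in (graph_of {..<n} B) A v - p * real (card A))\<^sup>2)}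
    \<le> 2 * (8 ^ n * exp (- 5 * real n))"
proof -
  let ?P = "independent_bits (vertex_pairs {..<n}) (\<lambda>_. p)"
  let ?V = "{..<n}"
  define m where "m = real n * p"
  \<comment> \<open>Chosen such that T / (8 m) = 5 n, enough for a union bound over all vertex sets.
    The constant 243 is 3 * 40 + 3 * 40 + 3, from splitting a square into three.\<close>
  define T where "T = 40 * (real n)\<^sup>2 * p"
  have n: "0 < n" using np by (cases n) auto
  define S1 where "S1 = (\<lambda>v. star v (A \<inter> {..<v}))"
  define S2 where "S2 = (\<lambda>v. star v (A \<inter> {v<..}))"
  define bad :: "(nat \<Rightarrow> nat set set) \<Rightarrow> (nat set \<Rightarrow> bool) set"
    where "bad = (\<lambda>S. {B. (\<forall>v\<in>?V. \<bar>\<Sum>e\<in>S v. of_bool (B e) - p\<bar> \<le> 2 * m) \<and> T \<le> (\<Sum>v\<in>?V. (\<Sum>e\<in>S v. of_bool (B e) - p)\<^sup>2)})"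
  have fin: "finite A" using A finite_subset by blast
  have sub: "S1 v \<subseteq> star v ?V" "S2 v \<subseteq> star v ?V" for v using A by (auto simp: S1_def S2_def star_def)
  have fins: "finite (star v ?V)" for v by (simp add: star_def)
  have card: "p * real (card S) \<le> m" if "S \<subseteq> star v ?V" for S v
  proof -
    have "card S \<le> card (star v ?V)" using that fins by (rule card_mono[rotated])
    also have "\<dots> \<le> n" unfolding card_star using card_mono[of ?V "?V - {v}"] by auto
    finally have "p * real (card S) \<le> p * real n" using p by (intro mult_left_mono) auto
    then show ?thesis by (simp add: m_def mult.commute)
  qed
  have tail: "measure_pmf.prob ?P (bad S) \<le> 8 ^ n * exp (- 5 * real n)"
    if "disjoint_family_on S ?V" "\<And>v. S v \<subseteq> star v ?V" for S
  proof -
    have "measure_pmf.prob ?P (bad S) \<le> 8 ^ card ?V * exp (- T / (8 * m))"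
      unfolding bad_def
    proof (rule block_square_sum_tail)
      show "S v \<subseteq> vertex_pairs ?V" if "v \<in> ?V" for v
        using \<open>S v \<subseteq> star v ?V\<close> star_subset[OF that, of ?V] by blast
      show "p * real (card (S v)) \<le> m" for v by (rule card[OF that(2)])
    qed (use p np that(1) in \<open>auto simp: finite_vertex_pairs m_def\<close>)
    also have "- T / (8 * m) = - 5 * real n" using np n by (auto simp: T_def m_def power2_eq_square)
    finally show ?thesis by simp
  qed
  have "disjoint_family_on S1 ?V" "disjoint_family_on S2 ?V"
    by (auto simp: disjoint_family_on_def S1_def S2_def star_def doubleton_eq_iff)
  then have tails: "measure_pmf.prob ?P (bad S1) \<le> 8 ^ n * exp (- 5 * real n)"
      "measure_pmf.prob ?P (bad S2) \<le> 8 ^ n * exp (- 5 * real n)"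
    using tail sub by auto
  have "measure_pmf.prob ?P {B. (\<forall>v<n. \<bar>deviation p B (star v ?V)\<bar> \<le> real n * p / 4) \<and>
        243 * (real n)\<^sup>2 * p < (\<Sum>v<n. (degree_in (graph_of ?V B) A v - p * real (card A))\<^sup>2)} \<le>
     measure_pmf.prob ?P (bad S1 \<union> bad S2)"
  proof (intro measure_pmf.finite_measure_mono subsetI)
    fix B assume "B \<in> {B. (\<forall>v<n. \<bar>deviation p B (star v ?V)\<bar> \<le> real n * p / 4) \<and>
        243 * (real n)\<^sup>2 * p < (\<Sum>v<n. (degree_in (graph_of ?V B) A v - p * real (card A))\<^sup>2)}"
    then have dev: "\<And>v. v < n \<Longrightarrow> \<bar>deviation p B (star v ?V)\<bar> \<le> m / 4"
      and big: "243 * (real n)\<^sup>2 * p < (\<Sum>v<n. (degree_in (graph_of ?V B) A v - p * real (card A))\<^sup>2)"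
      by (auto simp: m_def)
    \<comment> \<open>The number of edges in a partial star lies between 0 and the degree, so
      regular degrees alone yield the range that the square majorant requires, for all sets
      \<open>A\<close> at once.\<close>
    have small: "\<bar>deviation p B S\<bar> \<le> 2 * m" if "v < n" "S \<subseteq> star v ?V" for S v
    proof -
      have "(\<Sum>e\<in>S. of_bool (B e)) \<le> (\<Sum>e\<in>star v ?V. of_bool (B e) :: real)"
        using that fins by (intro sum_mono2) auto
      moreover have "(0 :: real) \<le> (\<Sum>e\<in>S. of_bool (B e))" by (intro sum_nonneg) auto
      moreover have "(\<Sum>e\<in>star v ?V. of_bool (B e)) = deviation p B (star v ?V) + p * real (card (star v ?V))"
        by (simp add: deviation_eq)
      moreover have "0 \<le> p * real (card S)" using p by simp
      moreover have "1 \<le> m" using np by (simp add: m_def)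
      ultimately show ?thesis
        using dev[OF that(1)] card[OF that(2)] card[OF subset_refl, of v] unfolding deviation_eq[of p B S] by linarith
    qed
    have pt: "(degree_in (graph_of ?V B) A v - p * real (card A))\<^sup>2 \<le> 3 * (deviation p B (S1 v))\<^sup>2 + 3 * (deviation p B (S2 v))\<^sup>2 + 3 * p\<^sup>2"
      if v: "v < n" for v
    proof -
      have "A - {v} = (A \<inter> {..<v} - {v}) \<union> (A \<inter> {v<..} - {v})" by auto
      then have "star v A = S1 v \<union> S2 v" unfolding S1_def S2_def star_def by (metis image_Un)
      moreover have "S1 v \<inter> S2 v = {}" by (auto simp: S1_def S2_def star_def doubleton_eq_iff)
      ultimately have split: "deviation p B (star v A) = deviation p B (S1 v) + deviation p B (S2 v)"
        unfolding deviation_def using finite_subset[OF sub(1) fins] finite_subset[OF sub(2) fins]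
        by (simp add: sum.union_disjoint)
      have "degree_in (graph_of ?V B) A v = deviation p B (star v A) + p * real (card (A - {v}))"
        using v A by (subst degree_in_graph_of) (auto simp: deviation_eq card_star)
      \<comment> \<open>A vertex of \<open>A\<close> is not its own neighbour; this is the origin of
        the third term \<open>3 * p\<^sup>2\<close>.\<close>
      moreover have "p * real (card A) = p * real (card (A - {v})) + p * of_bool (v \<in> A)"
        using fin by (cases "v \<in> A") (simp_all add: card_Suc_Diff1[symmetric, of A v] algebra_simps del: card_Diff_insert)
      ultimately have eq: "degree_in (graph_of ?V B) A v - p * real (card A) =
        deviation p B (S1 v) + deviation p B (S2 v) - p * of_bool (v \<in> A)" by (simp add: split)
      have sq3: "(x + y - z)\<^sup>2 \<le> 3 * x\<^sup>2 + 3 * y\<^sup>2 + 3 * z\<^sup>2" for x y z :: real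
        using zero_le_power2[of "x - y"] zero_le_power2[of "x + z"] zero_le_power2[of "y + z"]
        by (simp add: power2_eq_square algebra_simps)
      have "(p * of_bool (v \<in> A))\<^sup>2 \<le> p\<^sup>2" by simp
      then show ?thesis
        unfolding eq using sq3[of "deviation p B (S1 v)" "deviation p B (S2 v)" "p * of_bool (v \<in> A)"] by linarith
    qed
    have "243 * (real n)\<^sup>2 * p < (\<Sum>v<n. 3 * (deviation p B (S1 v))\<^sup>2 + 3 * (deviation p B (S2 v))\<^sup>2 + 3 * p\<^sup>2)"
      using big by (rule less_le_trans) (intro sum_mono pt, simp)
    also have "\<dots> = 3 * (\<Sum>v<n. (deviation p B (S1 v))\<^sup>2) + 3 * (\<Sum>v<n. (deviation p B (S2 v))\<^sup>2) + 3 * (real n * p\<^sup>2)"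
      by (simp add: sum.distrib sum_distrib_left)
    finally have "243 * (real n)\<^sup>2 * p < \<dots>" .
    moreover have "real n * p\<^sup>2 \<le> (real n)\<^sup>2 * p"
    proof -
      have "p * (real n * p) \<le> real n * (real n * p)" using n p np by (intro mult_right_mono) auto
      then show ?thesis by (simp add: power2_eq_square ac_simps)
    qed
    ultimately have "T \<le> (\<Sum>v<n. (deviation p B (S1 v))\<^sup>2) \<or> T \<le> (\<Sum>v<n. (deviation p B (S2 v))\<^sup>2)"
      unfolding T_def by linarith
    then show "B \<in> bad S1 \<union> bad S2"
      unfolding bad_def using small sub by (auto simp: deviation_def)
  qed simp
  also have "\<dots> \<le> measure_pmf.prob ?P (bad S1) + measure_pmf.prob ?P (bad S2)" by (intro measure_Un_le) auto
  finally show ?thesis using tails by simp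
qed

text \<open>Union bound over vertices, ordered pairs and all vertex sets; the 2^n sets turn 8^n into
  16^n. The discrepancy is estimated only where the degrees are regular, the other graphs being
  discarded already by \<open>bad1\<close>.\<close>

lemma random_graph_pseudorandom:
  fixes n :: nat and p t :: real
  assumes p: "0 \<le> p" "p \<le> 1" and np: "1 \<le> real n * p" and n: "4 \<le> n"
  shows "1 - (2 * real n * exp (- (real n * p / 64)) + (real n)\<^sup>2 * exp (2 * (real n * p\<^sup>2) - t) +
      2 * (16 ^ n * exp (- 5 * real n))) \<le>
    measure_pmf.prob (random_graph n p) {E. E \<subseteq> vertex_pairs {..<n} \<and>
      (\<forall>v<n. real n * p / 2 \<le> degree_in E {..<n} v \<and> degree_in E {..<n} v \<le> 2 * (real n * p)) \<and>
      (\<forall>A\<subseteq>{..<n}. (\<Sum>v<n. (degree_in E A v - p * real (card A))\<^sup>2) \<le> 243 * (real n)\<^sup>2 * p) \<and>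
      (\<forall>v<n. \<forall>w<n. v \<noteq> w \<longrightarrow> degree_in E (neighbours E v) w \<le> t)}"
    (is "1 - ?b \<le> measure_pmf.prob _ ?G")
proof -
  let ?P = "independent_bits (vertex_pairs {..<n}) (\<lambda>_. p)"
  let ?V = "{..<n}"
  define bad1 where "bad1 = (\<lambda>v. {B. real n * p / 4 \<le> \<bar>deviation p B (star v ?V)\<bar>})"
  define bad2 where "bad2 = (\<lambda>(v, w). {B. t \<le> degree_in (graph_of ?V B) (neighbours (graph_of ?V B) v) w})"
  define bad3 where "bad3 = (\<lambda>A. {B. (\<forall>v<n. \<bar>deviation p B (star v ?V)\<bar> \<le> real n * p / 4) \<and>
        243 * (real n)\<^sup>2 * p < (\<Sum>v<n. (degree_in (graph_of ?V B) A v - p * real (card A))\<^sup>2)})"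
  define W where "W = {(v, w) \<in> ?V \<times> ?V. v \<noteq> w}"
  define Bad where "Bad = (\<Union>v\<in>?V. bad1 v) \<union> (\<Union>x\<in>W. bad2 x) \<union> (\<Union>A\<in>Pow ?V. bad3 A)"
  have W: "finite W" "card W \<le> n * n"
    using card_mono[of "?V \<times> ?V" W] by (auto simp: W_def intro: finite_subset[of _ "?V \<times> ?V"])
  have "measure_pmf.prob ?P (\<Union>v\<in>?V. bad1 v) \<le> real (card ?V) * (2 * exp (- (real n * p / 64)))"
    unfolding bad1_def using degree_deviation_tail[of ?V p] p by (intro prob_UN_le) auto
  then have "measure_pmf.prob ?P (\<Union>v\<in>?V. bad1 v) \<le> 2 * real n * exp (- (real n * p / 64))"
    by (simp add: ac_simps)
  moreover have "measure_pmf.prob ?P (\<Union>x\<in>W. bad2 x) \<le> real (card W) * exp (2 * (real n * p\<^sup>2) - t)"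
    using codegree_tail[of ?V p] p W by (intro prob_UN_le) (auto simp: bad2_def W_def)
  moreover have "real (card W) * exp (2 * (real n * p\<^sup>2) - t) \<le> (real n)\<^sup>2 * exp (2 * (real n * p\<^sup>2) - t)"
    using W(2) by (intro mult_right_mono) (auto simp: power2_eq_square simp flip: of_nat_mult)
  moreover have "measure_pmf.prob ?P (\<Union>A\<in>Pow ?V. bad3 A) \<le> real (card (Pow ?V)) * (2 * (8 ^ n * exp (- 5 * real n)))"
    unfolding bad3_def using p np by (intro prob_UN_le discrepancy_tail) auto
  moreover have "real (card (Pow ?V)) * (2 * (8 ^ n * exp (- 5 * real n))) = 2 * (16 ^ n * exp (- 5 * real n))"
  proof -
    have "(2 :: real) ^ n * 8 ^ n = 16 ^ n" by (simp flip: power_mult_distrib)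
    then show ?thesis by (simp add: card_Pow)
  qed
  moreover have "measure_pmf.prob ?P Bad \<le> measure_pmf.prob ?P (\<Union>v\<in>?V. bad1 v) +
     measure_pmf.prob ?P (\<Union>x\<in>W. bad2 x) + measure_pmf.prob ?P (\<Union>A\<in>Pow ?V. bad3 A)"
    unfolding Bad_def by (intro order_trans[OF measure_Un_le] add_right_mono measure_Un_le) auto
  ultimately have "measure_pmf.prob ?P Bad \<le> ?b" by linarith
  then have "1 - ?b \<le> 1 - measure_pmf.prob ?P Bad" by simp
  also have "\<dots> = measure_pmf.prob ?P (- Bad)"
    using measure_pmf.prob_compl[of Bad ?P] by (simp add: Compl_eq_Diff_UNIV)
  also have "\<dots> \<le> measure_pmf.prob ?P (graph_of ?V -` ?G)"
  proof (intro measure_pmf.finite_measure_mono subsetI)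
    fix B assume B: "B \<in> - Bad"
    have dev: "\<bar>deviation p B (star v ?V)\<bar> < real n * p / 4" if "v < n" for v
      using B that by (auto simp: Bad_def bad1_def not_le)
    have cod: "degree_in (graph_of ?V B) (neighbours (graph_of ?V B) v) w \<le> t" if "v < n" "w < n" "v \<noteq> w" for v w
    proof -
      have "(v, w) \<in> W" using that by (simp add: W_def)
      then have "B \<notin> bad2 (v, w)" using B by (auto simp: Bad_def)
      then show ?thesis by (simp add: bad2_def)
    qed
    have disc: "(\<Sum>v<n. (degree_in (graph_of ?V B) A v - p * real (card A))\<^sup>2) \<le> 243 * (real n)\<^sup>2 * p" if "A \<subseteq> ?V" for A
    proof -
      have "B \<notin> bad3 A" using B that by (auto simp: Bad_def)
      then show ?thesis using dev by (force simp: bad3_def not_less)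
    qed
    have deg: "real n * p / 2 \<le> degree_in (graph_of ?V B) ?V v \<and> degree_in (graph_of ?V B) ?V v \<le> 2 * (real n * p)" if "v < n" for v
    proof -
      have "degree_in (graph_of ?V B) ?V v = deviation p B (star v ?V) + p * real (card (?V - {v}))"
        using that by (subst degree_in_graph_of) (auto simp: deviation_eq card_star)
      moreover have "real (card (?V - {v})) = real n - 1" using that n by (simp add: of_nat_diff)
      ultimately have "degree_in (graph_of ?V B) ?V v = deviation p B (star v ?V) + (real n * p - p)"
        by (simp add: algebra_simps)
      \<comment> \<open>The mean degree is (n - 1) p; the missing p is at most a quarter of n p, and
        the deviation takes another quarter.\<close>
      moreover have "4 * p \<le> real n * p" using p n by (intro mult_right_mono) auto
      ultimately show ?thesis using dev[OF that] p by linarith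
    qed
    show "B \<in> graph_of ?V -` ?G"
      using dev cod disc deg by (auto simp: graph_of_def[of ?V B, symmetric]) (simp add: graph_of_def)
  qed simp
  also have "\<dots> = measure_pmf.prob (random_graph n p) ?G"
    unfolding random_graph_def graph_of_def[symmetric] by simp
  finally show ?thesis .
qed

section \<open>Choice of the constants and conclusion\<close>

lemma failure_prob_small:
  fixes a :: real
  assumes "a > 0"
  shows "\<forall>\<^sub>F n in sequentially. 2 * real n * exp (- (a * sqrt (real n))) + (real n)\<^sup>2 * exp (- (a * sqrt (real n))) +
    2 * (1 / 2) ^ n \<le> real n powr (- 1)"
proof -
  have "(\<lambda>n. real n * (2 * real n * exp (- (a * sqrt (real n))) + (real n)\<^sup>2 * exp (- (a * sqrt (real n))) +
    2 * (1 / 2) ^ n)) \<longlonglongrightarrow> 0"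
    using assms by real_asymp
  then have "\<forall>\<^sub>F n in sequentially. real n * (2 * real n * exp (- (a * sqrt (real n))) +
    (real n)\<^sup>2 * exp (- (a * sqrt (real n))) + 2 * (1 / 2) ^ n) < 1"
    by (rule order_tendstoD(2)) simp
  then show ?thesis
    using eventually_gt_at_top[of 0]
    by eventually_elim (simp add: powr_minus_divide pos_le_divide_eq mult.commute)
qed

theorem corollary1p15:
  fixes k :: nat and p :: "nat \<Rightarrow> real"
  assumes "k \<ge> 2"
    and "\<And>n. 0 \<le> p n \<and> p n \<le> 1"
    and "p \<in> \<Omega>(\<lambda>n. 1 / sqrt (real n))"
  shows "\<exists>C>0. \<exists>c>0. \<exists>c'>0. \<forall>\<^sub>F n in sequentially.
    measure_pmf.prob (random_graph n (p n))
      {E. \<forall>A \<subseteq> {..<n}.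
         measure (voting_space k {..<n} E)
           {\<omega> \<in> space (voting_space k {..<n} E).
              ereal_of_enat (consensus_time {..<n} A \<omega>) \<le> ereal (C * ln (real n))}
         \<ge> 1 - real n powr (- c')}
    \<ge> 1 - real n powr (- c)"
proof -
  obtain \<delta> where \<delta>: "\<delta> > 0" "\<forall>\<^sub>F n in sequentially. norm (p n) \<ge> \<delta> * norm (1 / sqrt (real n))"
    using assms(3) by (rule landau_omega.bigE)
  define \<epsilon> :: real where "\<epsilon> = ((1 / 2) ^ (k - 2) / (8 * (real k)\<^sup>2))\<^sup>2"
  \<comment> \<open>243 is the discrepancy constant of the random graph; \<eta> and \<kappa> are
    dictated by \<open>pseudorandom_voting_expander\<close> for L = 243 and c = \<delta>.\<close>
  define \<eta> where "\<eta> = \<epsilon>\<^sup>2 / (512 * 243)"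
  define \<kappa> where "\<kappa> = 16 * 243 / \<delta>"
  define b :: real where "b = (1 / 2) ^ (k - 2) / 2"
  \<comment> \<open>The least value that satisfies the three lower bounds on R in
    \<open>consensus_time_bound\<close>; it depends on k and \<delta> only.\<close>
  define R where "R = max 1 (max (32 * \<kappa> * (real k)\<^sup>2 / b) (256 / b\<^sup>2))"
  define \<mu> where "\<mu> = 192 * 4 ^ k * (R + 1)"
  define \<gamma> where "\<gamma> = min (b / 16) (exp (- 4 * \<mu>\<^sup>2) / 8)"
  have "0 < \<epsilon>" using assms(1) by (simp add: \<epsilon>_def)
  moreover have "0 < b" by (simp add: b_def)
  moreover have "0 < \<eta>" using \<open>0 < \<epsilon>\<close> by (simp add: \<eta>_def)
  moreover have "0 < \<gamma>" using \<open>0 < b\<close> unfolding \<gamma>_def by (simp only: min_less_iff_conj) simp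
  ultimately have pos: "0 < \<epsilon>" "0 < \<eta>" "0 < b" "0 < \<gamma>" by blast+
  have R: "1 \<le> R" "32 * \<kappa> * (real k)\<^sup>2 \<le> b * R" "256 / b\<^sup>2 \<le> R"
  proof -
    have "32 * \<kappa> * (real k)\<^sup>2 / b \<le> R" by (simp add: R_def)
    then show "32 * \<kappa> * (real k)\<^sup>2 \<le> b * R" using pos by (simp add: pos_divide_le_eq mult.commute)
  qed (simp_all add: R_def)
  have "filterlim (\<lambda>n. sqrt (real n)) at_top sequentially" by real_asymp
  then have large: "\<forall>\<^sub>F n in sequentially. x \<le> sqrt (real n)" for x
    by (simp add: filterlim_at_top)
  define a where "a = min (\<delta> / 64) (\<eta> * \<delta> ^ 3 / 2)"
  have a: "0 < a" using \<delta>(1) pos by (simp add: a_def)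
  have "\<forall>\<^sub>F n in sequentially.
    measure_pmf.prob (random_graph n (p n))
      {E. \<forall>A \<subseteq> {..<n}.
         measure (voting_space k {..<n} E)
           {\<omega> \<in> space (voting_space k {..<n} E).
              ereal_of_enat (consensus_time {..<n} A \<omega>) \<le> ereal ((3 / \<gamma> + 1) * ln (real n))}
         \<ge> 1 - real n powr (- 1)}
    \<ge> 1 - real n powr (- 1)"
    using \<delta>(2) large[of "4 * R"] large[of "128 * \<kappa>"] large[of "8 * \<mu>"] large[of "1 / \<delta>"]
      large[of "4 / (\<epsilon> * \<delta>)"] large[of "4 / (\<eta> * \<delta>)"] large[of "exp 1"] eventually_ge_at_top[of 4]
      failure_prob_small[OF a]
  proof eventually_elim
    case (elim n)
    let ?q = "p n" and ?r = "sqrt (real n)"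
    have r: "?r > 0" "?r * ?r = real n" using elim(9) by auto
    have q: "0 \<le> ?q" "?q \<le> 1" using assms(2) by auto
    have qr: "\<delta> \<le> ?q * ?r" using elim(1) q r by (simp add: divide_le_eq)
    then have "0 < ?q * ?r" using \<delta>(1) by linarith
    then have "0 < ?q" using r by (simp add: zero_less_mult_iff)
    have nq: "\<delta> * ?r \<le> real n * ?q"
      using mult_right_mono[OF qr, of ?r] r(1) unfolding mult.assoc r(2) by (simp add: mult.commute)
    have ge: "x \<le> y * (real n * ?q)" if "x / (y * \<delta>) \<le> ?r" "0 < y" for x y
    proof -
      have "x \<le> y * \<delta> * ?r" using that \<delta>(1) by (simp add: pos_divide_le_eq mult.commute)
      also have "\<dots> \<le> y * (real n * ?q)" using mult_left_mono[OF nq, of y] that by (simp add: mult.assoc)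
      finally show ?thesis .
    qed
    have n1: "1 \<le> real n * ?q" using ge[of 1 1] elim(5) by simp
    have n2: "4 \<le> real n * ?q * \<epsilon>" using ge[of 4 \<epsilon>] elim(6) pos by (simp add: mult.commute)
    have n3: "4 \<le> \<eta> * (real n * ?q)" using ge[of 4 \<eta>] elim(7) pos by simp
    have "?r \<le> real n" using r elim(9) mult_left_mono[of 1 ?r ?r] by simp
    then have e: "exp 1 \<le> real n" using elim(8) by linarith
    let ?t = "\<eta> * (real n)\<^sup>2 * ?q ^ 3"
    define G where "G = {E. E \<subseteq> vertex_pairs {..<n} \<and>
      (\<forall>v<n. real n * ?q / 2 \<le> degree_in E {..<n} v \<and> degree_in E {..<n} v \<le> 2 * (real n * ?q)) \<and>
      (\<forall>A\<subseteq>{..<n}. (\<Sum>v<n. (degree_in E A v - ?q * real (card A))\<^sup>2) \<le> 243 * (real n)\<^sup>2 * ?q) \<and>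
      (\<forall>v<n. \<forall>w<n. v \<noteq> w \<longrightarrow> degree_in E (neighbours E v) w \<le> ?t)}"
    have "1 - real n powr (- 1) \<le> 1 - (2 * real n * exp (- (real n * ?q / 64)) +
      (real n)\<^sup>2 * exp (2 * (real n * ?q\<^sup>2) - ?t) + 2 * (16 ^ n * exp (- 5 * real n)))"
    proof -
      have "a * ?r \<le> \<delta> / 64 * ?r" using r by (intro mult_right_mono) (auto simp: a_def)
      also have "\<dots> \<le> real n * ?q / 64" using nq by simp
      finally have "exp (- (real n * ?q / 64)) \<le> exp (- (a * ?r))" by simp
      then have 1: "2 * real n * exp (- (real n * ?q / 64)) \<le> 2 * real n * exp (- (a * ?r))"
        by (rule mult_left_mono) simp
      \<comment> \<open>The codegree threshold exceeds the typical size n p^2 by the factor \<eta> n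
        p, which is at least 4 here, so half of the threshold survives in the exponent; it is at
        least of order sqrt n.\<close>
      have "4 * (real n * ?q\<^sup>2) \<le> \<eta> * (real n * ?q) * (real n * ?q\<^sup>2)"
        using n3 by (rule mult_right_mono) simp
      also have "\<dots> = ?t" by (simp add: power2_eq_square power3_eq_cube)
      finally have t1: "2 * (real n * ?q\<^sup>2) - ?t \<le> - (?t / 2)" by simp
      have "\<eta> * \<delta> ^ 3 * ?r \<le> \<eta> * (?q * ?r) ^ 3 * ?r"
        using pos r \<delta>(1) qr by (intro mult_right_mono mult_left_mono power_mono) auto
      also have "\<dots> = \<eta> * (?r * ?r)\<^sup>2 * ?q ^ 3" by (simp add: power2_eq_square power3_eq_cube del: real_sqrt_mult_self)
      also have "\<dots> = ?t" unfolding r ..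
      finally have "\<eta> * \<delta> ^ 3 / 2 * ?r \<le> ?t / 2" by simp
      moreover have "a * ?r \<le> \<eta> * \<delta> ^ 3 / 2 * ?r" using r by (intro mult_right_mono) (auto simp: a_def)
      ultimately have "2 * (real n * ?q\<^sup>2) - ?t \<le> - (a * ?r)" using t1 by linarith
      then have "exp (2 * (real n * ?q\<^sup>2) - ?t) \<le> exp (- (a * ?r))" by (rule exp_mono)
      then have 2: "(real n)\<^sup>2 * exp (2 * (real n * ?q\<^sup>2) - ?t) \<le> (real n)\<^sup>2 * exp (- (a * ?r))"
        by (rule mult_left_mono) simp
      \<comment> \<open>With this crude bound the rate 5 makes 16^n exp (- 5 n) at most
        2^(-n).\<close>
      have "exp (- 1 :: real) \<le> 1 / 2"
        using exp_ge_add_one_self[of 1] unfolding exp_minus by (simp add: field_simps)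
      then have "exp (- 1 :: real) ^ 5 \<le> (1 / 2) ^ 5" by (rule power_mono) simp
      then have "exp (- 1 :: real) ^ 5 \<le> 1 / 32" by (simp add: power_divide)
      moreover have "exp (- 1 :: real) ^ 5 = exp (- 5)" unfolding exp_of_nat_mult[symmetric] by simp
      ultimately have "16 * exp (- 5 :: real) \<le> 1 / 2" by linarith
      then have "(16 * exp (- 5 :: real)) ^ n \<le> (1 / 2) ^ n" by (rule power_mono) simp
      moreover have "exp (- 5 * real n) = exp (- 5) ^ n"
        unfolding exp_of_nat_mult[symmetric] by (simp add: mult.commute)
      ultimately have 3: "16 ^ n * exp (- 5 * real n) \<le> (1 / 2) ^ n" by (simp only: power_mult_distrib)
      show ?thesis using 1 2 3 elim(10) by linarith
    qed
    also have "\<dots> \<le> measure_pmf.prob (random_graph n ?q) G"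
      unfolding G_def by (rule random_graph_pseudorandom[OF q n1 elim(9)])
    also have "\<dots> \<le> measure_pmf.prob (random_graph n ?q)
      {E. \<forall>A \<subseteq> {..<n}.
         measure (voting_space k {..<n} E)
           {\<omega> \<in> space (voting_space k {..<n} E).
              ereal_of_enat (consensus_time {..<n} A \<omega>) \<le> ereal ((3 / \<gamma> + 1) * ln (real n))}
         \<ge> 1 - real n powr (- 1)}"
    proof (intro measure_pmf.finite_measure_mono subsetI CollectI allI impI)
      fix E A assume E: "E \<in> G" and A: "A \<subseteq> {..<n}"
      interpret voting_expander "{..<n}" E "\<lambda>v. degree_in E {..<n} v / (\<Sum>w<n. degree_in E {..<n} w)" k \<kappa>
        unfolding \<kappa>_def
      proof (rule pseudorandom_voting_expander)
        show "512 * 243 * \<eta> = (((1 / 2) ^ (k - 2) / (8 * (real k)\<^sup>2))\<^sup>2)\<^sup>2"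
          by (simp only: \<eta>_def \<epsilon>_def[symmetric])
        show "4 \<le> real (card {..<n}) * ?q * ((1 / 2) ^ (k - 2) / (8 * (real k)\<^sup>2))\<^sup>2"
          using n2 by (simp only: \<epsilon>_def[symmetric] card_lessThan)
        show "\<delta> \<le> ?q * sqrt (real (card {..<n}))" using qr by simp
        have "0 \<in> {..<n}" using elim(9) by simp
        then show "{..<n} \<noteq> {}" by blast
      qed (use E assms(1) \<open>0 < ?q\<close> \<delta>(1) elim(9) in \<open>auto simp: G_def\<close>)
      show "1 - real n powr (- 1) \<le> measure (voting_space k {..<n} E)
        {\<omega> \<in> space (voting_space k {..<n} E).
           ereal_of_enat (consensus_time {..<n} A \<omega>) \<le> ereal ((3 / \<gamma> + 1) * ln (real n))}"
        using consensus_time_bound[OF A R(1) R(2,3)[unfolded b_def], of \<mu>] elim(2-4) e \<mu>_def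
        unfolding \<gamma>_def b_def card_lessThan by blast
    qed simp
    finally show ?case .
  qed
  moreover have "3 / \<gamma> + 1 > 0" using pos by (simp add: add_pos_pos)
  ultimately show ?thesis using zero_less_one by blast
qed

end
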